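(* Let $m\geq2$, let $k_1=1$ and let $k_2,\dots,k_m\geq 2$ be integers, let $P(z)\in\mathbb{K}[z]$ be a polynomial of degree $d\geq 2$, and let $Y=\{y_1y_2^{k_2}\cdots y_m^{k_m}=P(z)\}\subset\mathbb{K}^{m+1}$. Then the group $\mathrm{Aut}(Y)$ is not solvable if and only if there are five pairwise distinct indices $i_1,i_2,i_3,i_4,i_5\in\{1,\dots,m\}$ such that $k_{i_1}=k_{i_2}=k_{i_3}=k_{i_4}=k_{i_5}$.
   Context: $\mathbb{K}$ is an algebraically closed field of characteristic zero. $\mathrm{Aut}(Y)$ is the group of automorphisms of the affine variety $Y$. *)

theory Defs
  imports
    "HOL-Algebra.Bij"
    "HOL-Algebra.Solvable_Groups"
    "HOL-Computational_Algebra.Polynomial"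
    "HOL-Library.Poly_Mapping"
begin

section \<open>Polynomials in several variables\<close>

text \<open>
  A polynomial in the variables $X_i$, $i \in \mathbb{N}$, is a finitely supported map from
  exponent vectors to coefficients; \<open>mpolys n\<close> is the ring $K[X_1,\dots,X_n]$.
\<close>

type_synonym 'a mpoly = "(nat \<Rightarrow>\<^sub>0 nat) \<Rightarrow>\<^sub>0 'a"

definition mpolys :: "nat \<Rightarrow> 'a::comm_ring_1 mpoly set"
  where "mpolys n = {p. \<forall>e \<in> Poly_Mapping.keys p. Poly_Mapping.keys e \<subseteq> {1..n}}"

definition mono_eval :: "(nat \<Rightarrow>\<^sub>0 nat) \<Rightarrow> (nat \<Rightarrow> 'a::comm_ring_1) \<Rightarrow> 'a"
  where "mono_eval e x = (\<Prod>i \<in> Poly_Mapping.keys e. x i ^ Poly_Mapping.lookup e i)"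

definition mpoly_eval :: "'a::comm_ring_1 mpoly \<Rightarrow> (nat \<Rightarrow> 'a) \<Rightarrow> 'a"
  where "mpoly_eval p x = (\<Sum>e \<in> Poly_Mapping.keys p. Poly_Mapping.lookup p e * mono_eval e x)"


section \<open>Automorphism groups of affine varieties\<close>

text \<open>
  Points of $K^n$ are functions on \<open>{1..n}\<close>, made extensional (\<open>undefined\<close> elsewhere)
  so that equality of points is equality of coordinates.
\<close>

definition affine_space :: "nat \<Rightarrow> (nat \<Rightarrow> 'a) set"
  where "affine_space n = {1..n} \<rightarrow>\<^sub>E UNIV"

text \<open>
  A map from a closed subvariety \<open>V\<close> of $K^n$ to $K^n$ is regular iff each of its coordinates
  is the restriction to \<open>V\<close> of a polynomial. An automorphism of \<open>V\<close> is a regular bijection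
  of \<open>V\<close> with regular inverse; the group operation is the one of the library's \<open>BijGroup V\<close>,
  composition of maps on \<open>V\<close>.
\<close>

definition regular_map ::
    "nat \<Rightarrow> (nat \<Rightarrow> 'a::comm_ring_1) set \<Rightarrow> ((nat \<Rightarrow> 'a) \<Rightarrow> (nat \<Rightarrow> 'a)) \<Rightarrow> bool"
  where "regular_map n V f \<longleftrightarrow>
    (\<forall>i \<in> {1..n}. \<exists>p \<in> mpolys n. \<forall>x \<in> V. f x i = mpoly_eval p x)"

definition variety_Aut ::
    "nat \<Rightarrow> (nat \<Rightarrow> 'a::comm_ring_1) set \<Rightarrow> ((nat \<Rightarrow> 'a) \<Rightarrow> (nat \<Rightarrow> 'a)) monoid"
  where "variety_Aut n V = (BijGroup V)
    \<lparr> carrier := {f \<in> Bij V. regular_map n V f \<and> regular_map n V (inv_into V f)} \<rparr>"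


section \<open>The hypersurface\<close>

text \<open>
  The coordinates on $K^{m+1}$ are $y_1,\dots,y_m,z$, so that $z$ is the coordinate of
  index \<open>m + 1\<close>. If $P \neq 0$ and \<open>k i = 1\<close> for some \<open>i\<close>, then the defining polynomial is
  linear in $y_i$ and irreducible, so over an algebraically closed field the automorphisms of
  its zero set correspond to those of the quotient of $K[y_1,\dots,y_m,z]$ by it.
\<close>

definition hypersurface ::
    "nat \<Rightarrow> (nat \<Rightarrow> nat) \<Rightarrow> 'a::comm_ring_1 poly \<Rightarrow> (nat \<Rightarrow> 'a) set"
  where "hypersurface m k P =
    {x \<in> affine_space (m + 1). (\<Prod>i = 1..m. x i ^ k i) = poly P (x (m + 1))}"


section \<open>The automorphisms of a variety form a group\<close>

lemma mono_eval_superset: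
  assumes "finite A" "Poly_Mapping.keys e \<subseteq> A"
  shows "mono_eval e x = (\<Prod>i \<in> A. x i ^ Poly_Mapping.lookup e i)"
  unfolding mono_eval_def
  by (rule prod.mono_neutral_left) (use assms in \<open>auto simp: in_keys_iff\<close>)

lemma mono_eval_zero [simp]: "mono_eval 0 x = 1"
  by (simp add: mono_eval_def)

lemma mono_eval_add: "mono_eval (d + e) x = mono_eval d x * mono_eval e x"
proof -
  let ?A = "Poly_Mapping.keys d \<union> Poly_Mapping.keys e"
  have "mono_eval (d + e) x = (\<Prod>i \<in> ?A. x i ^ Poly_Mapping.lookup (d + e) i)"
    by (rule mono_eval_superset) (simp_all add: Poly_Mapping.keys_add)
  also have "\<dots> = (\<Prod>i \<in> ?A. x i ^ Poly_Mapping.lookup d i) *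
      (\<Prod>i \<in> ?A. x i ^ Poly_Mapping.lookup e i)"
    by (simp add: lookup_add power_add prod.distrib)
  also have "\<dots> = mono_eval d x * mono_eval e x"
    by (subst (1 2) mono_eval_superset[of ?A]) auto
  finally show ?thesis .
qed

lemma mpoly_eval_superset:
  assumes "finite A" "Poly_Mapping.keys p \<subseteq> A"
  shows "mpoly_eval p x = (\<Sum>e \<in> A. Poly_Mapping.lookup p e * mono_eval e x)"
  unfolding mpoly_eval_def
  by (rule sum.mono_neutral_left) (use assms in \<open>auto simp: in_keys_iff\<close>)

lemma mpoly_eval_zero [simp]: "mpoly_eval 0 x = 0"
  by (simp add: mpoly_eval_def)

lemma mpoly_eval_single [simp]: "mpoly_eval (Poly_Mapping.single e c) x = c * mono_eval e x"
  by (subst mpoly_eval_superset[of "{e}"]) (auto split: if_splits)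

lemma mpoly_eval_add: "mpoly_eval (p + q) x = mpoly_eval p x + mpoly_eval q x"
proof -
  let ?A = "Poly_Mapping.keys p \<union> Poly_Mapping.keys q"
  have "mpoly_eval (p + q) x = (\<Sum>e \<in> ?A. Poly_Mapping.lookup (p + q) e * mono_eval e x)"
    by (rule mpoly_eval_superset) (simp_all add: Poly_Mapping.keys_add)
  also have "\<dots> = (\<Sum>e \<in> ?A. Poly_Mapping.lookup p e * mono_eval e x) +
      (\<Sum>e \<in> ?A. Poly_Mapping.lookup q e * mono_eval e x)"
    by (simp add: lookup_add algebra_simps sum.distrib)
  also have "\<dots> = mpoly_eval p x + mpoly_eval q x"
    by (subst (1 2) mpoly_eval_superset[of ?A]) auto
  finally show ?thesis .
qed

lemma mpoly_eval_sum: "mpoly_eval (sum f A) x = (\<Sum>a \<in> A. mpoly_eval (f a) x)"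
  by (induction A rule: infinite_finite_induct) (auto simp: mpoly_eval_add)

lemma mpoly_sum_monomials: "p = (\<Sum>e \<in> Poly_Mapping.keys p. Poly_Mapping.single e (Poly_Mapping.lookup p e))"
  for p :: "'a::comm_ring_1 mpoly"
  by (rule poly_mapping_eqI) (auto simp: lookup_sum lookup_single when_def in_keys_iff)

lemma mpoly_eval_mult: "mpoly_eval (p * q) x = mpoly_eval p x * mpoly_eval q x"
proof -
  have "p * q = (\<Sum>d \<in> Poly_Mapping.keys p. Poly_Mapping.single d (Poly_Mapping.lookup p d)) *
      (\<Sum>e \<in> Poly_Mapping.keys q. Poly_Mapping.single e (Poly_Mapping.lookup q e))"
    by (rule arg_cong2[of _ _ _ _ "(*)"]) (rule mpoly_sum_monomials)+
  also have "\<dots> = (\<Sum>d \<in> Poly_Mapping.keys p. \<Sum>e \<in> Poly_Mapping.keys q.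
      Poly_Mapping.single (d + e) (Poly_Mapping.lookup p d * Poly_Mapping.lookup q e))"
    by (simp add: sum_product mult_single)
  finally have "mpoly_eval (p * q) x = (\<Sum>d \<in> Poly_Mapping.keys p. \<Sum>e \<in> Poly_Mapping.keys q.
      (Poly_Mapping.lookup p d * mono_eval d x) * (Poly_Mapping.lookup q e * mono_eval e x))"
    by (simp add: mpoly_eval_sum mono_eval_add mult_ac)
  then show ?thesis
    by (simp add: sum_product mpoly_eval_def)
qed

lemma mpolys_single:
  assumes "Poly_Mapping.keys e \<subseteq> {1..n}"
  shows "Poly_Mapping.single e c \<in> mpolys n"
  using assms by (auto simp: mpolys_def split: if_splits)

lemma mpolys_add: "p \<in> mpolys n \<Longrightarrow> q \<in> mpolys n \<Longrightarrow> p + q \<in> mpolys n"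
  using Poly_Mapping.keys_add[of p q] by (fastforce simp: mpolys_def)

lemma mpolys_mult:
  assumes "p \<in> mpolys n" "q \<in> mpolys n"
  shows "p * q \<in> mpolys n"
proof -
  have "Poly_Mapping.keys e \<subseteq> {1..n}" if "e \<in> Poly_Mapping.keys (p * q)" for e
  proof -
    obtain a b where "e = a + b" "a \<in> Poly_Mapping.keys p" "b \<in> Poly_Mapping.keys q"
      using \<open>e \<in> Poly_Mapping.keys (p * q)\<close> keys_mult[of p q] by blast
    then show ?thesis
      using assms Poly_Mapping.keys_add[of a b] by (fastforce simp: mpolys_def)
  qed
  then show ?thesis by (simp add: mpolys_def)
qed

definition regular_fun :: "nat \<Rightarrow> (nat \<Rightarrow> 'a::comm_ring_1) set \<Rightarrow> ((nat \<Rightarrow> 'a) \<Rightarrow> 'a) \<Rightarrow> bool"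
  where "regular_fun n V g \<longleftrightarrow> (\<exists>p \<in> mpolys n. \<forall>x \<in> V. g x = mpoly_eval p x)"

lemma regular_map_iff: "regular_map n V f \<longleftrightarrow> (\<forall>i \<in> {1..n}. regular_fun n V (\<lambda>x. f x i))"
  by (simp add: regular_map_def regular_fun_def)

lemma regular_fun_const: "regular_fun n V (\<lambda>x. c)"
  unfolding regular_fun_def
  by (rule bexI[of _ "Poly_Mapping.single 0 c"]) (auto intro: mpolys_single)

lemma regular_fun_coord:
  assumes "i \<in> {1..n}"
  shows "regular_fun n V (\<lambda>x. x i)"
  unfolding regular_fun_def
  by (rule bexI[of _ "Poly_Mapping.single (Poly_Mapping.single i 1) 1"])
    (use assms in \<open>auto intro: mpolys_single simp: mono_eval_def\<close>)

lemma regular_fun_add: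
  assumes "regular_fun n V f" "regular_fun n V g"
  shows "regular_fun n V (\<lambda>x. f x + g x)"
proof -
  obtain p q where "p \<in> mpolys n" "\<forall>x \<in> V. f x = mpoly_eval p x"
    and "q \<in> mpolys n" "\<forall>x \<in> V. g x = mpoly_eval q x"
    using assms unfolding regular_fun_def by blast
  then show ?thesis
    unfolding regular_fun_def
    by (intro bexI[of _ "p + q"]) (simp_all add: mpolys_add mpoly_eval_add)
qed

lemma regular_fun_mult:
  assumes "regular_fun n V f" "regular_fun n V g"
  shows "regular_fun n V (\<lambda>x. f x * g x)"
proof -
  obtain p q where "p \<in> mpolys n" "\<forall>x \<in> V. f x = mpoly_eval p x"
    and "q \<in> mpolys n" "\<forall>x \<in> V. g x = mpoly_eval q x"
    using assms unfolding regular_fun_def by blast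
  then show ?thesis
    unfolding regular_fun_def
    by (intro bexI[of _ "p * q"]) (simp_all add: mpolys_mult mpoly_eval_mult)
qed

lemma regular_fun_sum:
  "(\<And>a. a \<in> A \<Longrightarrow> regular_fun n V (f a)) \<Longrightarrow> regular_fun n V (\<lambda>x. \<Sum>a \<in> A. f a x)"
  by (induction A rule: infinite_finite_induct) (auto intro: regular_fun_const regular_fun_add)

lemma regular_fun_prod:
  "(\<And>a. a \<in> A \<Longrightarrow> regular_fun n V (f a)) \<Longrightarrow> regular_fun n V (\<lambda>x. \<Prod>a \<in> A. f a x)"
  by (induction A rule: infinite_finite_induct) (auto intro: regular_fun_const regular_fun_mult)

lemma regular_fun_power: "regular_fun n V f \<Longrightarrow> regular_fun n V (\<lambda>x. f x ^ k)"
  by (induction k) (auto intro: regular_fun_const regular_fun_mult)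

lemma regular_fun_mpoly_eval:
  assumes "p \<in> mpolys n" "regular_map n V f"
  shows "regular_fun n V (\<lambda>x. mpoly_eval p (f x))"
  unfolding mpoly_eval_def mono_eval_def
  by (intro regular_fun_sum regular_fun_mult regular_fun_const regular_fun_prod regular_fun_power)
    (use assms in \<open>auto simp: mpolys_def regular_map_iff\<close>)

lemma regular_map_cong:
  assumes "\<And>x. x \<in> V \<Longrightarrow> f x = g x"
  shows "regular_map n V f \<longleftrightarrow> regular_map n V g"
  using assms by (simp add: regular_map_def)

lemma regular_map_id: "regular_map n V (\<lambda>x. x)"
  by (auto simp: regular_map_iff intro: regular_fun_coord)

lemma regular_map_comp:
  assumes "regular_map n V g" "regular_map n V f" "f \<in> V \<rightarrow> V"
  shows "regular_map n V (\<lambda>x. g (f x))"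
  unfolding regular_map_iff
proof
  fix i assume "i \<in> {1..n}"
  then obtain p where p: "p \<in> mpolys n" "\<And>x. x \<in> V \<Longrightarrow> g x i = mpoly_eval p x"
    using assms(1) unfolding regular_map_def by blast
  show "regular_fun n V (\<lambda>x. g (f x) i)"
    using regular_fun_mpoly_eval[OF p(1) assms(2)] p(2) assms(3)
    unfolding regular_fun_def by (simp add: Pi_iff)
qed

lemma inv_into_eq_on:
  assumes "f \<in> Bij V" "h \<in> V \<rightarrow> V" "\<And>y. y \<in> V \<Longrightarrow> f (h y) = y" "y \<in> V"
  shows "inv_into V f y = h y"
  using assms by (intro inv_into_f_eq) (auto simp: Bij_def bij_betw_def)

lemma variety_Aut_subgroup:
  "subgroup {f \<in> Bij V. regular_map n V f \<and> regular_map n V (inv_into V f)} (BijGroup V)"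
  (is "subgroup ?A _")
proof -
  interpret B: group "BijGroup V" by (rule group_BijGroup)
  have inv_funcset: "inv_into V f \<in> V \<rightarrow> V" if "f \<in> Bij V" for f
    using Bij_inv_into_mem[OF that] by blast
  have right: "f (inv_into V f y) = y" if "f \<in> Bij V" "y \<in> V" for f y
    using that bij_betw_inv_into_right[of f V V y] by (simp add: Bij_def)
  have left: "inv_into V f (f y) = y" if "f \<in> Bij V" "y \<in> V" for f y
    using that bij_betw_inv_into_left[of f V V y] by (simp add: Bij_def)
  show ?thesis
  proof (rule B.subgroupI)
    show "?A \<subseteq> carrier (BijGroup V)"
      by (auto simp: BijGroup_def)
    have "regular_map n V (\<lambda>x \<in> V. x)"
      using regular_map_cong[of V "\<lambda>x \<in> V. x" "\<lambda>x. x" n] regular_map_id by simp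
    moreover have "inv_into V (\<lambda>x \<in> V. x) y = y" if "y \<in> V" for y
      using that left[OF id_Bij that] by simp
    then have "regular_map n V (inv_into V (\<lambda>x \<in> V. x))"
      using regular_map_cong[of V "inv_into V (\<lambda>x \<in> V. x)" "\<lambda>x. x" n] regular_map_id by simp
    ultimately have "(\<lambda>x \<in> V. x) \<in> ?A"
      using id_Bij[of V] by simp
    then show "?A \<noteq> {}" by blast
  next
    fix f assume f: "f \<in> ?A"
    let ?g = "restrict (inv_into V f) V"
    have g: "?g \<in> Bij V"
      using f by (auto intro: restrict_inv_into_Bij)
    have "regular_map n V ?g"
      using f regular_map_cong[of V ?g "inv_into V f" n] by simp
    moreover have "inv_into V ?g y = f y" if "y \<in> V" for y
      using inv_into_eq_on[OF g, of f y] that f left Bij_imp_funcset[of f V]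
      by (simp add: Pi_iff)
    then have "regular_map n V (inv_into V ?g)"
      using f regular_map_cong[of V "inv_into V ?g" f n] by simp
    moreover have "inv\<^bsub>BijGroup V\<^esub> f = ?g"
      using f by (auto intro: inv_BijGroup)
    ultimately show "inv\<^bsub>BijGroup V\<^esub> f \<in> ?A"
      using g by simp
  next
    fix f g assume f: "f \<in> ?A" and g: "g \<in> ?A"
    have fV: "f \<in> V \<rightarrow> V" and gV: "g \<in> V \<rightarrow> V"
      using f g Bij_imp_funcset by auto
    have c: "compose V f g \<in> Bij V"
      using f g by (auto intro: compose_Bij)
    have "regular_map n V (compose V f g)"
      using regular_map_comp[of n V f g] f g gV
        regular_map_cong[of V "compose V f g" "\<lambda>x. f (g x)" n]
      by (simp add: compose_def)
    moreover have "regular_map n V (inv_into V (compose V f g))"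
    proof -
      let ?h = "\<lambda>x. inv_into V g (inv_into V f x)"
      have fi: "inv_into V f x \<in> V" and gi: "inv_into V g x \<in> V" if "x \<in> V" for x
        using inv_funcset[of f] inv_funcset[of g] f g that by auto
      have "compose V f g (?h y) = y" if "y \<in> V" for y
        using right[of f y] right[of g "inv_into V f y"] fi gi that f g by (simp add: compose_def)
      then have "inv_into V (compose V f g) y = ?h y" if "y \<in> V" for y
        using inv_into_eq_on[OF c, of ?h y] fi gi that by simp
      moreover have "regular_map n V ?h"
        using regular_map_comp[of n V "inv_into V g" "inv_into V f"] f g fi by simp
      ultimately show ?thesis
        using regular_map_cong[of V "inv_into V (compose V f g)" ?h n] by simp
    qed
    moreover have "f \<otimes>\<^bsub>BijGroup V\<^esub> g = compose V f g"
      using f g by (simp add: BijGroup_def)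
    ultimately show "f \<otimes>\<^bsub>BijGroup V\<^esub> g \<in> ?A"
      using c by simp
  qed
qed

lemma group_variety_Aut: "group (variety_Aut n V)"
  unfolding variety_Aut_def
  by (rule subgroup.subgroup_is_group[OF variety_Aut_subgroup group_BijGroup])

end

theory Submission
  imports Defs "HOL-Algebra.Sym_Groups"
begin

text \<open>
  Write \<open>y\<^sup>k\<close> for the product of the \<open>y_i ^ k i\<close> with \<open>i \<ge> 2\<close>, so that \<open>V\<close> is the hypersurface
  \<open>y_1 y\<^sup>k = P(z)\<close>. Solving for \<open>y_1\<close> identifies the coordinate ring of \<open>V\<close> with the ring \<open>A\<close>
  generated by \<open>y_2, \<dots>, y_m\<close>, \<open>z\<close> and \<open>P(z) / y\<^sup>k\<close> inside the polynomials in \<open>z\<close> over the Laurent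
  polynomials in \<open>y_2, \<dots>, y_m\<close>. The theorem follows once every automorphism is known to send each
  \<open>y_i\<close> with \<open>i \<ge> 2\<close> to a scalar multiple of some \<open>y_l\<close> with \<open>k l = k i\<close>
  (\<open>Aut_permutes_coordinates\<close>).

  Given this, the automorphism group maps to the permutations of \<open>{2..m}\<close> that preserve \<open>k\<close>, a
  product of symmetric groups. If each value of \<open>k\<close> is taken at most four times, the third derived
  subgroup only scales the \<open>y_i\<close>. Commutators of such elements fix all \<open>y_i\<close>. An automorphism that
  fixes all \<open>y_i\<close> acts on the line over a point with nonzero \<open>y_i\<close> by a polynomial bijection of the
  line, hence by \<open>z \<mapsto> \<alpha> z + \<beta>\<close>. Commutators of these are translations of \<open>z\<close>, and translations
  commute, so the sixth derived subgroup is trivial. Conversely, if \<open>k\<close> takes a value on five indices,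
  none of them is \<open>1\<close>, and permuting the coordinates with these indices embeds the symmetric group of
  degree five.

  The rigidity of the \<open>y_i\<close> comes from locally nilpotent derivations. Such a derivation \<open>D\<close> defines a
  degree function on \<open>A\<close>. The ring \<open>A\<close> is graded by the exponents of the \<open>y_i\<close>, and a homogeneous
  element is a monomial in \<open>y_1, \<dots>, y_m\<close> times a polynomial in \<open>z\<close>. For homogeneous \<open>D\<close>, comparing the
  degrees of the generators with the degrees of their images, and using \<open>k i \<ge> 2\<close> and
  \<open>degree P \<ge> 2\<close>, shows that \<open>D\<close> raises the exponent of each \<open>y_i\<close> by at least \<open>k i\<close>
  (\<open>homogeneous_lnd_weight\<close>). The extreme homogeneous component of an arbitrary locally nilpotent
  derivation is again one, so the bound holds for all components (\<open>lnd_support\<close>); in particular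
  \<open>y_i\<close> divides \<open>D y_i\<close>, which forces \<open>D y_i = 0\<close> (\<open>lnd_kills_Y\<close>).

  Conjugating \<open>y\<^sup>k \<partial>/\<partial>z\<close>, whose kernel is the polynomial ring \<open>C\<close> in \<open>y_2, \<dots>, y_m\<close>, by an automorphism
  \<open>\<phi>\<close> therefore gives a derivation that kills \<open>C\<close>. So \<open>\<phi>\<close> preserves \<open>C\<close>, and comparing the two
  derivations shows that \<open>y\<^sup>k\<close> divides \<open>\<phi>(y\<^sup>k)\<close>. By symmetry \<open>\<phi>(y\<^sup>k)\<close> is a scalar multiple of \<open>y\<^sup>k\<close>
  (\<open>phi_Q\<close>), and the factors of this monomial must be permuted.
\<close>

section \<open>Locally nilpotent derivations of integral domains\<close>

text \<open>
  The derivation is a function on the whole domain, but its laws are required on the subring \<open>A\<close> only,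
  because \<open>A\<close> is a proper subset of a Laurent polynomial ring in the application.
\<close>

locale loc_nilp_deriv =
  fixes A :: "'r::{idom,ring_char_0} set" and D :: "'r \<Rightarrow> 'r"
  assumes zero_in: "0 \<in> A" and one_in: "1 \<in> A"
    and add_in: "\<And>a b. a \<in> A \<Longrightarrow> b \<in> A \<Longrightarrow> a + b \<in> A"
    and mult_in: "\<And>a b. a \<in> A \<Longrightarrow> b \<in> A \<Longrightarrow> a * b \<in> A"
    and D_in: "\<And>a. a \<in> A \<Longrightarrow> D a \<in> A"
    and D_add: "\<And>a b. a \<in> A \<Longrightarrow> b \<in> A \<Longrightarrow> D (a + b) = D a + D b"
    and D_mult: "\<And>a b. a \<in> A \<Longrightarrow> b \<in> A \<Longrightarrow> D (a * b) = D a * b + a * D b"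
    and nilpotent: "\<And>a. a \<in> A \<Longrightarrow> \<exists>n. (D ^^ n) a = 0"
begin

text \<open>
  The number of times that \<open>D\<close> can be applied before the result vanishes, less one. At zero, where the
  natural value is minus infinity, it is \<open>0\<close>; this is why \<open>deg_mult\<close> excludes zero.
\<close>

definition deg :: "'r \<Rightarrow> nat"
  where "deg a = (LEAST n. (D ^^ Suc n) a = 0)"

lemma D_zero [simp]: "D 0 = 0"
  using D_add[OF zero_in zero_in] by simp

lemma Dn_zero [simp]: "(D ^^ n) 0 = 0"
  by (induction n) auto

lemma Dn_in: "a \<in> A \<Longrightarrow> (D ^^ n) a \<in> A"
  by (induction n) (auto intro: D_in)

lemma Dn_add: "a \<in> A \<Longrightarrow> b \<in> A \<Longrightarrow> (D ^^ n) (a + b) = (D ^^ n) a + (D ^^ n) b"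
  by (induction n) (auto simp: D_add Dn_in)

lemma Dn_mono_zero: "(D ^^ n) a = 0 \<Longrightarrow> n \<le> l \<Longrightarrow> (D ^^ l) a = 0"
  using funpow_add[of "l - n" n D] by simp

lemma sum_in: "(\<And>i. i \<in> S \<Longrightarrow> f i \<in> A) \<Longrightarrow> sum f S \<in> A"
  by (induction S rule: infinite_finite_induct) (auto intro: zero_in add_in)

lemma prod_in: "(\<And>i. i \<in> S \<Longrightarrow> f i \<in> A) \<Longrightarrow> prod f S \<in> A"
  by (induction S rule: infinite_finite_induct) (auto intro: one_in mult_in)

lemma power_in: "a \<in> A \<Longrightarrow> a ^ n \<in> A"
  by (induction n) (auto intro: one_in mult_in)

lemma of_nat_in: "of_nat n \<in> A"
  by (induction n) (auto intro: zero_in one_in add_in)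

lemma D_one [simp]: "D 1 = 0"
  using D_mult[OF one_in one_in] by simp

lemma D_of_nat [simp]: "D (of_nat n) = 0"
  by (induction n) (auto simp: D_add one_in of_nat_in)

lemma D_sum: "(\<And>i. i \<in> S \<Longrightarrow> f i \<in> A) \<Longrightarrow> D (sum f S) = (\<Sum>i\<in>S. D (f i))"
  by (induction S rule: infinite_finite_induct) (auto simp: D_add sum_in)

lemma D_of_nat_mult: "a \<in> A \<Longrightarrow> D (of_nat n * a) = of_nat n * D a"
  by (simp add: D_mult of_nat_in)

lemma Leibniz:
  assumes "a \<in> A" "b \<in> A"
  shows "(D ^^ n) (a * b) = (\<Sum>i\<le>n. of_nat (n choose i) * ((D ^^ i) a * (D ^^ (n - i)) b))"
proof (induction n)
  case (Suc n)
  let ?t = "\<lambda>i j. (D ^^ i) a * (D ^^ j) b"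
  have t: "?t i j \<in> A" for i j by (simp add: assms Dn_in mult_in)
  have "(D ^^ Suc n) (a * b) = (\<Sum>i\<le>n. of_nat (n choose i) * (?t (Suc i) (n - i) + ?t i (Suc (n - i))))"
    using t by (simp add: Suc D_sum D_of_nat_mult mult_in of_nat_in D_mult assms Dn_in)
  also have "\<dots> = (\<Sum>i\<le>n. of_nat (n choose i) * ?t (Suc i) (n - i)) +
      (\<Sum>i\<le>n. of_nat (n choose i) * ?t i (Suc n - i))"
    by (simp add: distrib_left sum.distrib Suc_diff_le)
  also have "(\<Sum>i\<le>n. of_nat (n choose i) * ?t i (Suc n - i)) =
      (\<Sum>i\<le>Suc n. of_nat (n choose i) * ?t i (Suc n - i))"
    by simp
  also have "\<dots> = ?t 0 (Suc n) + (\<Sum>i\<le>n. of_nat (n choose Suc i) * ?t (Suc i) (n - i))"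
    by (subst sum.atMost_Suc_shift) simp
  also have "(\<Sum>i\<le>n. of_nat (n choose i) * ?t (Suc i) (n - i)) + \<dots> =
      ?t 0 (Suc n) + (\<Sum>i\<le>n. of_nat (Suc n choose Suc i) * ?t (Suc i) (n - i))"
    by (simp add: sum.distrib algebra_simps)
  also have "\<dots> = (\<Sum>i\<le>Suc n. of_nat (Suc n choose i) * ?t i (Suc n - i))"
    by (subst sum.atMost_Suc_shift) simp
  finally show ?case .
qed simp

lemma deg_le_iff: "a \<in> A \<Longrightarrow> deg a \<le> n \<longleftrightarrow> (D ^^ Suc n) a = 0"
proof -
  assume a: "a \<in> A"
  obtain l where "(D ^^ l) a = 0" using nilpotent[OF a] by blast
  then have "(D ^^ Suc l) a = 0" using Dn_mono_zero[of l a "Suc l"] by simp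
  then have "(D ^^ Suc (deg a)) a = 0" unfolding deg_def by (rule LeastI)
  then show ?thesis
    using Dn_mono_zero[of "Suc (deg a)" a "Suc n"] by (auto simp: deg_def Least_le simp del: funpow.simps)
qed

lemma deg_witness: "a \<in> A \<Longrightarrow> a \<noteq> 0 \<Longrightarrow> (D ^^ deg a) a \<noteq> 0"
  using deg_le_iff[of a "deg a - 1"] by (cases "deg a") auto

lemma Dn_eq_0: "a \<in> A \<Longrightarrow> deg a < n \<Longrightarrow> (D ^^ n) a = 0"
  using deg_le_iff[of a "n - 1"] by (cases n) auto

lemma deg_eqI:
  assumes "a \<in> A" "(D ^^ n) a \<noteq> 0" "(D ^^ Suc n) a = 0"
  shows "deg a = n"
  using assms Dn_eq_0[of a n] deg_le_iff[of a n] by fastforce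

text \<open>
  In the Leibniz formula for the iterate of order \<open>deg a + deg b\<close> a single term survives, and its
  binomial coefficient is nonzero in characteristic zero.
\<close>

lemma deg_mult:
  assumes "a \<in> A" "b \<in> A" "a \<noteq> 0" "b \<noteq> 0"
  shows "deg (a * b) = deg a + deg b"
proof (rule deg_eqI)
  let ?p = "deg a" and ?q = "deg b"
  have z: "(D ^^ i) a * (D ^^ (n - i)) b = 0" if "n \<ge> ?p + ?q" "i \<noteq> ?p \<or> n \<noteq> ?p + ?q" for i n
  proof -
    have "i > ?p \<or> n - i > ?q" using that by linarith
    then show ?thesis using Dn_eq_0[OF assms(1), of i] Dn_eq_0[OF assms(2), of "n - i"] by auto
  qed
  show "(D ^^ Suc (?p + ?q)) (a * b) = 0"
    unfolding Leibniz[OF assms(1,2)] by (rule sum.neutral) (use z[of "Suc (?p + ?q)"] in auto)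
  have "(D ^^ (?p + ?q)) (a * b) =
      (\<Sum>i\<in>{?p}. of_nat ((?p + ?q) choose i) * ((D ^^ i) a * (D ^^ (?p + ?q - i)) b))"
    unfolding Leibniz[OF assms(1,2)] by (rule sum.mono_neutral_right) (use z[of "?p + ?q"] in auto)
  also have "\<dots> \<noteq> 0"
    using assms deg_witness by (simp add: binomial_eq_0_iff)
  finally show "(D ^^ (?p + ?q)) (a * b) \<noteq> 0" .
qed (use assms mult_in in auto)

lemma deg_zero [simp]: "deg 0 = 0"
  using deg_le_iff[OF zero_in, of 0] by simp

lemma deg_one [simp]: "deg 1 = 0"
  using deg_le_iff[OF one_in, of 0] by simp

lemma deg_power: "a \<in> A \<Longrightarrow> a \<noteq> 0 \<Longrightarrow> deg (a ^ n) = n * deg a"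
  by (induction n) (auto simp: deg_mult power_in)

lemma deg_prod:
  "(\<And>i. i \<in> S \<Longrightarrow> f i \<in> A) \<Longrightarrow> (\<And>i. i \<in> S \<Longrightarrow> f i \<noteq> 0) \<Longrightarrow> deg (prod f S) = (\<Sum>i\<in>S. deg (f i))"
  by (induction S rule: infinite_finite_induct) (auto simp: deg_mult prod_in)

lemma deg_eq_0_iff: "a \<in> A \<Longrightarrow> deg a = 0 \<longleftrightarrow> D a = 0"
  using deg_le_iff[of a 0] by simp

text \<open>
  Degrees are natural numbers, so they vanish when they add up to \<open>deg 1 = 0\<close>.
\<close>

lemma deg_unit: "a \<in> A \<Longrightarrow> b \<in> A \<Longrightarrow> a * b = 1 \<Longrightarrow> deg a = 0"
  using deg_mult[of a b] by fastforce

lemma deg_D: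
  assumes "a \<in> A" "D a \<noteq> 0"
  shows "deg a = Suc (deg (D a))"
proof (rule deg_eqI)
  show "(D ^^ Suc (deg (D a))) a \<noteq> 0"
    using deg_witness[OF D_in[OF assms(1)] assms(2)] by (simp add: funpow_swap1)
  have "(D ^^ Suc (deg (D a))) (D a) = 0"
    using deg_le_iff[OF D_in[OF assms(1)], of "deg (D a)"] by blast
  then show "(D ^^ Suc (Suc (deg (D a)))) a = 0" by (simp add: funpow_swap1)
qed fact

lemma deg_add_less:
  assumes "a \<in> A" "b \<in> A" "deg a < deg b"
  shows "deg (a + b) = deg b"
proof (rule deg_eqI)
  have "b \<noteq> 0" using assms(3) by auto
  then show "(D ^^ deg b) (a + b) \<noteq> 0"
    using assms deg_witness by (simp add: Dn_add Dn_eq_0)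
  show "(D ^^ Suc (deg b)) (a + b) = 0"
    using assms Dn_eq_0[of a "Suc (deg b)"] Dn_eq_0[of b "Suc (deg b)"] by (simp add: Dn_add del: funpow.simps)
qed (use assms add_in in auto)

text \<open>
  Applying \<open>D\<close> lowers the degree by one, whereas a multiple of \<open>a\<close> has at least the degree of \<open>a\<close>.
\<close>

lemma kernel_if_dvd_D:
  assumes "a \<in> A" "g \<in> A" "D a = a * g"
  shows "D a = 0"
proof (rule ccontr)
  assume "D a \<noteq> 0"
  then have "deg a = Suc (deg a + deg g)"
    using assms deg_D[OF assms(1)] deg_mult[OF assms(1,2)] by auto
  then show False by simp
qed

end

section \<open>The coordinate ring as a graded subring of a Laurent polynomial ring\<close>

abbreviation "lookup \<equiv> Poly_Mapping.lookup"
abbreviation "single \<equiv> Poly_Mapping.single"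
abbreviation "keys \<equiv> Poly_Mapping.keys"

text \<open>
  Laurent polynomials in the \<open>y_i\<close> with coefficients in $K[z]$. It is an integral domain because the
  lexicographic order of the exponent vectors is compatible with addition.
\<close>

type_synonym 'a laurent = "(nat \<Rightarrow>\<^sub>0 int) \<Rightarrow>\<^sub>0 'a poly"

lemma sum_homogeneous: "b = (\<Sum>e\<in>keys b. single e (lookup b e))"
  by (rule poly_mapping_eqI) (auto simp: lookup_sum lookup_single when_def in_keys_iff)

lemma times_eq_sum_single:
  "a * b = (\<Sum>d\<in>keys a. \<Sum>e\<in>keys b. single (d + e) (lookup a d * lookup b e))"
  for a b :: "'b::comm_monoid_add \<Rightarrow>\<^sub>0 'c::comm_semiring_0"
proof -
  have "a * b = (\<Sum>d\<in>keys a. single d (lookup a d)) * (\<Sum>e\<in>keys b. single e (lookup b e))"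
    by (rule arg_cong2[of _ _ _ _ "(*)"]) (rule sum_homogeneous)+
  then show ?thesis by (simp add: sum_product mult_single)
qed

lemma single_power: "single e p ^ n = single (\<Sum>j<n. e) (p ^ n)"
  for e :: "'b::comm_monoid_add" and p :: "'c::comm_semiring_1"
  by (induction n) (simp_all add: mult_single add.commute)

lemma single_prod: "(\<Prod>i\<in>S. single (f i) (g i)) = single (\<Sum>i\<in>S. f i) (\<Prod>i\<in>S. g i)"
  for f :: "'d \<Rightarrow> 'b::comm_monoid_add" and g :: "'d \<Rightarrow> 'c::comm_semiring_1"
  by (induction S rule: infinite_finite_induct) (simp_all add: mult_single)

lemma lookup_sum_const: "lookup (\<Sum>j<n. e) i = of_nat n * lookup e i"
  for e :: "'b \<Rightarrow>\<^sub>0 'c::comm_semiring_1"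
  unfolding lookup_sum by simp

lemma single_eq_0_iff [simp]: "single e p = 0 \<longleftrightarrow> p = 0"
  by (metis lookup_single_eq lookup_zero single_zero)

locale hypersurface_algebra =
  fixes I :: "nat set" and k :: "nat \<Rightarrow> nat" and P :: "'a::field_char_0 poly"
  assumes finite_I: "finite I" and k_ge: "\<And>i. i \<in> I \<Longrightarrow> k i \<ge> 2" and degree_P: "degree P \<ge> 2"
begin

text \<open>
  The pole order of the monomial \<open>y\<^sup>e\<close>, measured in powers of \<open>y\<^sup>k\<close>: the least \<open>n\<close> for which
  \<open>y\<^sup>e (y\<^sup>k)\<^sup>n\<close> is a polynomial.
\<close>

definition pole :: "(nat \<Rightarrow>\<^sub>0 int) \<Rightarrow> nat"
  where "pole e = (LEAST n. \<forall>i\<in>I. 0 \<le> lookup e i + int n * int (k i))"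

definition exps :: "(nat \<Rightarrow>\<^sub>0 int) set"
  where "exps = {e. keys e \<subseteq> I}"

text \<open>
  The coordinate ring of the hypersurface, with \<open>P / y\<^sup>k\<close> in the place of \<open>y_1\<close>. It is graded by the
  exponent vectors: the piece of weight \<open>e\<close> is \<open>y\<^sup>e P ^ pole e\<close> times $K[z]$. Describing it by its pieces
  rather than by its generators makes membership a condition on single coefficients.
\<close>

definition A :: "'a laurent set"
  where "A = {b. \<forall>e\<in>keys b. e \<in> exps \<and> P ^ pole e dvd lookup b e}"

definition kvec :: "nat \<Rightarrow>\<^sub>0 int"
  where "kvec = (\<Sum>i\<in>I. single i (int (k i)))"

definition X :: "'a laurent" where "X = single (- kvec) P"
definition Y :: "nat \<Rightarrow> 'a laurent" where "Y i = single (single i 1) 1"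
definition Z :: "'a laurent" where "Z = single 0 [:0, 1:]"

lemma P_nonzero [simp]: "P \<noteq> 0"
  using degree_P by auto

lemma k_pos: "i \<in> I \<Longrightarrow> 0 < k i"
  using k_ge[of i] by simp

lemma lookup_kvec: "lookup kvec i = (if i \<in> I then int (k i) else 0)"
  using finite_I by (simp add: kvec_def lookup_sum lookup_single when_def)

lemma pole_ge: "i \<in> I \<Longrightarrow> 0 \<le> lookup e i + int (pole e) * int (k i)"
proof -
  have "0 \<le> lookup e i + int (\<Sum>i\<in>I. nat \<bar>lookup e i\<bar>) * int (k i)" if "i \<in> I" for i
  proof -
    have "nat \<bar>lookup e i\<bar> \<le> (\<Sum>i\<in>I. nat \<bar>lookup e i\<bar>)"
      using that finite_I by (intro member_le_sum) auto
    also have "\<dots> \<le> (\<Sum>i\<in>I. nat \<bar>lookup e i\<bar>) * k i"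
      using k_pos[OF that] by simp
    finally have "int (nat \<bar>lookup e i\<bar>) \<le> int ((\<Sum>i\<in>I. nat \<bar>lookup e i\<bar>) * k i)"
      by (rule of_nat_mono)
    then show ?thesis by simp
  qed
  then have "\<exists>n. \<forall>i\<in>I. 0 \<le> lookup e i + int n * int (k i)" by blast
  then have "\<forall>i\<in>I. 0 \<le> lookup e i + int (pole e) * int (k i)"
    unfolding pole_def by (rule LeastI_ex)
  then show "i \<in> I \<Longrightarrow> 0 \<le> lookup e i + int (pole e) * int (k i)" by blast
qed

lemma pole_le: "(\<And>i. i \<in> I \<Longrightarrow> 0 \<le> lookup e i + int n * int (k i)) \<Longrightarrow> pole e \<le> n"
  unfolding pole_def by (rule Least_le) blast

lemma pole_eq_0_iff: "pole e = 0 \<longleftrightarrow> (\<forall>i\<in>I. 0 \<le> lookup e i)"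
  using pole_ge[of _ e] pole_le[of e 0] by fastforce

lemma pole_zero [simp]: "pole 0 = 0"
  by (simp add: pole_eq_0_iff)

lemma pole_add: "pole (d + e) \<le> pole d + pole e"
proof (rule pole_le)
  fix i assume "i \<in> I"
  then show "0 \<le> lookup (d + e) i + int (pole d + pole e) * int (k i)"
    using pole_ge[of i d] pole_ge[of i e] by (simp add: lookup_add algebra_simps)
qed

lemma pole_minus_kvec: "pole (- kvec) \<le> 1"
  by (rule pole_le) (simp add: lookup_kvec)

lemma exps_zero [simp]: "0 \<in> exps" by (simp add: exps_def)
lemma exps_add: "d \<in> exps \<Longrightarrow> e \<in> exps \<Longrightarrow> d + e \<in> exps"
  using Poly_Mapping.keys_add[of d e] by (auto simp: exps_def)
lemma exps_iff: "e \<in> exps \<longleftrightarrow> (\<forall>i. i \<notin> I \<longrightarrow> lookup e i = 0)"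
  by (auto simp: exps_def in_keys_iff)
lemma exps_uminus: "e \<in> exps \<Longrightarrow> - e \<in> exps"
  by (simp add: exps_iff)
lemma exps_kvec: "kvec \<in> exps"
  by (simp add: exps_iff lookup_kvec)
lemma exps_single: "i \<in> I \<Longrightarrow> single i c \<in> exps"
  by (auto simp: exps_iff lookup_single when_def)

lemma single_in_A_iff: "single e p \<in> A \<longleftrightarrow> p = 0 \<or> e \<in> exps \<and> P ^ pole e dvd p"
  by (auto simp: A_def)

lemma single_in_A: "e \<in> exps \<Longrightarrow> P ^ pole e dvd p \<Longrightarrow> single e p \<in> A"
  by (simp add: single_in_A_iff)

lemma A_zero [simp]: "0 \<in> A" by (simp add: A_def)

lemma dvd_lookup_A: "a \<in> A \<Longrightarrow> P ^ pole e dvd lookup a e"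
  by (cases "e \<in> keys a") (auto simp: A_def in_keys_iff)

lemma keys_A: "a \<in> A \<Longrightarrow> e \<in> keys a \<Longrightarrow> e \<in> exps"
  by (auto simp: A_def)

lemma homogeneous_part_in_A: "a \<in> A \<Longrightarrow> single e (lookup a e) \<in> A"
  using dvd_lookup_A[of a e] keys_A[of a e] by (auto simp: single_in_A_iff in_keys_iff)

lemma A_add: "a \<in> A \<Longrightarrow> b \<in> A \<Longrightarrow> a + b \<in> A"
proof -
  assume a: "a \<in> A" and b: "b \<in> A"
  have "e \<in> exps \<and> P ^ pole e dvd lookup (a + b) e" if "e \<in> keys (a + b)" for e
    using that Poly_Mapping.keys_add[of a b] a b dvd_lookup_A[of a e] dvd_lookup_A[of b e] keys_A
    by (auto simp: lookup_add)
  then show ?thesis by (simp add: A_def)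
qed

lemma A_sum: "(\<And>i. i \<in> S \<Longrightarrow> f i \<in> A) \<Longrightarrow> sum f S \<in> A"
  by (induction S rule: infinite_finite_induct) (auto intro: A_add)

lemma A_mult: "a \<in> A \<Longrightarrow> b \<in> A \<Longrightarrow> a * b \<in> A"
  unfolding times_eq_sum_single[of a b]
proof (intro A_sum single_in_A)
  fix d e assume a: "a \<in> A" "b \<in> A" "d \<in> keys a" "e \<in> keys b"
  then show "d + e \<in> exps" using keys_A exps_add by blast
  have "P ^ pole (d + e) dvd P ^ (pole d + pole e)" using pole_add by (rule le_imp_power_dvd)
  also have "\<dots> dvd lookup a d * lookup b e"
    using a dvd_lookup_A by (simp add: power_add mult_dvd_mono)
  finally show "P ^ pole (d + e) dvd lookup a d * lookup b e" .
qed

lemma A_single_0 [simp]: "single 0 q \<in> A" by (simp add: single_in_A_iff)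
lemma A_one [simp]: "1 \<in> A" using A_single_0[of 1] by simp
lemma A_Y: "i \<in> I \<Longrightarrow> Y i \<in> A"
proof -
  have "pole (single i 1) = 0"
    by (auto simp: pole_eq_0_iff lookup_single when_def)
  then show "i \<in> I \<Longrightarrow> Y i \<in> A"
    by (auto simp: Y_def single_in_A_iff exps_single)
qed
lemma A_Z: "Z \<in> A" by (simp add: Z_def)
lemma A_X: "X \<in> A"
proof -
  have "P ^ pole (- kvec) dvd P ^ 1" by (rule le_imp_power_dvd[OF pole_minus_kvec])
  then show ?thesis unfolding X_def by (intro single_in_A) (simp_all add: exps_uminus exps_kvec)
qed
lemma A_power: "a \<in> A \<Longrightarrow> a ^ n \<in> A"
  by (induction n) (auto intro: A_mult)
lemma A_prod: "(\<And>i. i \<in> S \<Longrightarrow> f i \<in> A) \<Longrightarrow> prod f S \<in> A"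
  by (induction S rule: infinite_finite_induct) (auto intro: A_mult)

lemma X_nonzero [simp]: "X \<noteq> 0" by (simp add: X_def)
lemma Y_nonzero [simp]: "Y i \<noteq> 0" by (simp add: Y_def)
lemma Z_nonzero [simp]: "Z \<noteq> 0" by (simp add: Z_def)

text \<open>
  A homogeneous element is a monomial in the generators times a polynomial in \<open>z\<close>. Hence a degree function
  is determined on homogeneous elements by its values on the generators, and a multiplicative property of
  homogeneous elements need only be checked for the generators.
\<close>

lemma homogeneous_factorization:
  assumes "e \<in> exps"
  shows "single e (P ^ pole e * q) =
    X ^ pole e * (\<Prod>i\<in>I. Y i ^ nat (lookup e i + int (pole e) * int (k i))) * single 0 q"
proof -
  let ?n = "\<lambda>i. nat (lookup e i + int (pole e) * int (k i))"
  have eq: "(\<Sum>j<pole e. - kvec) + (\<Sum>i\<in>I. \<Sum>j<?n i. single i 1) = e"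
  proof (rule poly_mapping_eqI)
    fix i
    have "lookup (\<Sum>j<pole e. - kvec) i = - (int (pole e) * lookup kvec i)"
      by (simp add: lookup_sum_const del: sum_constant)
    moreover have "lookup (\<Sum>i\<in>I. \<Sum>j<?n i. single i 1) i = (if i \<in> I then int (?n i) else 0)"
      using finite_I by (subst lookup_sum)
        (simp add: lookup_sum_const lookup_single when_def if_distrib[of "\<lambda>x. _ * x"] del: sum_constant cong: if_cong)
    ultimately show "lookup ((\<Sum>j<pole e. - kvec) + (\<Sum>i\<in>I. \<Sum>j<?n i. single i 1)) i = lookup e i"
      using pole_ge[of i e] assms
      by (auto simp: lookup_add lookup_minus lookup_kvec exps_iff simp del: sum_constant)
  qed
  show ?thesis
    unfolding X_def Y_def single_power single_prod mult_single eq by (simp del: sum_constant)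
qed

lemma prod_Y: "(\<Prod>i\<in>I. Y i ^ k i) = single kvec 1"
proof -
  have "(\<Sum>i\<in>I. \<Sum>j<k i. single i (1::int)) = kvec"
    by (rule poly_mapping_eqI, subst lookup_sum)
      (use finite_I in \<open>simp add: lookup_kvec lookup_sum_const lookup_single when_def
        if_distrib[of "\<lambda>x. _ * x"] del: sum_constant cong: if_cong\<close>)
  then show ?thesis
    by (simp add: Y_def single_power single_prod del: sum_constant)
qed

lemma X_times_Q: "X * single kvec 1 = single 0 P"
  by (simp add: X_def mult_single)

lemma homogeneous_induct:
  assumes "single e p \<in> A" "p \<noteq> 0"
    and X: "R X" and Y: "\<And>i. i \<in> I \<Longrightarrow> R (Y i)" and Z: "\<And>q. R (single 0 q)"
    and mult: "\<And>a b. a \<in> A \<Longrightarrow> b \<in> A \<Longrightarrow> R a \<Longrightarrow> R b \<Longrightarrow> R (a * b)"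
  shows "R (single e p)"
proof -
  obtain q where p: "p = P ^ pole e * q" and e: "e \<in> exps"
    using assms(1,2) by (auto simp: single_in_A_iff elim: dvdE)
  have one: "R 1" using Z[of 1] by simp
  have pow: "R (a ^ n)" if "a \<in> A" "R a" for a n
    by (induction n) (use that one in \<open>auto intro: mult A_power\<close>)
  have "R (\<Prod>i\<in>S. Y i ^ f i)" if "S \<subseteq> I" for S f
    using finite_subset[OF that finite_I] that
    by (induction S) (auto intro!: one mult pow A_power A_prod A_Y Y)
  then show ?thesis
    unfolding p homogeneous_factorization[OF e]
    by (intro mult A_mult A_power A_prod A_X A_Y A_single_0 pow X Z) auto
qed

lemma single_0_induct:
  assumes "\<And>c. R (single 0 [:c:])" and "R Z"
    and "\<And>a b. a \<in> A \<Longrightarrow> b \<in> A \<Longrightarrow> R a \<Longrightarrow> R b \<Longrightarrow> R (a + b)"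
    and "\<And>a b. a \<in> A \<Longrightarrow> b \<in> A \<Longrightarrow> R a \<Longrightarrow> R b \<Longrightarrow> R (a * b)"
  shows "R (single 0 q)"
proof (induction q)
  case 0
  then show ?case using assms(1)[of 0] by simp
next
  case (pCons c q)
  have "single 0 (pCons c q) = single 0 [:c:] + Z * single 0 q"
    by (simp add: Z_def mult_single single_add[symmetric])
  then show ?case
    using pCons assms by (auto intro!: assms A_mult A_Z)
qed

lemma A_induct:
  assumes "a \<in> A"
    and const: "\<And>c. R (single 0 [:c:])" and "R X" and "\<And>i. i \<in> I \<Longrightarrow> R (Y i)" and "R Z"
    and add: "\<And>a b. a \<in> A \<Longrightarrow> b \<in> A \<Longrightarrow> R a \<Longrightarrow> R b \<Longrightarrow> R (a + b)"
    and mult: "\<And>a b. a \<in> A \<Longrightarrow> b \<in> A \<Longrightarrow> R a \<Longrightarrow> R b \<Longrightarrow> R (a * b)"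
  shows "R a"
proof -
  have hom: "R (single e p)" if "single e p \<in> A" for e p
  proof (cases "p = 0")
    case True
    then show ?thesis using const[of 0] by simp
  next
    case False
    show ?thesis
      by (rule homogeneous_induct[OF that False]) (use assms single_0_induct[of R] in blast)+
  qed
  have "R (\<Sum>e\<in>S. single e (lookup a e))" if "finite S" for S
    using that
  proof (induction S)
    case empty
    then show ?case using const[of 0] by simp
  next
    case (insert e S)
    then show ?case
      using assms(1) hom by (auto intro!: add A_sum homogeneous_part_in_A)
  qed
  from this[of "keys a"] show ?thesis
    using sum_homogeneous[of a] by simp
qed

text \<open>
  Extends a map \<open>H e p\<close>, given on the elements \<open>single e p\<close>, to all sums of such elements. Additivity of \<open>H\<close> is
  only asked for pieces that lie in \<open>A\<close>, since that is where the laws of a derivation hold.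
\<close>

definition lin :: "((nat \<Rightarrow>\<^sub>0 int) \<Rightarrow> 'a poly \<Rightarrow> 'c::ab_group_add) \<Rightarrow> 'a laurent \<Rightarrow> 'c"
  where "lin H b = (\<Sum>e\<in>keys b. H e (lookup b e))"

definition additive_pieces :: "((nat \<Rightarrow>\<^sub>0 int) \<Rightarrow> 'a poly \<Rightarrow> 'c::ab_group_add) \<Rightarrow> bool"
  where "additive_pieces H \<longleftrightarrow>
    (\<forall>e p q. single e p \<in> A \<longrightarrow> single e q \<in> A \<longrightarrow> H e (p + q) = H e p + H e q)"

context
  fixes H :: "(nat \<Rightarrow>\<^sub>0 int) \<Rightarrow> 'a poly \<Rightarrow> 'c::ab_group_add"
  assumes H: "additive_pieces H"
begin

lemma piece_zero: "H e 0 = 0"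
  using H[unfolded additive_pieces_def, rule_format, of e 0 0] by simp

lemma lin_superset: "finite S \<Longrightarrow> keys b \<subseteq> S \<Longrightarrow> lin H b = (\<Sum>e\<in>S. H e (lookup b e))"
  unfolding lin_def by (rule sum.mono_neutral_left) (auto simp: piece_zero in_keys_iff)

lemma lin_single: "lin H (single e p) = H e p"
  by (subst lin_superset[of "{e}"]) (auto split: if_splits)

lemma lin_zero [simp]: "lin H 0 = 0" by (simp add: lin_def)

lemma lin_add:
  assumes "a \<in> A" "b \<in> A"
  shows "lin H (a + b) = lin H a + lin H b"
proof -
  let ?S = "keys a \<union> keys b"
  have "lin H (a + b) = (\<Sum>e\<in>?S. H e (lookup a e + lookup b e))"
    by (subst lin_superset[of ?S]) (auto simp: Poly_Mapping.keys_add lookup_add)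
  also have "\<dots> = (\<Sum>e\<in>?S. H e (lookup a e) + H e (lookup b e))"
    by (intro sum.cong refl H[unfolded additive_pieces_def, rule_format] homogeneous_part_in_A assms)
  also have "\<dots> = lin H a + lin H b"
    by (subst (1 2) lin_superset[of ?S]) (auto simp: sum.distrib)
  finally show ?thesis .
qed

lemma lin_sum: "(\<And>i. i \<in> S \<Longrightarrow> f i \<in> A) \<Longrightarrow> lin H (sum f S) = (\<Sum>i\<in>S. lin H (f i))"
  by (induction S rule: infinite_finite_induct) (auto simp: lin_add A_sum)

lemma lin_mult:
  assumes "a \<in> A" "b \<in> A"
  shows "lin H (a * b) = (\<Sum>d\<in>keys a. \<Sum>e\<in>keys b. H (d + e) (lookup a d * lookup b e))"
proof -
  have "single (d + e) (lookup a d * lookup b e) \<in> A" for d e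
    using A_mult[OF homogeneous_part_in_A[OF assms(1)] homogeneous_part_in_A[OF assms(2)], of d e]
    by (simp add: mult_single)
  then show ?thesis
    by (subst times_eq_sum_single) (simp add: lin_sum A_sum lin_single)
qed

end

lemma lin_derivation:
  fixes H :: "(nat \<Rightarrow>\<^sub>0 int) \<Rightarrow> 'a poly \<Rightarrow> 'a laurent"
  assumes H: "additive_pieces H"
    and prod: "\<And>d e p q. single d p \<in> A \<Longrightarrow> single e q \<in> A \<Longrightarrow>
      H (d + e) (p * q) = H d p * single e q + single d p * H e q"
    and "a \<in> A" "b \<in> A"
  shows "lin H (a * b) = lin H a * b + a * lin H b"
proof -
  have "lin H (a * b) = (\<Sum>d\<in>keys a. \<Sum>e\<in>keys b. H d (lookup a d) * single e (lookup b e) +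
      single d (lookup a d) * H e (lookup b e))"
    using assms by (simp add: lin_mult prod homogeneous_part_in_A)
  also have "\<dots> = lin H a * (\<Sum>e\<in>keys b. single e (lookup b e)) +
      (\<Sum>d\<in>keys a. single d (lookup a d)) * lin H b"
    by (simp add: sum.distrib sum_product lin_def)
  finally show ?thesis
    using sum_homogeneous[of a] sum_homogeneous[of b] by simp
qed

end

section \<open>Locally nilpotent derivations of the coordinate ring\<close>

lemma lookup_times_single: "lookup (a * single e q) (d + e) = lookup a d * q"
  for a :: "'b::cancel_comm_monoid_add \<Rightarrow>\<^sub>0 'c::comm_semiring_0"
proof -
  have "a * single e q = (\<Sum>d\<in>keys a. single (d + e) (lookup a d * q))"
    by (subst sum_homogeneous[of a]) (simp add: sum_distrib_right mult_single)
  then have "lookup (a * single e q) (d + e) = (\<Sum>d'\<in>keys a. if d' = d then lookup a d' * q else 0)"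
    by (simp add: lookup_sum lookup_single when_def)
  then show ?thesis by (simp add: in_keys_iff)
qed

lemma lookup_single_times: "lookup (single e q * a) (e + d) = q * lookup a d"
  for a :: "'b::cancel_comm_monoid_add \<Rightarrow>\<^sub>0 'c::comm_semiring_0"
  using lookup_times_single[of a e q d] by (simp add: ac_simps)

lemma keys_mult_subset_singleton:
  assumes "keys a \<subseteq> {i}" "keys b \<subseteq> {j}"
  shows "keys (a * b) \<subseteq> {i + j}"
proof
  fix d assume "d \<in> keys (a * b)"
  then obtain u v where "d = u + v" "u \<in> keys a" "v \<in> keys b"
    using keys_mult[of a b] by auto
  then show "d \<in> {i + j}" using assms by auto
qed

context hypersurface_algebra
begin

lemma in_A_if_nonneg:
  assumes "\<And>e. e \<in> keys b \<Longrightarrow> e \<in> exps" "\<And>e i. e \<in> keys b \<Longrightarrow> i \<in> I \<Longrightarrow> 0 \<le> lookup e i"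
  shows "b \<in> A"
  unfolding A_def
proof (intro CollectI ballI conjI)
  fix e assume "e \<in> keys b"
  then have "pole e = 0" using assms(2) by (simp add: pole_eq_0_iff)
  then show "P ^ pole e dvd lookup b e" by simp
qed (use assms(1) in blast)

context
  fixes D :: "'a laurent \<Rightarrow> 'a laurent"
  assumes lnd: "loc_nilp_deriv A D"
begin

interpretation L: loc_nilp_deriv A D by (rule lnd)

lemma lnd_D_const: "D (single 0 [:c:]) = 0"
proof (cases "c = 0")
  case False
  have "single 0 [:c:] * single 0 [:inverse c:] = (1::'a laurent)"
    using False by (simp add: mult_single flip: one_pCons single_one)
  then show ?thesis
    using L.deg_unit[of "single 0 [:c:]" "single 0 [:inverse c:]"] by (simp add: L.deg_eq_0_iff)
qed simp

text \<open>
  A polynomial in \<open>Z\<close> is a sum of powers of \<open>Z\<close> of different degrees, unless \<open>Z\<close> has degree zero; the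
  constants have degree zero because they are units.
\<close>

lemma lnd_deg_single_0: "q \<noteq> 0 \<Longrightarrow> L.deg (single 0 q) = degree q * L.deg Z"
proof (induction q)
  case (pCons c q)
  have eq: "single 0 (pCons c q) = single 0 [:c:] + Z * single 0 q"
    by (simp add: Z_def mult_single single_add[symmetric])
  have c: "L.deg (single 0 [:c:]) = 0"
    by (simp add: L.deg_eq_0_iff lnd_D_const)
  show ?case
  proof (cases "q = 0")
    case True
    then show ?thesis using c by simp
  next
    case False
    then have m: "L.deg (Z * single 0 q) = Suc (degree q) * L.deg Z"
      using pCons by (simp add: L.deg_mult A_Z)
    show ?thesis
    proof (cases "L.deg Z = 0")
      case True
      then have "D (single 0 [:c:] + Z * single 0 q) = 0"
        using m c L.deg_eq_0_iff[of "Z * single 0 q"] by (simp add: L.D_add A_mult A_Z lnd_D_const)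
      then have "L.deg (single 0 [:c:] + Z * single 0 q) = 0"
        by (simp add: L.deg_eq_0_iff A_add A_mult A_Z)
      then show ?thesis unfolding eq using True by simp
    next
      case nz: False
      then have "L.deg (single 0 [:c:] + Z * single 0 q) = L.deg (Z * single 0 q)"
        using m c by (intro L.deg_add_less) (simp_all add: A_mult A_Z)
      then show ?thesis using m eq False by simp
    qed
  qed
qed simp

lemma lnd_deg_homogeneous:
  assumes "e \<in> exps" "q \<noteq> 0"
  shows "L.deg (single e (P ^ pole e * q)) = pole e * L.deg X +
    (\<Sum>i\<in>I. nat (lookup e i + int (pole e) * int (k i)) * L.deg (Y i)) + degree q * L.deg Z"
  unfolding homogeneous_factorization[OF assms(1)] using assms finite_I
  by (simp add: L.deg_mult L.deg_power L.deg_prod lnd_deg_single_0 A_mult A_power A_prod A_X A_Y)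

text \<open>
  The degrees of the two sides of the equation \<open>y_1 y\<^sup>k = P(z)\<close>.
\<close>

lemma lnd_deg_relation: "L.deg X + (\<Sum>i\<in>I. k i * L.deg (Y i)) = degree P * L.deg Z"
proof -
  have "L.deg (X * (\<Prod>i\<in>I. Y i ^ k i)) = degree P * L.deg Z"
    by (simp add: prod_Y X_times_Q lnd_deg_single_0)
  then show ?thesis
    using finite_I by (simp add: L.deg_mult L.deg_power L.deg_prod A_power A_prod A_X A_Y)
qed

lemma lnd_zero_if_D_Z:
  assumes "D Z = 0" "a \<in> A"
  shows "D a = 0"
proof -
  have "L.deg Z = 0" using assms by (simp add: L.deg_eq_0_iff A_Z)
  then have "L.deg X = 0" "\<And>i. i \<in> I \<Longrightarrow> L.deg (Y i) = 0"
    using lnd_deg_relation finite_I k_pos by fastforce+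
  then have gen: "D X = 0" "\<And>i. i \<in> I \<Longrightarrow> D (Y i) = 0"
    by (simp_all add: L.deg_eq_0_iff A_X A_Y)
  show ?thesis
    by (rule A_induct[OF assms(2), of "\<lambda>a. D a = 0"])
      (simp_all add: gen assms lnd_D_const L.D_add L.D_mult)
qed

text \<open>
  The core of the argument. Write \<open>\<nu>\<close> for the degree function of \<open>D\<close>. A generator and its image are
  homogeneous, so \<open>lnd_deg_homogeneous\<close> expresses the degree of the image by the degrees of the generators,
  and \<open>\<nu>(D g) = \<nu>(g) - 1\<close> leaves little room: a monomial in \<open>D g\<close> cannot contain a generator of degree at
  least \<open>\<nu>(g)\<close>. If some \<open>y_i\<close> with \<open>i \<ge> 2\<close> had positive degree, then every other \<open>y_j\<close>, and \<open>y_1\<close>, would have degree zero; then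
  \<open>k i \<nu>(y_i) = degree P \<nu>(z)\<close> and \<open>\<nu>(z) \<ge> 1 + (k i - 1) \<nu>(y_i)\<close>, which is impossible for \<open>k i \<ge> 2\<close> and
  \<open>degree P \<ge> 2\<close>. So all \<open>y_i\<close> with \<open>i \<ge> 2\<close> have degree zero, \<open>y_1\<close> has positive degree, and \<open>D y_1\<close>, of weight
  \<open>e - k\<close>, does not involve \<open>y_1\<close>; that means \<open>e \<ge> k\<close>.
\<close>

lemma homogeneous_lnd_weight:
  assumes hom: "\<And>j p. single j p \<in> A \<Longrightarrow> keys (D (single j p)) \<subseteq> {j + e}"
    and nonzero: "a \<in> A" "D a \<noteq> 0" and i: "i \<in> I"
  shows "int (k i) \<le> lookup e i"
proof -
  define nX where "nX = L.deg X"
  define nY where "nY i = L.deg (Y i)" for i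
  define nZ where "nZ = L.deg Z"
  define c where "c j i = nat (lookup j i + int (pole j) * int (k i))" for j i
  have step: "\<exists>q :: 'a poly. L.deg (single j p) = Suc (pole (j + e) * nX + (\<Sum>i\<in>I. c (j + e) i * nY i) + degree q * nZ)"
    if "single j p \<in> A" "D (single j p) \<noteq> 0" for j p
  proof -
    let ?r = "lookup (D (single j p)) (j + e)"
    have eq: "D (single j p) = single (j + e) ?r"
      using hom[OF that(1)]
      by (intro poly_mapping_eqI) (auto simp: lookup_single when_def in_keys_iff)
    have "single (j + e) ?r \<in> A" using eq L.D_in[OF that(1)] by simp
    moreover have "?r \<noteq> 0" using eq that(2) by force
    ultimately obtain q where q: "j + e \<in> exps" "?r = P ^ pole (j + e) * q" "q \<noteq> 0"
      by (auto simp: single_in_A_iff elim!: dvdE)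
    have "L.deg (single j p) = Suc (L.deg (single (j + e) (P ^ pole (j + e) * q)))"
      using L.deg_D[OF that] eq q(2) by simp
    then show ?thesis
      unfolding lnd_deg_homogeneous[OF q(1,3)] unfolding nX_def nY_def nZ_def c_def by blast
  qed
  have "D Z \<noteq> 0" using lnd_zero_if_D_Z nonzero by blast
  then have nZ_pos: "nZ > 0" using L.deg_D[OF A_Z] by (simp add: nZ_def)
  obtain q :: "'a poly" where q: "nZ = Suc (pole e * nX + (\<Sum>i\<in>I. c e i * nY i) + degree q * nZ)"
    using step[of 0 "[:0, 1:]"] A_Z \<open>D Z \<noteq> 0\<close> by (auto simp: Z_def nZ_def)
  have "degree q = 0"
  proof (rule ccontr)
    assume "degree q \<noteq> 0"
    then have "nZ \<le> degree q * nZ" by simp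
    then show False using q by linarith
  qed
  then have nZ: "nZ = Suc (pole e * nX + (\<Sum>i\<in>I. c e i * nY i))" using q by simp
  have rel: "nX + (\<Sum>i\<in>I. k i * nY i) = degree P * nZ"
    using lnd_deg_relation by (simp add: nX_def nY_def nZ_def)
  \<comment> \<open>If \<open>D X\<close> contained a power of \<open>X\<close>, it could not have smaller degree than \<open>X\<close>.\<close>
  have X_case: "pole (- kvec + e) = 0" if "nX > 0"
  proof (rule ccontr)
    assume p: "pole (- kvec + e) \<noteq> 0"
    have "D X \<noteq> 0" using that L.deg_eq_0_iff[OF A_X] by (simp add: nX_def)
    then obtain q :: "'a poly" where "nX = Suc (pole (- kvec + e) * nX + (\<Sum>i\<in>I. c (- kvec + e) i * nY i) + degree q * nZ)"
      using step[of "- kvec" P] A_X by (auto simp: X_def nX_def)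
    moreover have "nX \<le> pole (- kvec + e) * nX" using p by simp
    ultimately show False by linarith
  qed
  define l where "l i = pole (single i 1 + e)" for i
  \<comment> \<open>Similarly \<open>D (Y i)\<close> cannot be divisible by \<open>Y i\<close>, which fixes the exponent \<open>e i\<close>.\<close>
  have Y_case: "lookup e i + 1 + int (l i) * int (k i) = 0" if i: "i \<in> I" and "nY i > 0" for i
  proof -
    have "D (Y i) \<noteq> 0" using that L.deg_eq_0_iff[OF A_Y[OF i]] by (simp add: nY_def)
    then obtain q :: "'a poly" where "nY i = Suc (l i * nX + (\<Sum>j\<in>I. c (single i 1 + e) j * nY j) + degree q * nZ)"
      using step[of "single i 1" 1] A_Y[OF i] by (auto simp: Y_def nY_def l_def)
    moreover have "c (single i 1 + e) i * nY i \<le> (\<Sum>j\<in>I. c (single i 1 + e) j * nY j)"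
      using finite_I i by (intro member_le_sum) auto
    ultimately have "c (single i 1 + e) i * nY i < nY i" by linarith
    then have "c (single i 1 + e) i = 0" by simp
    then show ?thesis
      using pole_ge[OF i, of "single i 1 + e"] by (simp add: c_def lookup_add l_def)
  qed
  have "nY i = 0" if i: "i \<in> I" for i
  proof (rule ccontr)
    assume "nY i \<noteq> 0"
    then have pos: "nY i > 0" by simp
    \<comment> \<open>Two such indices would each need the larger pole order.\<close>
    have less: "l j < l i" if "i \<in> I" "j \<in> I" "i \<noteq> j" "nY i > 0" "nY j > 0" for i j
    proof -
      have "0 \<le> lookup e j + int (l i) * int (k j)"
        using pole_ge[OF that(2), of "single i 1 + e"] that(3) by (simp add: l_def lookup_add lookup_single)
      then have "int (l j) * int (k j) < int (l i) * int (k j)"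
        using Y_case[OF that(2,5)] by linarith
      then show ?thesis by (simp add: mult_less_cancel_right)
    qed
    have other: "nY j = 0" if "j \<in> I" "j \<noteq> i" for j
      using less[of i j] less[of j i] that i pos by fastforce
    have sums: "(\<Sum>j\<in>I. f j * nY j) = f i * nY i" for f
      using finite_I i by (subst sum.remove[of _ i]) (auto intro!: sum.neutral simp: other)
    have neg: "lookup e i < 0"
    proof -
      have "0 \<le> int (l i) * int (k i)" by simp
      then show ?thesis using Y_case[OF i pos] by linarith
    qed
    have "nX = 0"
    proof (rule ccontr)
      assume "nX \<noteq> 0"
      then have "pole (- kvec + e) = 0" using X_case by simp
      then have "0 \<le> lookup (- kvec + e) i" using i by (simp only: pole_eq_0_iff)
      then show False using neg i by (simp add: lookup_add lookup_minus lookup_kvec)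
    qed
    have "int (l i) * int (k i) < int (pole e) * int (k i)"
      using pole_ge[OF i, of e] Y_case[OF i pos] by linarith
    then have "l i + 1 \<le> pole e" by (simp add: mult_less_cancel_right)
    then have "(l i + 1) * k i \<le> pole e * k i" by (rule mult_le_mono1)
    then have "int ((l i + 1) * k i) \<le> int (pole e * k i)" by (rule of_nat_mono)
    then have "int (k i) - 1 \<le> lookup e i + int (pole e) * int (k i)"
      using Y_case[OF i pos] by (simp add: algebra_simps)
    then have "k i - 1 \<le> c e i" by (simp add: c_def)
    then have "(k i - 1) * nY i \<le> c e i * nY i" by (rule mult_le_mono1)
    then have "Suc ((k i - 1) * nY i) \<le> Suc (pole e * nX + (\<Sum>i\<in>I. c e i * nY i))"
      unfolding sums[of "c e"] by (simp only: Suc_le_mono trans_le_add2)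
    then have "Suc ((k i - 1) * nY i) \<le> nZ" by (simp only: nZ)
    then have "2 * Suc ((k i - 1) * nY i) \<le> degree P * nZ"
      using degree_P by (intro mult_le_mono) auto
    also have "\<dots> = k i * nY i" using rel sums[of k] \<open>nX = 0\<close> by simp
    finally have *: "2 * Suc ((k i - 1) * nY i) \<le> k i * nY i" .
    obtain r where "k i = Suc (Suc r)" using k_ge[OF i] by (metis add_2_eq_Suc le_Suc_ex)
    then show False using * by (simp add: algebra_simps)
  qed
  then have "nX = degree P * nZ" using rel by simp
  then have "nX > 0" using nZ_pos degree_P by simp
  from X_case[OF this] have "0 \<le> lookup (- kvec + e) i" using i by (simp only: pole_eq_0_iff)
  then show ?thesis using i by (simp add: lookup_add lookup_minus lookup_kvec)
qed

text \<open>
  Weights by which \<open>D\<close> moves a product occur as such weights for one of its factors, so the generators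
  already show all of them.
\<close>

lemma finite_shifts:
  obtains E where "finite E" "\<And>j p. single j p \<in> A \<Longrightarrow> keys (D (single j p)) \<subseteq> (+) j ` E"
proof
  define E where "E = (\<lambda>d. d + kvec) ` keys (D X) \<union>
    (\<Union>i\<in>I. (\<lambda>d. d - single i 1) ` keys (D (Y i))) \<union> keys (D Z)"
  show "finite E" using finite_I by (simp add: E_def)
  have prod: "keys (D (a * b)) \<subseteq> (+) (i + j) ` E"
    if ab: "a \<in> A" "b \<in> A" and "keys a \<subseteq> {i}" "keys b \<subseteq> {j}"
      "keys (D a) \<subseteq> (+) i ` E" "keys (D b) \<subseteq> (+) j ` E" for a b i j
  proof
    fix d assume "d \<in> keys (D (a * b))"
    then have "d \<in> keys (D a * b) \<union> keys (a * D b)"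
      using Poly_Mapping.keys_add[of "D a * b" "a * D b"] by (auto simp: L.D_mult[OF ab])
    then show "d \<in> (+) (i + j) ` E"
    proof
      assume "d \<in> keys (D a * b)"
      then obtain u v where "d = u + v" "u \<in> keys (D a)" "v \<in> keys b"
        using keys_mult[of "D a" b] by auto
      then show ?thesis using that by (fastforce simp: ac_simps)
    next
      assume "d \<in> keys (a * D b)"
      then obtain u v where "d = u + v" "u \<in> keys a" "v \<in> keys (D b)"
        using keys_mult[of a "D b"] by auto
      then show ?thesis using that by (fastforce simp: ac_simps)
    qed
  qed
  have const: "keys (single 0 q :: 'a laurent) \<subseteq> {0} \<and> keys (D (single 0 q)) \<subseteq> (+) 0 ` E" for q
  proof (rule single_0_induct)
    show "keys Z \<subseteq> {0} \<and> keys (D Z) \<subseteq> (+) 0 ` E" by (auto simp: Z_def E_def)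
  next
    fix c show "keys (single 0 [:c:] :: 'a laurent) \<subseteq> {0} \<and> keys (D (single 0 [:c:])) \<subseteq> (+) 0 ` E"
      by (auto simp: lnd_D_const split: if_splits)
  next
    fix a b assume "a \<in> A" "b \<in> A"
      "keys a \<subseteq> {0} \<and> keys (D a) \<subseteq> (+) 0 ` E" "keys b \<subseteq> {0} \<and> keys (D b) \<subseteq> (+) 0 ` E"
    then show "keys (a + b) \<subseteq> {0} \<and> keys (D (a + b)) \<subseteq> (+) 0 ` E"
      using Poly_Mapping.keys_add[of a b] Poly_Mapping.keys_add[of "D a" "D b"]
      by (auto simp: L.D_add)
  next
    fix a b assume ab: "a \<in> A" "b \<in> A"
      "keys a \<subseteq> {0} \<and> keys (D a) \<subseteq> (+) 0 ` E" "keys b \<subseteq> {0} \<and> keys (D b) \<subseteq> (+) 0 ` E"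
    then have "keys (D (a * b)) \<subseteq> (+) (0 + 0) ` E" by (intro prod) auto
    moreover have "keys (a * b) \<subseteq> {0}" using ab keys_mult_subset_singleton[of a 0 b 0] by simp
    ultimately show "keys (a * b) \<subseteq> {0} \<and> keys (D (a * b)) \<subseteq> (+) 0 ` E" by simp
  qed
  fix j p assume jp: "single j p \<in> A"
  show "keys (D (single j p)) \<subseteq> (+) j ` E"
  proof (cases "p = 0")
    case False
    have "\<exists>i. keys (single j p) \<subseteq> {i} \<and> keys (D (single j p)) \<subseteq> (+) i ` E"
      using jp False
    proof (rule homogeneous_induct)
      show "\<exists>i. keys X \<subseteq> {i} \<and> keys (D X) \<subseteq> (+) i ` E"
      proof (intro exI[of _ "- kvec"] conjI subsetI)
        fix d assume "d \<in> keys (D X)"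
        then show "d \<in> (+) (- kvec) ` E" unfolding E_def by (intro image_eqI[of _ _ "d + kvec"]) auto
      qed (auto simp: X_def)
    next
      fix i assume "i \<in> I"
      show "\<exists>j. keys (Y i) \<subseteq> {j} \<and> keys (D (Y i)) \<subseteq> (+) j ` E"
      proof (intro exI[of _ "single i 1"] conjI subsetI)
        fix d assume "d \<in> keys (D (Y i))"
        then show "d \<in> (+) (single i 1) ` E"
          unfolding E_def using \<open>i \<in> I\<close> by (intro image_eqI[of _ _ "d - single i 1"]) auto
      qed (auto simp: Y_def)
    next
      fix a b assume ab: "a \<in> A" "b \<in> A"
        and "\<exists>i. keys a \<subseteq> {i} \<and> keys (D a) \<subseteq> (+) i ` E" "\<exists>i. keys b \<subseteq> {i} \<and> keys (D b) \<subseteq> (+) i ` E"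
      then obtain i j where ij: "keys a \<subseteq> {i}" "keys (D a) \<subseteq> (+) i ` E"
        "keys b \<subseteq> {j}" "keys (D b) \<subseteq> (+) j ` E" by blast
      moreover have "keys (a * b) \<subseteq> {i + j}" using keys_mult_subset_singleton[OF ij(1,3)] .
      ultimately show "\<exists>i. keys (a * b) \<subseteq> {i} \<and> keys (D (a * b)) \<subseteq> (+) i ` E"
        using prod[OF ab ij(1,3,2,4)] by blast
    qed (use const in blast)
    then show ?thesis using False by auto
  qed simp
qed

text \<open>
  A translation invariant total order on exponent vectors whose leading criterion is the exponent of \<open>y_i\<close>,
  so that a smallest weight bounds the exponent of \<open>y_i\<close> from below.
\<close>

definition precedes :: "nat \<Rightarrow> (nat \<Rightarrow>\<^sub>0 int) \<Rightarrow> (nat \<Rightarrow>\<^sub>0 int) \<Rightarrow> bool"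
  where "precedes i d e \<longleftrightarrow> lookup d i < lookup e i \<or> lookup d i = lookup e i \<and> d \<le> e"

lemma precedes_refl: "precedes i d d" by (simp add: precedes_def)

lemma precedes_add: "precedes i a b \<Longrightarrow> precedes i c d \<Longrightarrow> precedes i (a + c) (b + d)"
  by (auto simp: precedes_def lookup_add intro: add_mono)

lemma precedes_add_eq:
  assumes "precedes i a b" "precedes i c d" "a + c = b + d"
  shows "a = b \<and> c = d"
proof -
  have "lookup a i + lookup c i = lookup b i + lookup d i"
    using assms(3) by (metis lookup_add)
  then have "a \<le> b" "c \<le> d" using assms(1,2) by (auto simp: precedes_def)
  then show ?thesis using assms(3)
    by (metis add_less_le_mono add_le_less_mono order_le_less order_less_irrefl)
qed

lemma finite_precedes_min:
  assumes "finite E" "E \<noteq> {}"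
  obtains e where "e \<in> E" "\<And>d. d \<in> E \<Longrightarrow> precedes i e d"
proof -
  let ?m = "Min ((\<lambda>e. lookup e i) ` E)"
  let ?F = "{e \<in> E. lookup e i = ?m}"
  have "?m \<in> (\<lambda>e. lookup e i) ` E" using assms by (intro Min_in) auto
  then have F: "finite ?F" "?F \<noteq> {}" using assms(1) by auto
  have min: "?m \<le> lookup d i" if "d \<in> E" for d using that assms(1) by (intro Min_le) auto
  have "Min ?F \<in> ?F" using F by (rule Min_in)
  moreover have "precedes i (Min ?F) d" if "d \<in> E" for d
  proof (cases "d \<in> ?F")
    case True
    then have "Min ?F \<le> d" using F(1) by (intro Min_le)
    then show ?thesis using True calculation by (auto simp: precedes_def)
  next
    case False
    then show ?thesis using that min[OF that] calculation by (auto simp: precedes_def)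
  qed
  ultimately show ?thesis using that by blast
qed

text \<open>
  The homogeneous component of weight \<open>e\<close> of the derivation \<open>D\<close>.
\<close>

definition lead :: "(nat \<Rightarrow>\<^sub>0 int) \<Rightarrow> 'a laurent \<Rightarrow> 'a laurent"
  where "lead e = lin (\<lambda>j p. single (j + e) (lookup (D (single j p)) (j + e)))"

lemma lead_pieces: "additive_pieces (\<lambda>j p. single (j + e) (lookup (D (single j p)) (j + e)))"
  by (simp add: additive_pieces_def single_add L.D_add lookup_add)

lemma lead_single: "lead e (single j p) = single (j + e) (lookup (D (single j p)) (j + e))"
  unfolding lead_def by (rule lin_single[OF lead_pieces])

lemma lead_add: "a \<in> A \<Longrightarrow> b \<in> A \<Longrightarrow> lead e (a + b) = lead e a + lead e b"
  unfolding lead_def by (rule lin_add[OF lead_pieces])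

lemma lead_in: "a \<in> A \<Longrightarrow> lead e a \<in> A"
  unfolding lead_def lin_def by (intro A_sum homogeneous_part_in_A L.D_in)

lemma lead_mult:
  assumes "a \<in> A" "b \<in> A"
  shows "lead e (a * b) = lead e a * b + a * lead e b"
  unfolding lead_def
proof (rule lin_derivation[OF lead_pieces _ assms])
  fix d d' p q assume A: "single d p \<in> A" "single d' q \<in> A"
  let ?H = "\<lambda>j p. single (j + e) (lookup (D (single j p)) (j + e))"
  have "D (single (d + d') (p * q)) = D (single d p) * single d' q + single d p * D (single d' q)"
    using L.D_mult[OF A] by (simp add: mult_single)
  moreover have "lookup (D (single d p) * single d' q) (d + d' + e) = lookup (D (single d p)) (d + e) * q"
    using lookup_times_single[of "D (single d p)" d' q "d + e"] by (simp add: ac_simps)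
  moreover have "lookup (single d p * D (single d' q)) (d + d' + e) = p * lookup (D (single d' q)) (d' + e)"
    using lookup_single_times[of d p "D (single d' q)" "d' + e"] by (simp add: ac_simps)
  ultimately show "?H (d + d') (p * q) = ?H d p * single d' q + single d p * ?H d' q"
    by (simp add: lookup_add single_add mult_single ac_simps)
qed

text \<open>
  If \<open>e\<close> is the smallest weight of \<open>D\<close>, the iterates of the component of weight \<open>e\<close> are the components
  of the iterates of \<open>D\<close> of the smallest possible weight: a sum of weights attains the minimum only if
  each of them does. This transfers local nilpotency from \<open>D\<close> to its extreme component.
\<close>

lemma lead_funpow:
  assumes E: "\<And>j p. single j p \<in> A \<Longrightarrow> keys (D (single j p)) \<subseteq> (+) j ` E"
    and min: "\<And>d. d \<in> E \<Longrightarrow> precedes i e d" and jp: "single j p \<in> A"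
  shows "(lead e ^^ n) (single j p) =
      single (((\<lambda>j. j + e) ^^ n) j) (lookup ((D ^^ n) (single j p)) (((\<lambda>j. j + e) ^^ n) j)) \<and>
    (\<forall>d\<in>keys ((D ^^ n) (single j p)). precedes i (((\<lambda>j. j + e) ^^ n) j) d)"
proof (induction n)
  case 0
  then show ?case by (auto simp: precedes_refl split: if_splits)
next
  case (Suc n)
  define b where "b = (D ^^ n) (single j p)"
  define J where "J = ((\<lambda>j. j + e) ^^ n) j"
  have b: "b \<in> A" unfolding b_def by (rule L.Dn_in[OF jp])
  have IH: "(lead e ^^ n) (single j p) = single J (lookup b J)"
    "\<And>d. d \<in> keys b \<Longrightarrow> precedes i J d"
    using Suc by (auto simp: b_def J_def)
  have Db: "D b = (\<Sum>d\<in>keys b. D (single d (lookup b d)))"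
    using L.D_sum[of "keys b" "\<lambda>d. single d (lookup b d)"] sum_homogeneous[of b]
      homogeneous_part_in_A[OF b] by simp
  have K: "\<exists>u\<in>E. v = d + u" if "v \<in> keys (D (single d (lookup b d)))" for d v
    using E[OF homogeneous_part_in_A[OF b, of d]] that by auto
  have "lookup (D b) (J + e) = (\<Sum>d\<in>keys b. lookup (D (single d (lookup b d))) (J + e))"
    by (simp add: Db lookup_sum)
  also have "\<dots> = (\<Sum>d\<in>keys b. if d = J then lookup (D (single J (lookup b J))) (J + e) else 0)"
  proof (intro sum.cong refl)
    fix d assume d: "d \<in> keys b"
    have "lookup (D (single d (lookup b d))) (J + e) = 0" if "d \<noteq> J"
    proof (rule ccontr)
      assume "lookup (D (single d (lookup b d))) (J + e) \<noteq> 0"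
      then obtain u where u: "u \<in> E" "J + e = d + u" using K[of "J + e" d] by (auto simp: in_keys_iff)
      then show False using precedes_add_eq[OF IH(2)[OF d] min[OF u(1)] u(2)] that by blast
    qed
    then show "lookup (D (single d (lookup b d))) (J + e) =
      (if d = J then lookup (D (single J (lookup b J))) (J + e) else 0)" by simp
  qed
  also have "\<dots> = lookup (D (single J (lookup b J))) (J + e)"
    by (simp add: in_keys_iff)
  finally have "lead e (single J (lookup b J)) = single (J + e) (lookup (D b) (J + e))"
    by (simp add: lead_single)
  moreover have "precedes i (J + e) v" if v: "v \<in> keys (D b)" for v
  proof -
    obtain d where d: "d \<in> keys b" "v \<in> keys (D (single d (lookup b d)))"
      using v Poly_Mapping.keys_sum[of "\<lambda>d. D (single d (lookup b d))" "keys b"] unfolding Db by blast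
    then obtain u where "u \<in> E" "v = d + u" using K by blast
    then show ?thesis using precedes_add[OF IH(2)[OF d(1)] min] by simp
  qed
  ultimately show ?case
    using IH(1) by (simp add: b_def[symmetric] J_def[symmetric])
qed

lemma lead_lnd:
  assumes E: "\<And>j p. single j p \<in> A \<Longrightarrow> keys (D (single j p)) \<subseteq> (+) j ` E"
    and min: "\<And>d. d \<in> E \<Longrightarrow> precedes i e d"
  shows "loc_nilp_deriv A (lead e)"
proof (unfold_locales)
  have lead_in_n: "(lead e ^^ n) a \<in> A" if "a \<in> A" for n a
    using that by (induction n) (auto intro: lead_in)
  have lead_add_n: "(lead e ^^ n) (a + b) = (lead e ^^ n) a + (lead e ^^ n) b" if "a \<in> A" "b \<in> A" for n a b
    using that by (induction n) (auto simp: lead_add lead_in_n)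
  have lead_zero_n: "(lead e ^^ n) 0 = 0" for n
    using lead_add_n[OF A_zero A_zero, of n] by simp
  have mono: "(lead e ^^ n) a = 0" if "(lead e ^^ l) a = 0" "l \<le> n" for l n a
    using that funpow_add[of "n - l" l "lead e"] lead_zero_n by simp
  fix a assume a: "a \<in> A"
  have "\<exists>n. (lead e ^^ n) (\<Sum>j\<in>S. single j (lookup a j)) = 0" if "finite S" for S
    using that
  proof (induction S)
    case empty
    show ?case by (rule exI[of _ 0]) simp
  next
    case (insert j S)
    then obtain n where n: "(lead e ^^ n) (\<Sum>j\<in>S. single j (lookup a j)) = 0" by blast
    obtain l where "(D ^^ l) (single j (lookup a j)) = 0"
      using L.nilpotent[OF homogeneous_part_in_A[OF a]] by blast
    then have "(lead e ^^ l) (single j (lookup a j)) = 0"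
      using lead_funpow[OF E min homogeneous_part_in_A[OF a], of l j] by simp
    then have "(lead e ^^ max n l) (single j (lookup a j)) = 0"
      "(lead e ^^ max n l) (\<Sum>j\<in>S. single j (lookup a j)) = 0"
      using n mono[of _ _ "max n l"] by auto
    then show ?case
      using insert.hyps
      by (auto simp: lead_add_n A_sum homogeneous_part_in_A[OF a] intro!: exI[of _ "max n l"])
  qed
  from this[of "keys a"] show "\<exists>n. (lead e ^^ n) a = 0"
    using sum_homogeneous[of a] by simp
qed (simp_all add: A_add A_mult lead_in lead_add lead_mult)

text \<open>
  The smallest weight of \<open>D\<close> in the order \<open>precedes i\<close> is the weight of a nonzero homogeneous locally
  nilpotent derivation, so its exponent at \<open>i\<close> is at least \<open>k i\<close>, and all other weights have an exponent
  at \<open>i\<close> that is at least as large.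
\<close>

theorem lnd_support:
  assumes jp: "single j p \<in> A" and d: "d \<in> keys (D (single j p))" and i: "i \<in> I"
  shows "lookup j i + int (k i) \<le> lookup d i"
proof -
  obtain E where E: "finite E" "\<And>j p. single j p \<in> A \<Longrightarrow> keys (D (single j p)) \<subseteq> (+) j ` E"
    using finite_shifts by blast
  define E' where "E' = {e \<in> E. \<exists>j p. single j p \<in> A \<and> lookup (D (single j p)) (j + e) \<noteq> 0}"
  have sub: "keys (D (single j p)) \<subseteq> (+) j ` E'" if "single j p \<in> A" for j p
    using E(2)[OF that] that by (fastforce simp: E'_def in_keys_iff)
  then obtain u where u: "u \<in> E'" "d = j + u" using jp d by blast
  have "finite E'" using E(1) by (simp add: E'_def)
  then obtain e where e: "e \<in> E'" "\<And>d. d \<in> E' \<Longrightarrow> precedes i e d"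
    using finite_precedes_min[of E' i] u(1) by auto
  obtain j' p' where j': "single j' p' \<in> A" "lookup (D (single j' p')) (j' + e) \<noteq> 0"
    using e(1) by (auto simp: E'_def)
  have lnd': "loc_nilp_deriv A (lead e)" using sub e(2) by (rule lead_lnd)
  have "int (k i) \<le> lookup e i"
  proof (rule hypersurface_algebra.homogeneous_lnd_weight[OF hypersurface_algebra_axioms lnd' _ j'(1) _ i])
    show "keys (lead e (single j p)) \<subseteq> {j + e}" for j p by (simp add: lead_single)
    show "lead e (single j' p') \<noteq> 0" using j'(2) by (simp add: lead_single)
  qed
  also have "\<dots> \<le> lookup u i" using e(2)[OF u(1)] by (auto simp: precedes_def)
  finally show ?thesis using u(2) by (simp add: lookup_add)
qed

text \<open>
  All weights of \<open>D\<close> are at least \<open>k\<close>, so \<open>D (Y i)\<close> is the product of \<open>Y i\<close> and an element without poles.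
\<close>

theorem lnd_kills_Y:
  assumes i: "i \<in> I"
  shows "D (Y i) = 0"
proof -
  define g where "g = single (- single i 1) 1 * D (Y i)"
  have Yg: "D (Y i) = Y i * g"
    by (simp add: g_def Y_def mult_single flip: mult.assoc)
  have "g \<in> A"
  proof (rule in_A_if_nonneg)
    fix e assume "e \<in> keys g"
    then have key: "e + single i 1 \<in> keys (D (Y i))"
      using lookup_single_times[of "- single i 1" 1 "D (Y i)" "e + single i 1"]
      by (simp add: g_def in_keys_iff)
    then have "e + single i 1 \<in> exps" using keys_A[OF L.D_in[OF A_Y[OF i]]] by blast
    then show "e \<in> exps"
      using exps_add[OF _ exps_uminus[OF exps_single[OF i]], of "e + single i 1" 1] by simp
    fix l assume l: "l \<in> I"
    show "0 \<le> lookup e l"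
      using lnd_support[of "single i 1" 1 "e + single i 1" l] key A_Y[OF i] l
      by (simp add: Y_def lookup_add)
  qed
  then show ?thesis using L.kernel_if_dvd_D[OF A_Y[OF i] _ Yg] by blast
qed

end

end

section \<open>Automorphisms of the coordinate ring permute the variables\<close>

lemma single_eq_singleD: "single d p = single e q \<Longrightarrow> p \<noteq> 0 \<Longrightarrow> d = e \<and> p = q"
  by (metis lookup_single_eq lookup_single_not_eq)

lemma single_one_eqD:
  fixes p :: "'c::zero_neq_one"
  shows "single d 1 = single e p \<Longrightarrow> d = e"
  using single_eq_singleD[of d 1 e p] by simp

lemma lookup_mult_unique:
  fixes f g :: "'b::comm_monoid_add \<Rightarrow>\<^sub>0 'c::comm_semiring_0"
  assumes "\<And>d e. d \<in> keys f \<Longrightarrow> e \<in> keys g \<Longrightarrow> d + e = M + N \<Longrightarrow> d = M \<and> e = N"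
    and "M \<in> keys f" "N \<in> keys g"
  shows "lookup (f * g) (M + N) = lookup f M * lookup g N"
proof -
  have "lookup (f * g) (M + N) =
      (\<Sum>d\<in>keys f. \<Sum>e\<in>keys g. if d + e = M + N then lookup f d * lookup g e else 0)"
    by (subst times_eq_sum_single) (simp add: lookup_sum lookup_single when_def)
  also have "\<dots> = (\<Sum>d\<in>keys f. \<Sum>e\<in>keys g. if e = N then if d = M then lookup f d * lookup g e else 0 else 0)"
    by (intro sum.cong refl) (use assms(1) in auto)
  also have "\<dots> = lookup f M * lookup g N"
    using assms(2,3) by simp
  finally show ?thesis .
qed

text \<open>
  The sum of the largest exponents of two factors is the largest exponent of the product, and likewise for
  the smallest. For a single term these agree, so each factor has only one exponent.
\<close>

lemma factor_of_single:
  fixes f g :: "'b::{linorder, ordered_cancel_comm_monoid_add} \<Rightarrow>\<^sub>0 'c::idom"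
  assumes "f * g = single e p" "p \<noteq> 0"
  obtains d q where "f = single d q" "q \<noteq> 0"
proof -
  have "single e p \<noteq> 0" using assms(2) by simp
  then have "f \<noteq> 0" "g \<noteq> 0" using assms(1) by auto
  then have ne: "keys f \<noteq> {}" "keys g \<noteq> {}" by auto
  define M N m n where "M = Max (keys f)" "N = Max (keys g)" "m = Min (keys f)" "n = Min (keys g)"
  have mem: "M \<in> keys f" "N \<in> keys g" "m \<in> keys f" "n \<in> keys g"
    unfolding M_N_m_n_def using ne by simp_all
  have le: "d \<le> M" "m \<le> d" if "d \<in> keys f" for d
    using that by (simp_all add: M_N_m_n_def)
  have le': "d \<le> N" "n \<le> d" if "d \<in> keys g" for d
    using that by (simp_all add: M_N_m_n_def)
  have eq: "d = u \<and> d' = u'" if "d \<le> u" "d' \<le> u'" "d + d' = u + u'" for d d' u u' :: 'b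
    using that by (metis add_less_le_mono add_le_less_mono order_le_less order_less_irrefl)
  have "lookup (f * g) (M + N) = lookup f M * lookup g N"
  proof (rule lookup_mult_unique)
    fix u v assume "u \<in> keys f" "v \<in> keys g" "u + v = M + N"
    then show "u = M \<and> v = N" using eq[of u M v N] le le' by simp
  qed (fact mem)+
  then have top: "M + N = e"
    using mem assms by (auto simp: in_keys_iff lookup_single when_def split: if_splits)
  have "lookup (f * g) (m + n) = lookup f m * lookup g n"
  proof (rule lookup_mult_unique)
    fix u v assume "u \<in> keys f" "v \<in> keys g" "u + v = m + n"
    then show "u = m \<and> v = n" using eq[of m u n v] le le' by simp
  qed (fact mem)+
  then have bot: "m + n = e"
    using mem assms by (auto simp: in_keys_iff lookup_single when_def split: if_splits)
  have "m = M" using eq[of m M n N] top bot le(2)[of M] le'(2)[of N] mem by simp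
  then have "keys f = {M}" using le mem by (auto intro!: antisym)
  then have "f = single M (lookup f M)"
    by (intro poly_mapping_eqI) (auto simp: lookup_single when_def in_keys_iff)
  then show ?thesis using that mem(1) by (auto simp: in_keys_iff)
qed

lemma pderiv_funpow_eq_0: "degree p < n \<Longrightarrow> (pderiv ^^ n) p = 0"
  for p :: "'a::{idom,ring_char_0} poly"
proof (induction n arbitrary: p)
  case (Suc n)
  show ?case
  proof (cases "degree p = 0")
    case True
    then have "pderiv p = 0" by (simp add: pderiv_eq_0_iff)
    moreover have "(pderiv ^^ n) 0 = (0 :: 'a poly)" by (induction n) auto
    ultimately show ?thesis by (simp add: funpow_swap1)
  next
    case False
    then show ?thesis using Suc.IH[of "pderiv p"] Suc.prems by (simp add: funpow_swap1 degree_pderiv)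
  qed
qed simp

context hypersurface_algebra
begin

text \<open>
  The monomial \<open>y\<^sup>k\<close>.
\<close>

abbreviation Q :: "'a laurent" where "Q \<equiv> single kvec 1"

text \<open>
  The derivation \<open>y\<^sup>k \<partial>/\<partial>z\<close>. It maps \<open>A\<close> to itself because differentiating \<open>P\<^sup>n q\<close> costs at most one factor
  \<open>P\<close>, and multiplication by \<open>y\<^sup>k\<close> lowers a positive pole order by one.
\<close>

definition D0 :: "'a laurent \<Rightarrow> 'a laurent"
  where "D0 = lin (\<lambda>e p. single (e + kvec) (pderiv p))"

lemma D0_pieces: "additive_pieces (\<lambda>e p. single (e + kvec) (pderiv p))"
  by (simp add: additive_pieces_def pderiv_add single_add)

lemma D0_single: "D0 (single e p) = single (e + kvec) (pderiv p)"
  unfolding D0_def by (rule lin_single[OF D0_pieces])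

lemma lookup_D0: "lookup (D0 b) (e + kvec) = pderiv (lookup b e)"
  by (simp add: D0_def lin_def lookup_sum lookup_single when_def in_keys_iff)

text \<open>
  The coefficients of weight \<open>e\<close> in \<open>A\<close> are multiples of \<open>P ^ pole e\<close>; one of degree less than that of \<open>P\<close>
  can only occur at a weight without poles.
\<close>

lemma degree_if_pole_dvd:
  assumes "P ^ pole e dvd p" "p \<noteq> 0" "degree p < degree P"
  shows "pole e = 0"
proof (rule ccontr)
  assume "pole e \<noteq> 0"
  have "pole e * degree P \<le> degree p"
    using dvd_imp_degree_le[OF assms(1,2)] by (simp add: degree_power_eq)
  moreover have "degree P \<le> pole e * degree P" using \<open>pole e \<noteq> 0\<close> by simp
  ultimately show False using assms(3) by linarith
qed

lemma A_Q: "Q \<in> A"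
  by (rule single_in_A[OF exps_kvec]) (simp add: pole_eq_0_iff[THEN iffD2] lookup_kvec)

lemma D0_lnd: "loc_nilp_deriv A D0"
proof
  fix a assume a: "a \<in> A"
  show "D0 a \<in> A"
    unfolding D0_def lin_def
  proof (intro A_sum single_in_A exps_add exps_kvec)
    fix e assume "e \<in> keys a"
    then show "e \<in> exps" using keys_A[OF a] by blast
    obtain q where q: "lookup a e = P ^ pole e * q" using dvd_lookup_A[OF a, of e] by (auto elim: dvdE)
    have "pole (e + kvec) \<le> pole e - 1"
    proof (rule pole_le)
      fix i assume "i \<in> I"
      then show "0 \<le> lookup (e + kvec) i + int (pole e - 1) * int (k i)"
        using pole_ge[of i e] by (cases "pole e") (auto simp: lookup_add lookup_kvec algebra_simps)
    qed
    then have "P ^ pole (e + kvec) dvd P ^ (pole e - 1)" by (rule le_imp_power_dvd)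
    also have "\<dots> dvd pderiv (P ^ pole e * q)"
    proof -
      have "P ^ (pole e - 1) dvd P ^ pole e" by (rule le_imp_power_dvd) simp
      then show ?thesis by (simp add: pderiv_mult pderiv_power dvd_add dvd_mult dvd_mult2 dvd_smult)
    qed
    finally show "P ^ pole (e + kvec) dvd pderiv (lookup a e)" by (simp add: q)
  qed
  show "\<exists>n. (D0 ^^ n) a = 0"
  proof -
    define n where "n = Suc (\<Sum>e\<in>keys a. degree (lookup a e))"
    have deg: "degree (lookup a e) < n" for e
    proof (cases "e \<in> keys a")
      case True
      then have "degree (lookup a e) \<le> (\<Sum>e\<in>keys a. degree (lookup a e))"
        by (intro member_le_sum) auto
      then show ?thesis by (simp add: n_def)
    qed (simp add: n_def in_keys_iff)
    have shift: "lookup ((D0 ^^ l) a) e = (pderiv ^^ l) (lookup a (((\<lambda>e. e - kvec) ^^ l) e))" for l e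
    proof (induction l arbitrary: e)
      case (Suc l)
      have "lookup ((D0 ^^ Suc l) a) e = pderiv (lookup ((D0 ^^ l) a) (e - kvec))"
        using lookup_D0[of "(D0 ^^ l) a" "e - kvec"] by simp
      also have "\<dots> = (pderiv ^^ Suc l) (lookup a (((\<lambda>e. e - kvec) ^^ Suc l) e))"
        by (simp only: Suc funpow_Suc_right[where f = "\<lambda>e. e - kvec"] funpow.simps o_apply)
      finally show ?case .
    qed simp
    have "(D0 ^^ n) a = 0"
      by (rule poly_mapping_eqI) (simp add: shift pderiv_funpow_eq_0 deg)
    then show ?thesis by blast
  qed
next
  fix a b assume "a \<in> A" "b \<in> A"
  then show "D0 (a * b) = D0 a * b + a * D0 b"
    unfolding D0_def
    by (rule lin_derivation[OF D0_pieces, rotated])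
      (simp add: mult_single pderiv_mult single_add ac_simps)
next
  fix a b assume "a \<in> A" "b \<in> A"
  then show "D0 (a + b) = D0 a + D0 b"
    unfolding D0_def by (rule lin_add[OF D0_pieces])
qed (simp_all add: A_add A_mult)

interpretation D0: loc_nilp_deriv A D0 by (rule D0_lnd)

lemma D0_Z: "D0 Z = Q"
  by (simp add: Z_def D0_single pderiv_pCons one_pCons)

lemma D0_constant: "D0 (single e [:c:]) = 0"
  by (simp add: D0_single pderiv_pCons)

lemma D0_Q: "D0 Q = 0"
  by (simp add: D0_single)

lemma D0_Y: "D0 (Y i) = 0"
  by (simp add: Y_def D0_single)

text \<open>
  The kernel of \<open>D0\<close> is the polynomial ring in the \<open>y_i\<close>: a nonzero coefficient that is constant in \<open>z\<close> is not
  divisible by \<open>P\<close>, so it can only occur at exponents that are nonnegative.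
\<close>

lemma kernel_D0:
  assumes "a \<in> A" "D0 a = 0" "e \<in> keys a"
  obtains c where "c \<noteq> 0" "lookup a e = [:c:]" "pole e = 0" "e \<in> exps"
proof -
  have "degree (lookup a e) = 0"
    using lookup_D0[of a e] assms(2) by (simp add: pderiv_eq_0_iff)
  then obtain c where c: "lookup a e = [:c:]" by (rule degree_eq_zeroE)
  then have "c \<noteq> 0" using assms(3) by (auto simp: in_keys_iff)
  moreover have "pole e = 0"
    by (rule degree_if_pole_dvd[OF dvd_lookup_A[OF assms(1)]]) (use c \<open>c \<noteq> 0\<close> degree_P in auto)
  ultimately show ?thesis using that c keys_A assms by blast
qed

lemma lnd_kills_kernel_D0:
  assumes lnd: "loc_nilp_deriv A D" and a: "a \<in> A" "D0 a = 0"
  shows "D a = 0"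
proof -
  interpret L: loc_nilp_deriv A D by (rule lnd)
  have "D (single e (lookup a e)) = 0" if e: "e \<in> keys a" for e
  proof -
    obtain c where c: "c \<noteq> 0" "lookup a e = [:c:]" "pole e = 0" "e \<in> exps"
      using kernel_D0[OF a e] .
    have "L.deg (Y i) = 0" if "i \<in> I" for i
      using lnd_kills_Y[OF lnd that] by (simp add: L.deg_eq_0_iff A_Y that)
    then have "L.deg (single e (P ^ pole e * [:c:])) = 0"
      using c by (subst lnd_deg_homogeneous[OF lnd]) auto
    then show ?thesis
      using c homogeneous_part_in_A[OF a(1), of e] by (simp add: L.deg_eq_0_iff)
  qed
  then have "D (\<Sum>e\<in>keys a. single e (lookup a e)) = 0"
    by (subst L.D_sum) (auto simp: homogeneous_part_in_A[OF a(1)])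
  then show ?thesis using sum_homogeneous[of a] by simp
qed

text \<open>
  Both \<open>Q D\<close> and \<open>D(z) D0\<close> are derivations that kill the \<open>y_i\<close>, and they agree at \<open>z\<close>. At \<open>y_1\<close> they agree
  because \<open>y_1 Q = P(z)\<close> determines the value there.
\<close>

lemma lnd_proportional:
  assumes lnd: "loc_nilp_deriv A D" and "b \<in> A"
  shows "Q * D b = D0 b * D Z"
proof -
  interpret L: loc_nilp_deriv A D by (rule lnd)
  let ?R = "\<lambda>b. Q * D b = D0 b * D Z"
  have const: "?R (single 0 [:c:])" for c
    by (simp add: D0_constant lnd_D_const[OF lnd])
  have Z: "?R Z" by (simp add: D0_Z)
  have add: "?R (a + b)" if "a \<in> A" "b \<in> A" "?R a" "?R b" for a b
    using that by (simp add: L.D_add D0.D_add algebra_simps)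
  have mult: "?R (a * b)" if ab: "a \<in> A" "b \<in> A" "?R a" "?R b" for a b
  proof -
    have "Q * D (a * b) = (Q * D a) * b + a * (Q * D b)"
      using ab by (simp add: L.D_mult algebra_simps)
    then show ?thesis using ab by (simp add: D0.D_mult algebra_simps)
  qed
  have "?R (single 0 P)" by (rule single_0_induct[of ?R]) (use const Z add mult in auto)
  moreover have "D (single 0 P) = D X * Q"
    using L.D_mult[OF A_X A_Q] lnd_kills_kernel_D0[OF lnd A_Q D0_Q] by (simp add: X_times_Q)
  moreover have "D0 (single 0 P) = D0 X * Q"
    using D0.D_mult[OF A_X A_Q] D0_Q by (simp add: X_times_Q)
  ultimately have "Q * (Q * D X) = Q * (D0 X * D Z)" by (simp add: ac_simps)
  then have X: "?R X" by simp
  show ?thesis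
    by (rule A_induct[OF assms(2), of ?R])
      (use const Z X add mult in \<open>auto simp: D0_Y lnd_kills_Y[OF lnd]\<close>)
qed

lemma lnd_D_Z_dvd:
  assumes lnd: "loc_nilp_deriv A D"
  obtains g where "g \<in> A" "D Z = Q * g"
proof
  interpret L: loc_nilp_deriv A D by (rule lnd)
  let ?g = "single (- kvec) 1 * D Z"
  show "D Z = Q * ?g" by (simp add: mult_single flip: mult.assoc)
  show "?g \<in> A"
  proof (rule in_A_if_nonneg)
    fix e assume "e \<in> keys ?g"
    then have key: "e + kvec \<in> keys (D Z)"
      using lookup_single_times[of "- kvec" 1 "D Z" "e + kvec"] by (simp add: in_keys_iff)
    then have "e + kvec \<in> exps" using keys_A[OF L.D_in[OF A_Z]] by blast
    then show "e \<in> exps"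
      using exps_add[OF _ exps_uminus[OF exps_kvec], of "e + kvec"] by simp
    fix i assume i: "i \<in> I"
    show "0 \<le> lookup e i"
      using lnd_support[OF lnd, of 0 "[:0, 1:]" "e + kvec" i] key A_Z i
      by (simp add: Z_def lookup_add lookup_kvec)
  qed
qed

definition total :: "(nat \<Rightarrow>\<^sub>0 int) \<Rightarrow> nat"
  where "total e = (\<Sum>i\<in>I. nat (lookup e i))"

lemma single_unit_in_A:
  assumes "single d q \<in> A" "q \<noteq> 0" "degree q = 0"
  shows "pole d = 0" "d \<in> exps"
  using assms degree_if_pole_dvd[of d q] degree_P by (auto simp: single_in_A_iff)

lemma unit_in_A:
  assumes "a \<in> A" "b \<in> A" "a * b = 1"
  obtains c where "c \<noteq> 0" "a = single 0 [:c:]"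
proof -
  have one: "a * b = single 0 1" "b * a = single 0 1" using assms(3) by (simp_all add: mult.commute)
  obtain d q where dq: "a = single d q" "q \<noteq> 0" using factor_of_single[OF one(1)] by auto
  obtain d' q' where dq': "b = single d' q'" "q' \<noteq> 0" using factor_of_single[OF one(2)] by auto
  have eq: "single (d + d') (q * q') = single 0 1" using one(1) by (simp add: dq dq' mult_single)
  have "d + d' = 0" "q * q' = 1" using single_eq_singleD[OF eq] dq(2) dq'(2) by auto
  then have unit: "degree q = 0" "degree q' = 0"
    using degree_mult_eq[OF dq(2) dq'(2)] by auto
  have d': "d' = - d" using \<open>d + d' = 0\<close> by (simp add: eq_neg_iff_add_eq_0 add.commute)
  have "pole d = 0" "pole d' = 0" "d \<in> exps"
    using single_unit_in_A[of d q] single_unit_in_A[of d' q'] assms(1,2) dq dq' unit by auto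
  then have "d = 0"
    unfolding d' by (intro poly_mapping_eqI) (force simp: pole_eq_0_iff exps_iff)
  then show ?thesis using that dq unit by (metis degree_eq_zeroE pCons_0_0)
qed

end

locale coordinate_ring_aut = hypersurface_algebra I k P
  for I :: "nat set" and k and P :: "'a::field_char_0 poly" +
  fixes \<phi> \<psi> :: "'a laurent \<Rightarrow> 'a laurent"
  assumes phi_in: "\<And>a. a \<in> A \<Longrightarrow> \<phi> a \<in> A"
    and phi_add: "\<And>a b. a \<in> A \<Longrightarrow> b \<in> A \<Longrightarrow> \<phi> (a + b) = \<phi> a + \<phi> b"
    and phi_mult: "\<And>a b. a \<in> A \<Longrightarrow> b \<in> A \<Longrightarrow> \<phi> (a * b) = \<phi> a * \<phi> b"
    and phi_const: "\<And>c. \<phi> (single 0 [:c:]) = single 0 [:c:]"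
    and psi_in: "\<And>a. a \<in> A \<Longrightarrow> \<psi> a \<in> A"
    and psi_add: "\<And>a b. a \<in> A \<Longrightarrow> b \<in> A \<Longrightarrow> \<psi> (a + b) = \<psi> a + \<psi> b"
    and psi_mult: "\<And>a b. a \<in> A \<Longrightarrow> b \<in> A \<Longrightarrow> \<psi> (a * b) = \<psi> a * \<psi> b"
    and psi_const: "\<And>c. \<psi> (single 0 [:c:]) = single 0 [:c:]"
    and phi_psi: "\<And>a. a \<in> A \<Longrightarrow> \<phi> (\<psi> a) = a"
    and psi_phi: "\<And>a. a \<in> A \<Longrightarrow> \<psi> (\<phi> a) = a"
begin

interpretation D0: loc_nilp_deriv A D0 by (rule D0_lnd)

lemma swapped: "coordinate_ring_aut I k P \<psi> \<phi>"
  by unfold_locales (simp_all add: phi_in phi_add phi_mult phi_const phi_psi psi_in psi_add psi_mult psi_const psi_phi)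

lemma phi_zero: "\<phi> 0 = 0" and phi_one: "\<phi> 1 = 1"
  using phi_const[of 0] phi_const[of 1] by (simp_all flip: one_pCons)

lemma phi_eq_0_iff: "a \<in> A \<Longrightarrow> \<phi> a = 0 \<longleftrightarrow> a = 0"
  using psi_phi[of a] coordinate_ring_aut.phi_zero[OF swapped] phi_zero by auto

lemma phi_power: "a \<in> A \<Longrightarrow> \<phi> (a ^ n) = \<phi> a ^ n"
  by (induction n) (simp_all add: phi_one phi_mult A_power)

lemma phi_prod: "(\<And>i. i \<in> S \<Longrightarrow> f i \<in> A) \<Longrightarrow> \<phi> (prod f S) = (\<Prod>i\<in>S. \<phi> (f i))"
  by (induction S rule: infinite_finite_induct) (simp_all add: phi_one phi_mult A_prod)

lemma conjugate_lnd: "loc_nilp_deriv A (\<lambda>a. \<phi> (D0 (\<psi> a)))"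
proof
  fix a assume a: "a \<in> A"
  then show "\<phi> (D0 (\<psi> a)) \<in> A" by (simp add: phi_in psi_in D0.D_in)
  have pow: "((\<lambda>a. \<phi> (D0 (\<psi> a))) ^^ n) a = \<phi> ((D0 ^^ n) (\<psi> a))" for n
    by (induction n) (simp_all add: a phi_psi psi_phi psi_in D0.Dn_in)
  obtain n where "(D0 ^^ n) (\<psi> a) = 0" using D0.nilpotent[OF psi_in[OF a]] by blast
  then show "\<exists>n. ((\<lambda>a. \<phi> (D0 (\<psi> a))) ^^ n) a = 0"
    using pow[of n] phi_zero by (intro exI[of _ n]) simp
qed (simp_all add: A_add A_mult psi_in psi_add psi_mult phi_add phi_mult phi_psi D0.D_in D0.D_add D0.D_mult)

text \<open>
  The conjugate of \<open>D0\<close> by the inverse automorphism kills the \<open>y_i\<close>, hence the whole kernel of \<open>D0\<close>.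
\<close>

lemma phi_kernel:
  assumes "a \<in> A" "D0 a = 0"
  shows "D0 (\<phi> a) = 0"
proof -
  have "\<psi> (D0 (\<phi> a)) = 0"
    using lnd_kills_kernel_D0[OF coordinate_ring_aut.conjugate_lnd[OF swapped] assms] .
  then show ?thesis
    using coordinate_ring_aut.phi_eq_0_iff[OF swapped] assms(1) by (simp add: D0.D_in phi_in)
qed

text \<open>
  Let \<open>D\<close> be the conjugate of \<open>D0\<close> and \<open>b = \<phi> Z\<close>, so that \<open>D b = \<phi> Q\<close>. Proportionality of \<open>D\<close> and \<open>D0\<close>,
  together with \<open>D Z = Q g\<close>, gives \<open>\<phi> Q = D0 b * g\<close>. Since \<open>\<phi> Q\<close> is in the kernel of \<open>D0\<close>, so is its factor
  \<open>D0 b\<close>. Hence \<open>b\<close> has degree at most one in \<open>z\<close>, and as \<open>degree P \<ge> 2\<close>, it has no poles; therefore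
  \<open>D0 b\<close> is divisible by \<open>Q\<close> in \<open>A\<close>.
\<close>

lemma phi_Q_dvd:
  obtains h where "h \<in> A" "\<phi> Q = Q * h"
proof -
  define D where "D a = \<phi> (D0 (\<psi> a))" for a
  have lnd: "loc_nilp_deriv A D" unfolding D_def by (rule conjugate_lnd)
  define b where "b = \<phi> Z"
  have b: "b \<in> A" by (simp add: b_def phi_in A_Z)
  obtain g where g: "g \<in> A" "D Z = Q * g" using lnd_D_Z_dvd[OF lnd] .
  have "D b = \<phi> Q" by (simp add: D_def b_def psi_phi A_Z D0_Z)
  then have "Q * \<phi> Q = Q * (D0 b * g)"
    using lnd_proportional[OF lnd b] g(2) by (simp add: ac_simps)
  then have eq: "\<phi> Q = D0 b * g" by simp
  have "\<phi> Q \<noteq> 0" by (simp add: phi_eq_0_iff A_Q)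
  then have nz: "D0 b \<noteq> 0" "g \<noteq> 0" using eq by auto
  have "D0.deg (\<phi> Q) = 0"
    using phi_kernel[OF A_Q D0_Q] by (simp add: D0.deg_eq_0_iff phi_in A_Q)
  then have "D0.deg (D0 b) = 0"
    using D0.deg_mult[OF D0.D_in[OF b] g(1) nz] eq by simp
  then have DDb: "D0 (D0 b) = 0" using D0.deg_eq_0_iff D0.D_in[OF b] by blast
  define u where "u = single (- kvec) 1 * D0 b"
  have lookup_u: "lookup u e = pderiv (lookup b e)" for e
    using lookup_single_times[of "- kvec" 1 "D0 b" "e + kvec"] by (simp add: u_def lookup_D0)
  have "u \<in> A"
  proof (rule in_A_if_nonneg)
    fix e assume "e \<in> keys u"
    then have nz: "pderiv (lookup b e) \<noteq> 0" by (simp add: in_keys_iff lookup_u)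
    then have e: "e \<in> keys b" by (auto simp: in_keys_iff)
    then show "e \<in> exps" using keys_A[OF b] by blast
    fix i assume "i \<in> I"
    have "pderiv (pderiv (lookup b e)) = 0"
      using DDb lookup_D0[of "D0 b" "e + kvec"] lookup_D0[of b e] by simp
    then have "degree (lookup b e) \<le> 1" by (simp add: pderiv_eq_0_iff degree_pderiv)
    then have "pole e = 0"
      using degree_if_pole_dvd[OF dvd_lookup_A[OF b], of e] e degree_P by (simp add: in_keys_iff)
    then show "0 \<le> lookup e i" using \<open>i \<in> I\<close> by (simp add: pole_eq_0_iff)
  qed
  moreover have "\<phi> Q = Q * (u * g)"
    unfolding eq u_def by (simp add: mult_single flip: mult.assoc)
  ultimately show ?thesis using that g(1) A_mult by blast
qed

text \<open>
  Since \<open>\<phi>\<close> and its inverse both map \<open>Q\<close> to a multiple of \<open>Q\<close>, the quotient of \<open>\<phi> Q\<close> by \<open>Q\<close> is a unit of \<open>A\<close>.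
\<close>

lemma phi_Q:
  obtains c where "c \<noteq> 0" "\<phi> Q = single kvec [:c:]"
proof -
  obtain h where h: "h \<in> A" "\<phi> Q = Q * h" using phi_Q_dvd .
  obtain h' where h': "h' \<in> A" "\<psi> Q = Q * h'"
    using coordinate_ring_aut.phi_Q_dvd[OF swapped] .
  have "Q * 1 = \<phi> (\<psi> Q)" by (simp add: phi_psi A_Q)
  also have "\<dots> = Q * (h * \<phi> h')" using h h' by (simp add: phi_mult A_Q ac_simps)
  finally have "h * \<phi> h' = 1" by simp
  then obtain c where "c \<noteq> 0" "h = single 0 [:c:]"
    using unit_in_A[OF h(1) phi_in[OF h'(1)]] by blast
  then show ?thesis using that h(2) by (simp add: mult_single)
qed

text \<open>
  \<open>Y i\<close> divides \<open>Q\<close>, so its image divides a monomial.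
\<close>

lemma phi_Y_monomial:
  assumes i: "i \<in> I"
  obtains e c where "c \<noteq> 0" "\<phi> (Y i) = single e [:c:]" "pole e = 0" "e \<in> exps"
proof -
  let ?r = "single (kvec - single i 1) 1 :: 'a laurent"
  have "?r \<in> A"
  proof (rule in_A_if_nonneg)
    fix e assume "e \<in> keys ?r"
    then have e: "e = kvec + - single i 1" by simp
    show "e \<in> exps" unfolding e using i by (intro exps_add exps_uminus exps_kvec exps_single)
    fix j assume "j \<in> I"
    then show "0 \<le> lookup e j"
      using k_pos[of j] unfolding e by (auto simp: lookup_add lookup_minus lookup_kvec lookup_single when_def)
  qed
  moreover have "Q = Y i * ?r" by (simp add: Y_def mult_single)
  ultimately have eq: "\<phi> Q = \<phi> (Y i) * \<phi> ?r" using A_Y[OF i] by (metis phi_mult)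
  obtain c where c: "c \<noteq> 0" "\<phi> Q = single kvec [:c:]" using phi_Q .
  have eq1: "\<phi> (Y i) * \<phi> ?r = single kvec [:c:]" "\<phi> ?r * \<phi> (Y i) = single kvec [:c:]"
    using eq c by (simp_all add: mult.commute)
  obtain d q where dq: "\<phi> (Y i) = single d q" "q \<noteq> 0" using factor_of_single[OF eq1(1)] c(1) by auto
  obtain d' q' where dq': "\<phi> ?r = single d' q'" "q' \<noteq> 0" using factor_of_single[OF eq1(2)] c(1) by auto
  have "single (d + d') (q * q') = single kvec [:c:]"
    using eq1(1) by (simp add: dq dq' mult_single)
  then have "q * q' = [:c:]" using single_eq_singleD dq(2) dq'(2) by (metis mult_eq_0_iff)
  then have "degree (q * q') = 0" by simp
  then have "degree q = 0" using degree_mult_eq[OF dq(2) dq'(2)] by simp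
  then obtain b where b: "q = [:b:]" "b \<noteq> 0" using dq(2) by (metis degree_eq_zeroE pCons_0_0)
  have "single d q \<in> A" using phi_in[OF A_Y[OF i]] dq(1) by simp
  then have "pole d = 0" "d \<in> exps"
    using single_unit_in_A[of d q] dq(2) \<open>degree q = 0\<close> by auto
  then show ?thesis using that b dq(1) by blast
qed

lemma phi_Y_nonconstant:
  assumes "i \<in> I" "\<phi> (Y i) = single e [:c:]" "pole e = 0" "e \<in> exps"
  shows "total e > 0"
proof (rule ccontr)
  assume "\<not> total e > 0"
  then have "nat (lookup e j) = 0" if "j \<in> I" for j
    using finite_I that by (simp add: total_def)
  then have "lookup e j = 0" for j
    using assms(3,4) by (cases "j \<in> I") (force simp: pole_eq_0_iff exps_iff)+
  then have "e = 0" by (intro poly_mapping_eqI) simp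
  then have "Y i = single 0 [:c:]"
    using psi_phi[OF A_Y[OF assms(1)]] assms(2) psi_const by simp
  then have "single i (1::int) = 0" unfolding Y_def by (rule single_one_eqD)
  then show False by simp
qed

text \<open>
  The monomial \<open>\<phi> (Y i)\<close> is mapped back to \<open>Y i\<close>, of total degree one, by replacing each of its variables by
  a nonconstant monomial. So it consists of one variable.
\<close>

lemma phi_Y_variable:
  assumes i: "i \<in> I"
  obtains l c where "l \<in> I" "c \<noteq> 0" "\<phi> (Y i) = single (single l 1) [:c:]"
proof -
  obtain e c where e: "c \<noteq> 0" "\<phi> (Y i) = single e [:c:]" "pole e = 0" "e \<in> exps"
    using phi_Y_monomial[OF i] .
  define n where "n l = nat (lookup e l)" for l
  have "\<exists>f d. d \<noteq> 0 \<and> \<psi> (Y l) = single f [:d:] \<and> pole f = 0 \<and> f \<in> exps" if "l \<in> I" for l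
    using coordinate_ring_aut.phi_Y_monomial[OF swapped that] by metis
  then obtain f d where f: "\<And>l. l \<in> I \<Longrightarrow> d l \<noteq> 0 \<and> \<psi> (Y l) = single (f l) [:d l:] \<and> pole (f l) = 0 \<and> f l \<in> exps"
    by metis
  have f_pos: "total (f l) > 0" if "l \<in> I" for l
  proof -
    have "\<psi> (Y l) = single (f l) [:d l:]" "pole (f l) = 0" "f l \<in> exps" using f[OF that] by auto
    then show ?thesis by (rule coordinate_ring_aut.phi_Y_nonconstant[OF swapped that])
  qed
  have "single e [:c:] = (\<Prod>l\<in>I. Y l ^ n l) * single 0 [:c:]"
    using homogeneous_factorization[OF e(4), of "[:c:]"] e(3) by (simp add: n_def)
  then have "Y i = \<psi> ((\<Prod>l\<in>I. Y l ^ n l) * single 0 [:c:])"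
    using psi_phi[OF A_Y[OF i]] e(2) by simp
  also have "\<dots> = (\<Prod>l\<in>I. \<psi> (Y l) ^ n l) * single 0 [:c:]"
    by (simp add: psi_mult psi_const A_prod A_power A_Y coordinate_ring_aut.phi_prod[OF swapped]
        coordinate_ring_aut.phi_power[OF swapped])
  also have "(\<Prod>l\<in>I. \<psi> (Y l) ^ n l) = (\<Prod>l\<in>I. single (f l) [:d l:] ^ n l)"
    using f by (intro prod.cong) auto
  also have "\<dots> * single 0 [:c:] =
      single (\<Sum>l\<in>I. \<Sum>j<n l. f l) ((\<Prod>l\<in>I. [:d l:] ^ n l) * [:c:])"
    by (simp add: single_power single_prod mult_single del: sum_constant)
  finally have "single (single i 1) 1 =
      single (\<Sum>l\<in>I. \<Sum>j<n l. f l) ((\<Prod>l\<in>I. [:d l:] ^ n l) * [:c:])"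
    by (simp add: Y_def del: sum_constant)
  then have exp: "single i 1 = (\<Sum>l\<in>I. \<Sum>j<n l. f l)"
    by (rule single_one_eqD)
  have f_nonneg: "0 \<le> lookup (f l) j" if "l \<in> I" "j \<in> I" for l j
    using f[OF that(1)] that(2) by (simp add: pole_eq_0_iff)
  have "int (\<Sum>l\<in>I. n l * total (f l)) = (\<Sum>l\<in>I. \<Sum>j\<in>I. int (n l) * lookup (f l) j)"
    using f_nonneg by (simp add: total_def sum_distrib_left)
  also have "\<dots> = (\<Sum>j\<in>I. lookup (\<Sum>l\<in>I. \<Sum>j<n l. f l) j)"
    by (subst sum.swap, rule sum.cong[OF refl], subst lookup_sum)
      (simp add: lookup_sum_const del: sum_constant)
  also have "\<dots> = 1"
    using finite_I i by (simp add: exp[symmetric] lookup_single when_def del: sum_constant)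
  finally have "(\<Sum>l\<in>I. n l * total (f l)) = 1" by linarith
  then obtain l where l: "l \<in> I" "n l * total (f l) = 1" "\<And>j. j \<in> I \<Longrightarrow> j \<noteq> l \<Longrightarrow> n j * total (f j) = 0"
    using sum_eq_1_iff[OF finite_I, of "\<lambda>l. n l * total (f l)"] by auto
  have "e = single l 1"
  proof (rule poly_mapping_eqI)
    fix j
    have "n j = 0" if "j \<in> I" "j \<noteq> l" using l(3)[OF that] f_pos[OF that(1)] by simp
    then show "lookup e j = lookup (single l 1) j"
      using l(1,2) e(3,4) by (auto simp: lookup_single when_def n_def pole_eq_0_iff exps_iff)
        (metis antisym)+
  qed
  then show ?thesis using that l(1) e by blast
qed

text \<open>
  Compare the exponents of \<open>Y l\<close> in \<open>Q\<close> and in \<open>\<phi> Q\<close>, which are equal as \<open>\<phi> Q\<close> is a scalar multiple of \<open>Q\<close>.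
\<close>

lemma phi_Y_weight_le:
  assumes i: "i \<in> I" and eq: "\<phi> (Y i) = single (single l 1) [:c:]" and l: "l \<in> I"
  shows "k i \<le> k l"
proof -
  have "\<exists>l c. \<phi> (Y j) = single (single l 1) [:c:]" if "j \<in> I" for j
    using phi_Y_variable[OF that] by metis
  then obtain s b where s: "\<And>j. j \<in> I \<Longrightarrow> \<phi> (Y j) = single (single (s j) 1) [:b j:]" by metis
  have si: "s i = l"
  proof -
    have eq': "single (single (s i) (1::int)) [:b i:] = single (single l 1) [:c:]"
      using s[OF i] eq by simp
    have "single (single (s i) (1::int)) [:b i:] \<noteq> 0"
      using phi_eq_0_iff[OF A_Y[OF i]] unfolding s[OF i] by simp
    then have "[:b i:] \<noteq> 0" by simp
    then have "single (s i) (1::int) = single l 1" using single_eq_singleD[OF eq'] by simp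
    then show ?thesis by (rule single_one_eqD)
  qed
  obtain a where a: "a \<noteq> 0" "\<phi> Q = single kvec [:a:]" using phi_Q .
  have "\<phi> Q = (\<Prod>j\<in>I. \<phi> (Y j) ^ k j)"
    by (simp add: prod_Y[symmetric] phi_prod phi_power A_power A_Y)
  also have "\<dots> = (\<Prod>j\<in>I. single (single (s j) 1) [:b j:] ^ k j)"
    using s by (intro prod.cong) auto
  also have "\<dots> = single (\<Sum>j\<in>I. \<Sum>t<k j. single (s j) 1) (\<Prod>j\<in>I. [:b j:] ^ k j)"
    by (simp add: single_power single_prod del: sum_constant)
  finally have eq': "single kvec [:a:] =
      single (\<Sum>j\<in>I. \<Sum>t<k j. single (s j) 1) (\<Prod>j\<in>I. [:b j:] ^ k j)"
    using a(2) by simp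
  have kvec: "kvec = (\<Sum>j\<in>I. \<Sum>t<k j. single (s j) 1)"
    using single_eq_singleD[OF eq'] a(1) by simp
  have "lookup kvec l = (\<Sum>j\<in>I. lookup (\<Sum>t<k j. single (s j) (1::int)) l)"
    unfolding kvec by (rule lookup_sum)
  then have "int (k l) = (\<Sum>j\<in>I. int (k j) * (if l = s j then 1 else 0))"
    using l by (simp add: lookup_kvec lookup_sum_const lookup_single when_def del: sum_constant cong: if_cong)
  also have "\<dots> \<ge> int (k i) * (if l = s i then 1 else 0)"
    using finite_I i by (intro member_le_sum) auto
  finally show ?thesis using si by simp
qed

theorem phi_permutes_variables:
  assumes i: "i \<in> I"
  shows "\<exists>l\<in>I. \<exists>c. c \<noteq> 0 \<and> k l = k i \<and> \<phi> (Y i) = single 0 [:c:] * Y l"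
proof -
  obtain l c where l: "l \<in> I" "c \<noteq> 0" "\<phi> (Y i) = single (single l 1) [:c:]"
    using phi_Y_variable[OF i] .
  obtain j d where j: "j \<in> I" "d \<noteq> 0" "\<psi> (Y l) = single (single j 1) [:d:]"
    using coordinate_ring_aut.phi_Y_variable[OF swapped l(1)] .
  have fac: "\<phi> (Y i) = single 0 [:c:] * Y l" using l(3) by (simp add: Y_def mult_single)
  have "Y i = single 0 [:c:] * \<psi> (Y l)"
    using psi_phi[OF A_Y[OF i]] l(1) by (simp add: fac psi_mult psi_const A_Y)
  then have "single (single i 1) 1 = single (single j (1::int)) ([:c:] * [:d:])"
    unfolding j(3) unfolding Y_def by (simp add: mult_single)
  then have "single i (1::int) = single j 1" by (rule single_one_eqD)
  then have "j = i" by (rule single_one_eqD[symmetric])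
  then have "k l \<le> k i"
    using coordinate_ring_aut.phi_Y_weight_le[OF swapped l(1) j(3) j(1)] by simp
  moreover have "k i \<le> k l" using phi_Y_weight_le[OF i l(3,1)] .
  ultimately show ?thesis using l fac by (intro bexI[of _ l] exI[of _ c]) auto
qed

end

section \<open>Regular functions on the hypersurface\<close>

lemma two_powi_inject:
  assumes "(2 :: 'a::field_char_0) powi a = 2 powi b"
  shows "a = b"
proof -
  have False if "a < b" "(2 :: 'a) powi a = 2 powi b" for a b :: int
  proof -
    have "(2 :: 'a) powi b = 2 powi a * 2 powi (b - a)" by (simp flip: power_int_add)
    then have "(2 :: 'a) powi (b - a) = 1" using that(2) by simp
    then have "of_nat (2 ^ nat (b - a)) = (of_nat 1 :: 'a)" using that(1) by (simp add: power_int_def)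
    then have "2 ^ nat (b - a) = (1 :: nat)" by (simp only: of_nat_eq_iff)
    then show False using that(1) by simp
  qed
  then show ?thesis using assms by (metis linorder_neqE_linordered_idom)
qed

text \<open>
  Distinct monomials are distinct characters of the torus, as one sees by putting one coordinate equal to \<open>2\<close>
  and the others equal to \<open>1\<close>; the proof is Dedekind's proof of the linear independence of characters.
\<close>

lemma monomial_functions_independent:
  fixes c :: "(nat \<Rightarrow>\<^sub>0 int) \<Rightarrow> 'a::field_char_0"
  assumes "finite J" "finite S"
    and "\<And>e. e \<in> S \<Longrightarrow> keys e \<subseteq> J"
    and "\<And>y. (\<And>i. i \<in> J \<Longrightarrow> y i \<noteq> 0) \<Longrightarrow> (\<Sum>e\<in>S. c e * (\<Prod>i\<in>J. y i powi lookup e i)) = 0"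
  shows "\<forall>e\<in>S. c e = 0"
  using assms(2-4)
proof (induction S arbitrary: c)
  case (insert e0 S)
  define \<chi> where "\<chi> e y = (\<Prod>i\<in>J. y i powi lookup e i)" for e and y :: "nat \<Rightarrow> 'a"
  have rel: "c e0 * \<chi> e0 y + (\<Sum>e\<in>S. c e * \<chi> e y) = 0" if "\<And>i. i \<in> J \<Longrightarrow> y i \<noteq> 0" for y
    using insert.prems(2)[OF that] insert.hyps by (simp add: \<chi>_def)
  have zero: "c e = 0" if e: "e \<in> S" for e
  proof -
    have "e \<noteq> e0" using e insert.hyps by blast
    then obtain i where i: "lookup e i \<noteq> lookup e0 i" by (meson poly_mapping_eqI)
    then have iJ: "i \<in> J" using insert.prems(1)[of e] insert.prems(1)[of e0] e
      by (metis in_keys_iff insert_iff subsetD)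
    define t where "t = (\<lambda>j. if j = i then 2 else 1 :: 'a)"
    have chi_t: "\<chi> d t = 2 powi lookup d i" for d
    proof -
      have "\<chi> d t = (\<Prod>j\<in>J. if j = i then 2 powi lookup d i else 1)"
        unfolding \<chi>_def by (intro prod.cong) (auto simp: t_def)
      then show ?thesis using iJ assms(1) by simp
    qed
    have mult: "\<chi> d (\<lambda>j. t j * y j) = \<chi> d t * \<chi> d y" for d y
      by (simp add: \<chi>_def power_int_mult_distrib prod.distrib)
    have "\<forall>e\<in>S. c e * (\<chi> e t - \<chi> e0 t) = 0"
    proof (rule insert.IH)
      fix y :: "nat \<Rightarrow> 'a" assume y: "\<And>i. i \<in> J \<Longrightarrow> y i \<noteq> 0"
      have "c e0 * \<chi> e0 (\<lambda>j. t j * y j) + (\<Sum>e\<in>S. c e * \<chi> e (\<lambda>j. t j * y j)) = 0"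
        using y by (intro rel) (auto simp: t_def)
      moreover have "\<chi> e0 t * (c e0 * \<chi> e0 y + (\<Sum>e\<in>S. c e * \<chi> e y)) = 0"
        using rel[OF y] by simp
      ultimately have "c e0 * (\<chi> e0 t * \<chi> e0 y) + (\<Sum>e\<in>S. c e * (\<chi> e t * \<chi> e y)) =
          c e0 * (\<chi> e0 t * \<chi> e0 y) + \<chi> e0 t * (\<Sum>e\<in>S. c e * \<chi> e y)"
        by (simp add: mult algebra_simps)
      then have "(\<Sum>e\<in>S. c e * (\<chi> e t * \<chi> e y)) - \<chi> e0 t * (\<Sum>e\<in>S. c e * \<chi> e y) = 0" by simp
      then show "(\<Sum>e\<in>S. c e * (\<chi> e t - \<chi> e0 t) * (\<Prod>i\<in>J. y i powi lookup e i)) = 0"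
        by (simp add: sum_distrib_left algebra_simps sum_subtractf flip: \<chi>_def)
    qed (use insert.prems in auto)
    moreover have "(2 :: 'a) powi lookup e i \<noteq> 2 powi lookup e0 i"
      using i two_powi_inject by blast
    ultimately show ?thesis using e by (auto simp: chi_t)
  qed
  have "\<chi> e0 (\<lambda>j. 1) = 1" by (simp add: \<chi>_def)
  then have "c e0 = 0" using rel[of "\<lambda>j. 1"] zero by simp
  then show ?case using zero by auto
qed simp

locale hypersurface_variety =
  fixes m :: nat and k :: "nat \<Rightarrow> nat" and P :: "'a::field_char_0 poly"
  assumes m_ge: "m \<ge> 2" and k_1: "k 1 = 1" and k_ge_2: "\<And>i. i \<in> {2..m} \<Longrightarrow> k i \<ge> 2"
    and degree_P_ge_2: "degree P \<ge> 2"
begin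

definition I :: "nat set" where "I = {2..m}"

sublocale hypersurface_algebra I k P
  by unfold_locales (auto simp: I_def k_ge_2 degree_P_ge_2)

abbreviation V :: "(nat \<Rightarrow> 'a) set" where "V \<equiv> hypersurface m k P"

lemma V_iff: "x \<in> V \<longleftrightarrow> x \<in> affine_space (m + 1) \<and> x 1 * (\<Prod>i\<in>I. x i ^ k i) = poly P (x (m + 1))"
proof -
  have "{1..m} = insert 1 I" "1 \<notin> I" using m_ge by (auto simp: I_def)
  then have "(\<Prod>i=1..m. x i ^ k i) = x 1 * (\<Prod>i\<in>I. x i ^ k i)"
    using finite_I k_1 by simp
  then show ?thesis by (simp add: hypersurface_def)
qed

text \<open>
  The regular function on the hypersurface that corresponds to an element of \<open>A\<close>. Replacing \<open>P ^ pole e / (y\<^sup>k) ^ pole e\<close> by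
  \<open>y_1 ^ pole e\<close> gives a formula without denominators, which also makes sense at the points where some \<open>y_i\<close>
  vanishes.
\<close>

definition section_piece :: "(nat \<Rightarrow> 'a) \<Rightarrow> (nat \<Rightarrow>\<^sub>0 int) \<Rightarrow> 'a poly \<Rightarrow> 'a"
  where "section_piece x e p = x 1 ^ pole e *
    (\<Prod>i\<in>I. x i ^ nat (lookup e i + int (pole e) * int (k i))) * poly (p div P ^ pole e) (x (m + 1))"

definition section_of :: "'a laurent \<Rightarrow> (nat \<Rightarrow> 'a) \<Rightarrow> 'a"
  where "section_of a x = lin (section_piece x) a"

lemma section_piece_additive: "additive_pieces (section_piece x)"
  by (simp add: additive_pieces_def section_piece_def poly_div_add_left algebra_simps)

lemma section_of_single: "section_of (single e p) x = section_piece x e p"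
  unfolding section_of_def by (rule lin_single[OF section_piece_additive])

lemma section_of_add: "a \<in> A \<Longrightarrow> b \<in> A \<Longrightarrow> section_of (a + b) x = section_of a x + section_of b x"
  unfolding section_of_def by (rule lin_add[OF section_piece_additive])

lemma section_of_const: "section_of (single 0 [:c:]) x = c"
  by (simp add: section_of_single section_piece_def)

lemma section_of_Z: "section_of Z x = x (m + 1)"
  by (simp add: Z_def section_of_single section_piece_def)

lemma section_of_Y:
  assumes "i \<in> I"
  shows "section_of (Y i) x = x i"
proof -
  have "pole (single i 1) = 0"
    by (auto simp: pole_eq_0_iff lookup_single when_def)
  moreover have "(\<Prod>j\<in>I. x j ^ nat (lookup (single i 1) j)) = (\<Prod>j\<in>I. if j = i then x i else 1)"
    by (intro prod.cong) (auto simp: lookup_single when_def)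
  ultimately show ?thesis
    using assms finite_I by (simp add: Y_def section_of_single section_piece_def)
qed

lemma section_of_X: "section_of X x = x 1"
proof -
  have "pole (- kvec) \<noteq> 0"
  proof
    have "2 \<in> I" using m_ge by (simp add: I_def)
    moreover assume "pole (- kvec) = 0"
    ultimately have "0 \<le> lookup (- kvec) 2" by (simp only: pole_eq_0_iff)
    then show False using \<open>2 \<in> I\<close> k_pos[of 2] by (simp add: lookup_kvec)
  qed
  then have "pole (- kvec) = 1" using pole_minus_kvec by linarith
  then show ?thesis
    by (simp add: X_def section_of_single section_piece_def lookup_kvec)
qed

text \<open>
  The pole order of a product may be smaller than the sum of the pole orders; the difference is made up by the
  equation of the hypersurface.
\<close>

lemma section_piece_mult:
  assumes x: "x \<in> V" and A: "single d p \<in> A" "single e q \<in> A"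
  shows "section_piece x (d + e) (p * q) = section_piece x d p * section_piece x e q"
proof (cases "p = 0 \<or> q = 0")
  case True
  then show ?thesis by (auto simp: section_piece_def)
next
  case False
  then obtain p' q' where p: "p = P ^ pole d * p'" and q: "q = P ^ pole e * q'"
    using A by (auto simp: single_in_A_iff elim!: dvdE)
  obtain r where r: "pole d + pole e = pole (d + e) + r"
    using pole_add[of d e] by (auto simp: le_iff_add)
  have "p * q = P ^ (pole d + pole e) * (p' * q')" by (simp add: p q power_add)
  also have "\<dots> = P ^ pole (d + e) * (P ^ r * (p' * q'))" by (simp add: r power_add)
  finally have "poly (p * q div P ^ pole (d + e)) (x (m + 1)) =
      (x 1 * (\<Prod>i\<in>I. x i ^ k i)) ^ r * (poly p' (x (m + 1)) * poly q' (x (m + 1)))"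
    using x by (simp add: V_iff)
  moreover have "(\<Prod>i\<in>I. x i ^ nat (lookup (d + e) i + int (pole (d + e)) * int (k i))) * (\<Prod>i\<in>I. x i ^ k i) ^ r =
      (\<Prod>i\<in>I. x i ^ nat (lookup d i + int (pole d) * int (k i))) *
      (\<Prod>i\<in>I. x i ^ nat (lookup e i + int (pole e) * int (k i)))"
    unfolding prod_power_distrib prod.distrib[symmetric]
  proof (intro prod.cong refl)
    fix i assume i: "i \<in> I"
    have r': "int (pole d) + int (pole e) = int (pole (d + e)) + int r" using r by linarith
    have "int (pole d) * int (k i) + int (pole e) * int (k i) = (int (pole d) + int (pole e)) * int (k i)"
      by (simp add: algebra_simps)
    also have "\<dots> = int (pole (d + e)) * int (k i) + int (k i * r)"
      unfolding r' by (simp add: algebra_simps)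
    finally have "int (nat (lookup (d + e) i + int (pole (d + e)) * int (k i)) + k i * r) =
        int (nat (lookup d i + int (pole d) * int (k i)) + nat (lookup e i + int (pole e) * int (k i)))"
      using pole_ge[OF i, of d] pole_ge[OF i, of e] pole_ge[OF i, of "d + e"]
      by (simp add: lookup_add)
    then have "nat (lookup (d + e) i + int (pole (d + e)) * int (k i)) + k i * r =
        nat (lookup d i + int (pole d) * int (k i)) + nat (lookup e i + int (pole e) * int (k i))"
      by (simp only: of_nat_eq_iff)
    then show "x i ^ nat (lookup (d + e) i + int (pole (d + e)) * int (k i)) * (x i ^ k i) ^ r =
        x i ^ nat (lookup d i + int (pole d) * int (k i)) * x i ^ nat (lookup e i + int (pole e) * int (k i))"
      by (simp flip: power_add power_mult)
  qed
  moreover have "x 1 ^ pole d * x 1 ^ pole e = x 1 ^ pole (d + e) * x 1 ^ r"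
    by (simp add: r flip: power_add)
  moreover have "p div P ^ pole d = p'" "q div P ^ pole e = q'" by (simp_all add: p q)
  ultimately show ?thesis
    unfolding section_piece_def by (simp add: power_mult_distrib ac_simps)
qed

lemma section_of_mult:
  assumes "x \<in> V" "a \<in> A" "b \<in> A"
  shows "section_of (a * b) x = section_of a x * section_of b x"
proof -
  have "section_of (a * b) x = (\<Sum>d\<in>keys a. \<Sum>e\<in>keys b. section_piece x (d + e) (lookup a d * lookup b e))"
    unfolding section_of_def by (rule lin_mult[OF section_piece_additive assms(2,3)])
  also have "\<dots> = (\<Sum>d\<in>keys a. \<Sum>e\<in>keys b. section_piece x d (lookup a d) * section_piece x e (lookup b e))"
    using assms by (intro sum.cong refl section_piece_mult homogeneous_part_in_A)
  finally show ?thesis by (simp add: section_of_def lin_def sum_product)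
qed

text \<open>
  The point with given coordinates \<open>y_i \<noteq> 0\<close> and \<open>z = t\<close>; the equation determines \<open>y_1\<close>. For fixed \<open>y\<close>
  these points form a curve that \<open>z\<close> maps isomorphically to the affine line.
\<close>

definition torus_point :: "(nat \<Rightarrow> 'a) \<Rightarrow> 'a \<Rightarrow> nat \<Rightarrow> 'a"
  where "torus_point y t = (\<lambda>j. if j = 1 then poly P t / (\<Prod>i\<in>I. y i ^ k i)
    else if j \<in> I then y j else if j = m + 1 then t else undefined)"

definition in_torus :: "(nat \<Rightarrow> 'a) \<Rightarrow> bool"
  where "in_torus y \<longleftrightarrow> (\<forall>i\<in>I. y i \<noteq> 0)"

lemma torus_point_simps [simp]:
  "i \<in> I \<Longrightarrow> torus_point y t i = y i" "torus_point y t (Suc m) = t"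
  "torus_point y t (Suc 0) = poly P t / (\<Prod>i\<in>I. y i ^ k i)"
  using m_ge by (auto simp: torus_point_def I_def)

lemma torus_point_in_V: "in_torus y \<Longrightarrow> torus_point y t \<in> V"
  using finite_I m_ge by (auto simp: V_iff in_torus_def affine_space_def PiE_def extensional_def torus_point_def I_def)

lemma eq_torus_point:
  assumes "x \<in> V" "in_torus y" "\<And>i. i \<in> I \<Longrightarrow> x i = y i"
  shows "x = torus_point y (x (m + 1))"
proof
  fix j
  have "(\<Prod>i\<in>I. x i ^ k i) = (\<Prod>i\<in>I. y i ^ k i)" using assms(3) by simp
  moreover have "(\<Prod>i\<in>I. y i ^ k i) \<noteq> 0" using assms(2) finite_I by (simp add: in_torus_def)
  ultimately have "x 1 = poly P (x (m + 1)) / (\<Prod>i\<in>I. y i ^ k i)"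
    using assms(1) by (auto simp: V_iff field_simps)
  moreover have "x j = undefined" if "j \<notin> {1..m+1}"
    using assms(1) that by (auto simp: V_iff affine_space_def PiE_def extensional_def)
  ultimately show "x j = torus_point y (x (m + 1)) j"
    using assms(3) by (auto simp: torus_point_def I_def)
qed

lemma section_of_torus_point:
  assumes a: "a \<in> A" and y: "in_torus y"
  shows "section_of a (torus_point y t) = (\<Sum>e\<in>keys a. poly (lookup a e) t * (\<Prod>i\<in>I. y i powi lookup e i))"
  unfolding section_of_def lin_def
proof (intro sum.cong refl)
  fix e assume "e \<in> keys a"
  obtain q where q: "lookup a e = P ^ pole e * q" using dvd_lookup_A[OF a, of e] by (auto elim: dvdE)
  have "(\<Prod>i\<in>I. y i ^ nat (lookup e i + int (pole e) * int (k i))) =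
      (\<Prod>i\<in>I. y i powi lookup e i) * (\<Prod>i\<in>I. y i ^ k i) ^ pole e"
    unfolding prod_power_distrib prod.distrib[symmetric]
  proof (intro prod.cong refl)
    fix i assume i: "i \<in> I"
    then have nz: "y i \<noteq> 0" using y by (simp add: in_torus_def)
    have "y i ^ nat (lookup e i + int (pole e) * int (k i)) = y i powi (lookup e i + int (k i * pole e))"
      using pole_ge[OF i, of e] by (simp add: power_int_def ac_simps)
    also have "\<dots> = y i powi lookup e i * (y i ^ k i) ^ pole e"
      using nz by (simp add: power_int_add power_mult del: of_nat_mult)
    finally show "y i ^ nat (lookup e i + int (pole e) * int (k i)) = y i powi lookup e i * (y i ^ k i) ^ pole e" .
  qed
  moreover have "(\<Prod>i\<in>I. y i ^ k i) \<noteq> 0" using y finite_I by (simp add: in_torus_def)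
  ultimately show "section_piece (torus_point y t) e (lookup a e) =
      poly (lookup a e) t * (\<Prod>i\<in>I. y i powi lookup e i)"
    by (simp add: section_piece_def q power_divide)
qed

lemma section_of_eq_0:
  assumes a: "a \<in> A" and zero: "\<And>y t. in_torus y \<Longrightarrow> section_of a (torus_point y t) = 0"
  shows "a = 0"
proof (rule poly_mapping_eqI)
  fix e
  show "lookup a e = lookup 0 e"
  proof (cases "e \<in> keys a")
    case True
    have "poly (lookup a e) t = 0" for t
    proof -
      have "\<forall>e\<in>keys a. poly (lookup a e) t = 0"
      proof (rule monomial_functions_independent[OF finite_I])
        fix y :: "nat \<Rightarrow> 'a" assume "\<And>i. i \<in> I \<Longrightarrow> y i \<noteq> 0"
        then have "in_torus y" by (simp add: in_torus_def)
        from zero[OF this, of t] show "(\<Sum>e\<in>keys a. poly (lookup a e) t * (\<Prod>i\<in>I. y i powi lookup e i)) = 0"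
          by (simp only: section_of_torus_point[OF a \<open>in_torus y\<close>])
      qed (use keys_A[OF a] in \<open>auto simp: exps_def\<close>)
      then show ?thesis using True by blast
    qed
    then show ?thesis using poly_all_0_iff_0[of "lookup a e"] by simp
  qed (simp add: in_keys_iff)
qed

text \<open>
  On the torus an element of \<open>A\<close> is evaluated as a Laurent polynomial, so it is determined by its values there.
  This serves as the density of the torus in the hypersurface.
\<close>

lemma section_of_inject:
  assumes a: "a \<in> A" and b: "b \<in> A"
    and eq: "\<And>y t. in_torus y \<Longrightarrow> section_of a (torus_point y t) = section_of b (torus_point y t)"
  shows "a = b"
proof -
  let ?d = "a + single 0 [:- 1:] * b"
  have d: "?d \<in> A" by (intro A_add A_mult a b) simp
  have "?d = 0"
    using eq by (intro section_of_eq_0[OF d])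
      (simp add: section_of_add section_of_mult[OF torus_point_in_V] section_of_const a b A_mult)
  moreover have "single 0 [:- 1:] = (- 1 :: 'a laurent)"
  proof -
    have "single 0 [:- 1:] = (single 0 (- 1) :: 'a laurent)" by (simp add: one_pCons)
    then show ?thesis by (simp only: single_uminus single_one)
  qed
  ultimately show ?thesis by simp
qed

text \<open>
  Regular functions are sections because sections form a ring of functions that contains the coordinates.
\<close>

definition is_section :: "((nat \<Rightarrow> 'a) \<Rightarrow> 'a) \<Rightarrow> bool"
  where "is_section g \<longleftrightarrow> (\<exists>a\<in>A. \<forall>x\<in>V. g x = section_of a x)"

lemma is_sectionI: "a \<in> A \<Longrightarrow> (\<And>x. x \<in> V \<Longrightarrow> g x = section_of a x) \<Longrightarrow> is_section g"
  by (auto simp: is_section_def)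

lemma is_section_const: "is_section (\<lambda>x. c)"
  by (rule is_sectionI[of "single 0 [:c:]"]) (simp_all add: section_of_const)

lemma is_section_coord:
  assumes "j \<in> {1..m + 1}"
  shows "is_section (\<lambda>x. x j)"
proof -
  consider "j = 1" | "j \<in> I" | "j = m + 1" using assms by (fastforce simp: I_def)
  then show ?thesis
  proof cases
    case 1
    then show ?thesis by (intro is_sectionI[of X]) (simp_all add: A_X section_of_X)
  next
    case 2
    then show ?thesis by (intro is_sectionI[of "Y j"]) (simp_all add: A_Y section_of_Y)
  next
    case 3
    then show ?thesis by (intro is_sectionI[of Z]) (simp_all add: A_Z section_of_Z)
  qed
qed

lemma is_section_add: "is_section f \<Longrightarrow> is_section g \<Longrightarrow> is_section (\<lambda>x. f x + g x)"
  unfolding is_section_def using A_add section_of_add by metis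

lemma is_section_mult: "is_section f \<Longrightarrow> is_section g \<Longrightarrow> is_section (\<lambda>x. f x * g x)"
  unfolding is_section_def using A_mult section_of_mult by metis

lemma is_section_sum: "(\<And>i. i \<in> S \<Longrightarrow> is_section (f i)) \<Longrightarrow> is_section (\<lambda>x. \<Sum>i\<in>S. f i x)"
  by (induction S rule: infinite_finite_induct) (auto intro: is_section_const is_section_add)

lemma is_section_prod: "(\<And>i. i \<in> S \<Longrightarrow> is_section (f i)) \<Longrightarrow> is_section (\<lambda>x. \<Prod>i\<in>S. f i x)"
  by (induction S rule: infinite_finite_induct) (auto intro: is_section_const is_section_mult)

lemma is_section_power: "is_section f \<Longrightarrow> is_section (\<lambda>x. f x ^ n)"
  by (induction n) (auto intro: is_section_const is_section_mult)

lemma is_section_poly: "is_section f \<Longrightarrow> is_section (\<lambda>x. poly q (f x))"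
  by (induction q) (auto intro: is_section_const is_section_add is_section_mult)

lemma is_section_mpoly:
  assumes "p \<in> mpolys (m + 1)"
  shows "is_section (mpoly_eval p)"
  unfolding mpoly_eval_def mono_eval_def
  by (intro is_section_sum is_section_mult is_section_const is_section_prod is_section_power is_section_coord)
    (use assms in \<open>fastforce simp: mpolys_def\<close>)+

lemma is_section_cong: "(\<And>x. x \<in> V \<Longrightarrow> f x = g x) \<Longrightarrow> is_section f \<longleftrightarrow> is_section g"
  by (simp add: is_section_def)

lemma is_section_regular_map:
  assumes "regular_map (m + 1) V f" "j \<in> {1..m + 1}"
  shows "is_section (\<lambda>x. f x j)"
proof -
  obtain p where "p \<in> mpolys (m + 1)" "\<And>x. x \<in> V \<Longrightarrow> f x j = mpoly_eval p x"
    using assms unfolding regular_map_def by blast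
  then show ?thesis using is_section_mpoly is_section_cong by metis
qed

lemma is_section_comp:
  assumes f: "regular_map (m + 1) V f"
  shows "is_section (\<lambda>x. section_of a (f x))"
  unfolding section_of_def lin_def section_piece_def
  by (intro is_section_sum is_section_mult is_section_prod is_section_power is_section_poly
      is_section_regular_map[OF f]) (use m_ge in \<open>auto simp: I_def\<close>)

definition pullback :: "((nat \<Rightarrow> 'a) \<Rightarrow> nat \<Rightarrow> 'a) \<Rightarrow> 'a laurent \<Rightarrow> 'a laurent"
  where "pullback f a = (SOME b. b \<in> A \<and> (\<forall>x\<in>V. section_of a (f x) = section_of b x))"

lemma
  assumes "regular_map (m + 1) V f"
  shows pullback_in: "pullback f a \<in> A"
    and section_of_pullback: "x \<in> V \<Longrightarrow> section_of (pullback f a) x = section_of a (f x)"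
proof -
  have "\<exists>b. b \<in> A \<and> (\<forall>x\<in>V. section_of a (f x) = section_of b x)"
    using is_section_comp[OF assms, of a] by (auto simp: is_section_def)
  then have "pullback f a \<in> A \<and> (\<forall>x\<in>V. section_of a (f x) = section_of (pullback f a) x)"
    unfolding pullback_def by (rule someI_ex)
  then show "pullback f a \<in> A" "x \<in> V \<Longrightarrow> section_of (pullback f a) x = section_of a (f x)" by auto
qed

text \<open>
  A constant of its own, so that the simplifier does not rewrite the dimension \<open>m + 1\<close> inside it.
\<close>

definition Aut :: "((nat \<Rightarrow> 'a) \<Rightarrow> nat \<Rightarrow> 'a) monoid"
  where "Aut = variety_Aut (m + 1) V"

lemma Aut_iff: "f \<in> carrier Aut \<longleftrightarrow>
    f \<in> Bij V \<and> regular_map (m + 1) V f \<and> regular_map (m + 1) V (inv_into V f)"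
  by (auto simp: Aut_def variety_Aut_def)

lemma
  assumes "f \<in> carrier Aut"
  shows Aut_Bij: "f \<in> Bij V" and Aut_regular: "regular_map (m + 1) V f"
    and Aut_inv_regular: "regular_map (m + 1) V (inv_into V f)"
    and Aut_maps: "x \<in> V \<Longrightarrow> f x \<in> V"
  using assms[unfolded Aut_iff] Bij_imp_funcset[of f V] by auto

lemma coordinate_ring_aut_pullback:
  assumes f: "f \<in> carrier Aut"
  shows "coordinate_ring_aut I k P (pullback f) (pullback (inv_into V f))"
proof -
  have bij: "bij_betw f V V" using Aut_Bij[OF f] by (simp add: Bij_def)
  note reg = Aut_regular[OF f] Aut_inv_regular[OF f]
  have maps: "f x \<in> V" "inv_into V f x \<in> V" if "x \<in> V" for x
    using that Aut_maps[OF f] bij_betw_apply[OF bij_betw_inv_into[OF bij]] by auto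
  have hom: "pullback g (a + b) = pullback g a + pullback g b \<and> pullback g (a * b) = pullback g a * pullback g b"
    if g: "regular_map (m + 1) V g" "\<And>x. x \<in> V \<Longrightarrow> g x \<in> V" and ab: "a \<in> A" "b \<in> A" for g a b
    by (intro conjI section_of_inject pullback_in A_add A_mult g ab)
      (simp_all add: section_of_pullback[OF g(1)] section_of_add section_of_mult pullback_in[OF g(1)] torus_point_in_V g(2) ab)
  have const: "pullback g (single 0 [:c:]) = single 0 [:c:]"
    if g: "regular_map (m + 1) V g" for g c
    by (intro section_of_inject pullback_in g)
      (simp_all add: section_of_pullback[OF g] section_of_const torus_point_in_V)
  show ?thesis
  proof (unfold_locales)
    fix a assume a: "a \<in> A"
    show "pullback f (pullback (inv_into V f) a) = a"
      by (intro section_of_inject pullback_in reg a)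
        (simp add: section_of_pullback[OF reg(1)] section_of_pullback[OF reg(2)] maps torus_point_in_V bij_betw_inv_into_left[OF bij])
    show "pullback (inv_into V f) (pullback f a) = a"
      by (intro section_of_inject pullback_in reg a)
        (simp add: section_of_pullback[OF reg(1)] section_of_pullback[OF reg(2)] maps torus_point_in_V bij_betw_inv_into_right[OF bij])
  qed (use hom const reg maps pullback_in in auto)
qed

theorem Aut_permutes_coordinates:
  assumes f: "f \<in> carrier Aut" and i: "i \<in> I"
  shows "\<exists>l\<in>I. k l = k i \<and> (\<exists>c. c \<noteq> 0 \<and> (\<forall>x\<in>V. f x i = c * x l))"
proof -
  interpret coordinate_ring_aut I k P "pullback f" "pullback (inv_into V f)"
    by (rule coordinate_ring_aut_pullback[OF f])
  obtain l c where l: "l \<in> I" "c \<noteq> 0" "k l = k i" "pullback f (Y i) = single 0 [:c:] * Y l"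
    using phi_permutes_variables[OF i] by blast
  have "f x i = c * x l" if x: "x \<in> V" for x
  proof -
    have "f x i = section_of (pullback f (Y i)) x"
      using x i by (simp add: section_of_pullback[OF Aut_regular[OF f]] section_of_Y)
    then show ?thesis
      using x l(1) by (simp add: l(4) section_of_mult A_Y section_of_const section_of_Y)
  qed
  then show ?thesis using l by blast
qed

end

section \<open>Solvability of the symmetric group of degree four\<close>

lemma (in group) derived_subset:
  assumes "subgroup M G" "\<And>a b. a \<in> L \<Longrightarrow> b \<in> L \<Longrightarrow> a \<otimes> b \<otimes> inv a \<otimes> inv b \<in> M"
  shows "derived G L \<subseteq> M"
  unfolding derived_def by (rule generate_subgroup_incl) (use assms in auto)

text \<open>
  Permutations of \<open>{1..4}\<close> are represented by the lists of their values, so that the derived series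
  \<open>S\<^sub>4 > A\<^sub>4 > V\<^sub>4 > 1\<close> can be verified by evaluating commutators.
\<close>

definition word :: "(nat \<Rightarrow> nat) \<Rightarrow> nat list"
  where "word p = map p [1, 2, 3, 4]"

definition word_apply :: "nat list \<Rightarrow> nat \<Rightarrow> nat"
  where "word_apply l j = (case l of [a, b, c, d] \<Rightarrow>
    if j = 1 then a else if j = 2 then b else if j = 3 then c else d | _ \<Rightarrow> 0)"

definition word_mult :: "nat list \<Rightarrow> nat list \<Rightarrow> nat list"
  where "word_mult l l' = map (word_apply l) l'"

definition word_inv :: "nat list \<Rightarrow> nat list"
  where "word_inv l = (case l of [a, b, c, d] \<Rightarrow>
    map (\<lambda>j. if a = j then 1 else if b = j then 2 else if c = j then 3 else 4) [1, 2, 3, 4] | _ \<Rightarrow> [])"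

definition words_S4 :: "nat list list"
  where "words_S4 = filter distinct (List.n_lists 4 [1, 2, 3, 4])"

definition words_A4 :: "nat list list"
  where "words_A4 = [[1,2,3,4], [1,3,4,2], [1,4,2,3], [2,1,4,3], [2,3,1,4], [2,4,3,1],
    [3,1,2,4], [3,2,4,1], [3,4,1,2], [4,1,3,2], [4,2,1,3], [4,3,2,1]]"

definition words_V4 :: "nat list list"
  where "words_V4 = [[1,2,3,4], [2,1,4,3], [3,4,1,2], [4,3,2,1]]"

definition words_1 :: "nat list list"
  where "words_1 = [[1,2,3,4]]"

definition closed_words :: "nat list list \<Rightarrow> bool"
  where "closed_words L \<longleftrightarrow> [1,2,3,4] \<in> set L \<and> list_all (\<lambda>p. word_inv p \<in> set L) L \<and>
    list_all (\<lambda>p. list_all (\<lambda>q. word_mult p q \<in> set L) L) L"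

definition commutators_in :: "nat list list \<Rightarrow> nat list list \<Rightarrow> bool"
  where "commutators_in L M \<longleftrightarrow> list_all (\<lambda>p. list_all (\<lambda>q.
    word_mult (word_mult p q) (word_mult (word_inv p) (word_inv q)) \<in> set M) L) L"

lemma closed_A4: "closed_words words_A4" by code_simp
lemma closed_V4: "closed_words words_V4" by code_simp
lemma closed_1: "closed_words words_1" by code_simp
lemma commutators_S4: "commutators_in words_S4 words_A4" by code_simp
lemma commutators_A4: "commutators_in words_A4 words_V4" by code_simp
lemma commutators_V4: "commutators_in words_V4 words_1" by code_simp

lemma atLeastAtMost_1_4: "{1..4::nat} = {1, 2, 3, 4}"
  by auto

lemma word_permutes:
  assumes "p permutes {1..4}"
  shows "word p \<in> set words_S4"
proof -
  have "distinct (word p)"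
    using permutes_inj[OF assms] by (simp add: word_def inj_eq)
  moreover have "p i \<in> {1, 2, 3, 4}" if "i \<in> {1, 2, 3, 4}" for i
    using permutes_in_image[OF assms, of i] that unfolding atLeastAtMost_1_4 by blast
  ultimately show ?thesis
    by (auto simp: words_S4_def set_n_lists word_def)
qed

lemma word_comp:
  assumes "q permutes {1..4}"
  shows "word (p \<circ> q) = word_mult (word p) (word q)"
proof -
  have "word_apply (word p) j = p j" if "j \<in> {1, 2, 3, 4}" for j
    using that by (auto simp: word_apply_def word_def)
  moreover have "q i \<in> {1, 2, 3, 4}" if "i \<in> {1, 2, 3, 4}" for i
    using permutes_in_image[OF assms, of i] that unfolding atLeastAtMost_1_4 by blast
  ultimately show ?thesis by (simp add: word_mult_def word_def)
qed

lemma word_inverse: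
  assumes "p permutes {1..4}"
  shows "word (Hilbert_Choice.inv p) = word_inv (word p)"
proof -
  have "Hilbert_Choice.inv p j =
      (if p 1 = j then 1 else if p 2 = j then 2 else if p 3 = j then 3 else 4)"
    if "j \<in> {1, 2, 3, 4}" for j
  proof -
    obtain i where i: "Hilbert_Choice.inv p j = i" by simp
    have "i \<in> {1, 2, 3, 4}"
      using permutes_in_image[OF permutes_inv[OF assms], of j] that
      unfolding atLeastAtMost_1_4 i by blast
    moreover have "p l = j \<longleftrightarrow> l = i" for l
      using permutes_inv_eq[OF assms, of j l] i by auto
    ultimately show ?thesis unfolding i by auto
  qed
  then show ?thesis by (simp add: word_inv_def word_def)
qed

lemma word_eq_id:
  assumes "p permutes {1..4}" "word p = [1,2,3,4]"
  shows "p = id"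
proof
  fix j
  show "p j = id j"
  proof (cases "j \<in> {1..4}")
    case True
    then show ?thesis using assms(2) unfolding word_def atLeastAtMost_1_4 by auto
  qed (simp add: permutes_not_in[OF assms(1)])
qed

definition perms_of_words :: "nat list list \<Rightarrow> (nat \<Rightarrow> nat) set"
  where "perms_of_words L = {p. p permutes {1..4} \<and> word p \<in> set L}"

interpretation S4: group "sym_group 4" by (rule sym_group_is_group)

lemma sym_group_4_mult: "p \<otimes>\<^bsub>sym_group 4\<^esub> q = p \<circ> q" by (simp add: sym_group_mult)

lemma sym_group_4_inv: "p permutes {1..4} \<Longrightarrow> inv\<^bsub>sym_group 4\<^esub> p = Hilbert_Choice.inv p"
  by (simp add: sym_group_carrier)

lemma subgroup_perms_of_words:
  assumes "closed_words L"
  shows "subgroup (perms_of_words L) (sym_group 4)"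
proof (rule S4.subgroupI)
  show "perms_of_words L \<subseteq> carrier (sym_group 4)"
    by (auto simp: perms_of_words_def sym_group_carrier)
  have "id \<in> perms_of_words L"
    using assms by (auto simp: perms_of_words_def closed_words_def permutes_id word_def)
  then show "perms_of_words L \<noteq> {}" by blast
next
  fix p assume "p \<in> perms_of_words L"
  then show "inv\<^bsub>sym_group 4\<^esub> p \<in> perms_of_words L"
    using assms by (auto simp: perms_of_words_def closed_words_def list_all_iff sym_group_4_inv
        word_inverse permutes_inv)
next
  fix p q assume "p \<in> perms_of_words L" "q \<in> perms_of_words L"
  then show "p \<otimes>\<^bsub>sym_group 4\<^esub> q \<in> perms_of_words L"
    using assms by (auto simp: perms_of_words_def closed_words_def list_all_iff sym_group_4_mult
        word_comp permutes_compose)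
qed

lemma derived_perms_of_words:
  assumes "closed_words M" "commutators_in L M"
  shows "derived (sym_group 4) (perms_of_words L) \<subseteq> perms_of_words M"
proof (rule S4.derived_subset[OF subgroup_perms_of_words[OF assms(1)]])
  fix p q assume "p \<in> perms_of_words L" "q \<in> perms_of_words L"
  then have pq: "p permutes {1..4}" "q permutes {1..4}" "word p \<in> set L" "word q \<in> set L"
    by (auto simp: perms_of_words_def)
  have "p \<otimes>\<^bsub>sym_group 4\<^esub> q \<otimes>\<^bsub>sym_group 4\<^esub> inv\<^bsub>sym_group 4\<^esub> p \<otimes>\<^bsub>sym_group 4\<^esub> inv\<^bsub>sym_group 4\<^esub> q =
      (p \<circ> q) \<circ> (Hilbert_Choice.inv p \<circ> Hilbert_Choice.inv q)"
    using pq by (simp add: sym_group_4_mult sym_group_4_inv o_assoc)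
  moreover have "word ((p \<circ> q) \<circ> (Hilbert_Choice.inv p \<circ> Hilbert_Choice.inv q)) \<in> set M"
    using pq assms(2)
    by (simp add: word_comp word_inverse permutes_compose permutes_inv commutators_in_def list_all_iff)
  ultimately show "p \<otimes>\<^bsub>sym_group 4\<^esub> q \<otimes>\<^bsub>sym_group 4\<^esub> inv\<^bsub>sym_group 4\<^esub> p \<otimes>\<^bsub>sym_group 4\<^esub> inv\<^bsub>sym_group 4\<^esub> q \<in> perms_of_words M"
    using pq by (auto simp: perms_of_words_def intro!: permutes_compose permutes_inv)
qed

lemma derived_series_sym_group_4:
  "(derived (sym_group 4) ^^ 3) (carrier (sym_group 4)) \<subseteq> {id}"
proof -
  let ?D = "derived (sym_group 4)"
  have 0: "carrier (sym_group 4) \<subseteq> perms_of_words words_S4"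
    by (auto simp: perms_of_words_def sym_group_carrier word_permutes)
  have 1: "?D (carrier (sym_group 4)) \<subseteq> perms_of_words words_A4"
    using S4.mono_derived[OF 0] derived_perms_of_words[OF closed_A4 commutators_S4] by blast
  have 2: "?D (?D (carrier (sym_group 4))) \<subseteq> perms_of_words words_V4"
    using S4.mono_derived[OF 1] derived_perms_of_words[OF closed_V4 commutators_A4] by blast
  have "?D (?D (?D (carrier (sym_group 4)))) \<subseteq> perms_of_words words_1"
    using S4.mono_derived[OF 2] derived_perms_of_words[OF closed_1 commutators_V4] by blast
  also have "\<dots> \<subseteq> {id}" using word_eq_id by (auto simp: perms_of_words_def words_1_def)
  finally show ?thesis by (simp add: numeral_3_eq_3)
qed

text \<open>
  A group that acts on at most four points maps to \<open>S\<^sub>4\<close>, where the third derived subgroup is trivial.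
\<close>

lemma (in group) derived_series_small_permutations:
  fixes \<rho> :: "'a \<Rightarrow> 'p \<Rightarrow> 'p"
  assumes T: "finite T" "card T \<le> 4"
    and perm: "\<And>f. f \<in> carrier G \<Longrightarrow> \<rho> f permutes T"
    and comp: "\<And>f g. f \<in> carrier G \<Longrightarrow> g \<in> carrier G \<Longrightarrow> \<rho> (f \<otimes> g) = \<rho> f \<circ> \<rho> g"
    and f: "f \<in> (derived G ^^ 3) (carrier G)"
  shows "\<rho> f = id"
proof -
  obtain j where j: "bij_betw j T {1..card T}"
    using finite_same_card_bij[of T "{1..card T}"] T(1) by auto
  define h where "h f = map_permutation T j (\<rho> f)" for f
  have perm_h: "h f permutes {1..4}" if "f \<in> carrier G" for f
    using permutes_subset[OF map_permutation_permutes[OF j perm[OF that]], of "{1..4}"] T(2)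
    by (simp add: h_def)
  have "group_hom G (sym_group 4) h"
    unfolding group_hom_def group_hom_axioms_def
  proof (intro conjI homI is_group sym_group_is_group)
    fix f g assume fg: "f \<in> carrier G" "g \<in> carrier G"
    show "h f \<in> carrier (sym_group 4)" using perm_h[OF fg(1)] by (simp add: sym_group_carrier)
    show "h (f \<otimes> g) = h f \<otimes>\<^bsub>sym_group 4\<^esub> h g"
      using map_permutation_compose'[OF _ perm[OF fg(2)], of j "\<rho> f"] j fg
      by (simp add: h_def comp sym_group_mult bij_betw_def)
  qed
  then interpret h: group_hom G "sym_group 4" h .
  have "h ` (derived G ^^ 3) (carrier G) = (derived (sym_group 4) ^^ 3) (h ` carrier G)"
    by (rule h.exp_of_derived_img[symmetric]) simp
  also have "\<dots> \<subseteq> (derived (sym_group 4) ^^ 3) (carrier (sym_group 4))"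
    by (rule S4.mono_exp_of_derived) auto
  finally have "h f = id" using derived_series_sym_group_4 f by blast
  have "f \<in> carrier G" using f exp_of_derived_in_carrier[of "carrier G" 3] by blast
  then have rho: "\<rho> f permutes T" by (rule perm)
  show ?thesis
  proof
    fix x
    show "\<rho> f x = id x"
    proof (cases "x \<in> T")
      case True
      then have "j (\<rho> f x) = j x"
        using map_permutation_apply[of j T x "\<rho> f"] j \<open>h f = id\<close> by (simp add: h_def bij_betw_def)
      then show ?thesis
        using True j permutes_in_image[OF rho, of x] by (auto simp: bij_betw_def inj_on_def)
    qed (use rho in \<open>simp add: permutes_not_in\<close>)
  qed
qed

section \<open>The automorphism group\<close>

context hypersurface_variety
begin

lemma group_Aut: "group Aut"
  unfolding Aut_def by (rule group_variety_Aut)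

interpretation Aut: group Aut by (rule group_Aut)

lemma Aut_mult: "f \<in> carrier Aut \<Longrightarrow> g \<in> carrier Aut \<Longrightarrow> x \<in> V \<Longrightarrow> (f \<otimes>\<^bsub>Aut\<^esub> g) x = f (g x)"
  using Aut_Bij[of f] Aut_Bij[of g] by (simp add: Aut_def variety_Aut_def BijGroup_def compose_def)

lemma Aut_one: "x \<in> V \<Longrightarrow> \<one>\<^bsub>Aut\<^esub> x = x"
  by (simp add: Aut_def variety_Aut_def BijGroup_def)

lemma Aut_eqI:
  assumes "f \<in> carrier Aut" "g \<in> carrier Aut" "\<And>x. x \<in> V \<Longrightarrow> f x = g x"
  shows "f = g"
  using Aut_Bij[OF assms(1)] Aut_Bij[OF assms(2)] assms(3)
  by (auto simp: Bij_def intro: extensionalityI)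

lemma Aut_inv:
  assumes "f \<in> carrier Aut" "x \<in> V"
  shows "f ((inv\<^bsub>Aut\<^esub> f) x) = x" "(inv\<^bsub>Aut\<^esub> f) (f x) = x"
  using Aut_mult[OF assms(1) Aut.inv_closed[OF assms(1)] assms(2)]
    Aut_mult[OF Aut.inv_closed[OF assms(1)] assms(1) assms(2)] Aut_one[OF assms(2)] assms
  by simp_all

text \<open>
  The value of a commutator at the points \<open>g (f x)\<close>, which are all points, is expressed without inverses.
\<close>

lemma Aut_commutator:
  assumes "f \<in> carrier Aut" "g \<in> carrier Aut"
  obtains w where "w = f \<otimes>\<^bsub>Aut\<^esub> g \<otimes>\<^bsub>Aut\<^esub> inv\<^bsub>Aut\<^esub> f \<otimes>\<^bsub>Aut\<^esub> inv\<^bsub>Aut\<^esub> g" "w \<in> carrier Aut"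
    "\<And>x. x \<in> V \<Longrightarrow> w (g (f x)) = f (g x)"
proof
  show "f \<otimes>\<^bsub>Aut\<^esub> g \<otimes>\<^bsub>Aut\<^esub> inv\<^bsub>Aut\<^esub> f \<otimes>\<^bsub>Aut\<^esub> inv\<^bsub>Aut\<^esub> g \<in> carrier Aut" using assms by simp
  fix x assume "x \<in> V"
  then show "(f \<otimes>\<^bsub>Aut\<^esub> g \<otimes>\<^bsub>Aut\<^esub> inv\<^bsub>Aut\<^esub> f \<otimes>\<^bsub>Aut\<^esub> inv\<^bsub>Aut\<^esub> g) (g (f x)) = f (g x)"
    using assms by (simp add: Aut_mult Aut_maps Aut_inv)
qed simp

text \<open>
  The pullback of the coordinate \<open>i\<close> along \<open>f\<close> is a multiple of the coordinate \<open>l\<close>.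
\<close>

definition moves :: "((nat \<Rightarrow> 'a) \<Rightarrow> nat \<Rightarrow> 'a) \<Rightarrow> nat \<Rightarrow> nat \<Rightarrow> bool"
  where "moves f i l \<longleftrightarrow> l \<in> I \<and> (\<exists>c. c \<noteq> 0 \<and> (\<forall>x\<in>V. f x i = c * x l))"

lemma moves_unique:
  assumes "moves f i l" "moves f i l'"
  shows "l = l'"
proof (rule ccontr)
  assume ne: "l \<noteq> l'"
  obtain c where c: "l \<in> I" "c \<noteq> 0" "\<And>x. x \<in> V \<Longrightarrow> f x i = c * x l"
    using assms(1) by (auto simp: moves_def)
  obtain c' where c': "l' \<in> I" "\<And>x. x \<in> V \<Longrightarrow> f x i = c' * x l'"
    using assms(2) by (auto simp: moves_def)
  let ?y = "\<lambda>j. if j = l then 2 else 1"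
  have "torus_point (\<lambda>j. 1) 0 \<in> V" "torus_point ?y 0 \<in> V"
    by (auto intro!: torus_point_in_V simp: in_torus_def)
  then have "c * torus_point (\<lambda>j. 1) 0 l = c' * torus_point (\<lambda>j. 1) 0 l'"
    "c * torus_point ?y 0 l = c' * torus_point ?y 0 l'"
    using c(3) c'(2) by metis+
  then have "c = c'" "c * 2 = c'" using ne c(1) c'(1) by simp_all
  then show False using c(2) by simp
qed

lemma moves_mult:
  assumes "f \<in> carrier Aut" "g \<in> carrier Aut" "moves f i l" "moves g l r"
  shows "moves (f \<otimes>\<^bsub>Aut\<^esub> g) i r"
proof -
  obtain c c' where c: "r \<in> I" "c \<noteq> 0" "c' \<noteq> 0" "\<And>x. x \<in> V \<Longrightarrow> f x i = c * x l" "\<And>x. x \<in> V \<Longrightarrow> g x l = c' * x r"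
    using assms by (auto simp: moves_def)
  have "(f \<otimes>\<^bsub>Aut\<^esub> g) x i = (c * c') * x r" if "x \<in> V" for x
    using that assms(1,2) c(4,5) by (simp add: Aut_mult Aut_maps)
  then show ?thesis using c(1-3) unfolding moves_def by (metis mult_eq_0_iff)
qed

lemma moves_one: "i \<in> I \<Longrightarrow> moves \<one>\<^bsub>Aut\<^esub> i i"
  unfolding moves_def by (auto simp: Aut_one intro!: exI[of _ 1])

text \<open>
  Pullback reverses the order of composition, so \<open>\<tau>\<close> is an antihomomorphism; composing it with the inverse
  gives an action.
\<close>

definition \<tau> :: "((nat \<Rightarrow> 'a) \<Rightarrow> nat \<Rightarrow> 'a) \<Rightarrow> nat \<Rightarrow> nat"
  where "\<tau> f i = (THE l. moves f i l)"

lemma moves_tau: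
  assumes "f \<in> carrier Aut" "i \<in> I"
  shows "moves f i (\<tau> f i)" "\<tau> f i \<in> I" "k (\<tau> f i) = k i"
proof -
  obtain l where l: "moves f i l" "k l = k i" "l \<in> I"
    using Aut_permutes_coordinates[OF assms] by (auto simp: moves_def)
  have "\<tau> f i = l" unfolding \<tau>_def using l(1) moves_unique by blast
  then show "moves f i (\<tau> f i)" "\<tau> f i \<in> I" "k (\<tau> f i) = k i" using l by auto
qed

lemma tau_eqI: "moves f i l \<Longrightarrow> \<tau> f i = l"
  unfolding \<tau>_def using moves_unique by blast

lemma tau_mult:
  assumes "f \<in> carrier Aut" "g \<in> carrier Aut" "i \<in> I"
  shows "\<tau> (f \<otimes>\<^bsub>Aut\<^esub> g) i = \<tau> g (\<tau> f i)"
  by (rule tau_eqI, rule moves_mult[OF assms(1,2) moves_tau(1)[OF assms(1,3)]])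
    (intro moves_tau assms)

lemma tau_inv:
  assumes "f \<in> carrier Aut" "i \<in> I"
  shows "\<tau> f (\<tau> (inv\<^bsub>Aut\<^esub> f) i) = i" "\<tau> (inv\<^bsub>Aut\<^esub> f) (\<tau> f i) = i"
proof -
  have "\<tau> \<one>\<^bsub>Aut\<^esub> i = i" using moves_one[OF assms(2)] by (rule tau_eqI)
  then show "\<tau> f (\<tau> (inv\<^bsub>Aut\<^esub> f) i) = i" "\<tau> (inv\<^bsub>Aut\<^esub> f) (\<tau> f i) = i"
    using tau_mult[of "inv\<^bsub>Aut\<^esub> f" f i] tau_mult[of f "inv\<^bsub>Aut\<^esub> f" i] assms by simp_all
qed

lemma third_derived_moves_trivially:
  assumes classes: "\<And>c. card {i \<in> I. k i = c} \<le> 4"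
    and f: "f \<in> (derived Aut ^^ 3) (carrier Aut)" and i: "i \<in> I"
  shows "moves f i i"
proof -
  define T where "T = {j \<in> I. k j = k i}"
  define \<rho> where "\<rho> g j = (if j \<in> T then \<tau> (inv\<^bsub>Aut\<^esub> g) j else j)" for g j
  have fin: "finite T" using finite_I by (simp add: T_def)
  have stays: "\<tau> g j \<in> T" if "g \<in> carrier Aut" "j \<in> T" for g j
    using moves_tau[OF that(1), of j] that(2) by (simp add: T_def)
  have "\<rho> f = id"
  proof (rule Aut.derived_series_small_permutations[where \<rho> = \<rho> and T = T])
    show "finite T" by (rule fin)
    show "f \<in> (derived Aut ^^ 3) (carrier Aut)" by (rule f)
    show "card T \<le> 4" unfolding T_def by (rule classes)
  next
    fix g assume g: "g \<in> carrier Aut"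
    show "\<rho> g permutes T"
    proof (rule bij_imp_permutes)
      show "bij_betw (\<rho> g) T T"
        by (rule bij_betwI[where g = "\<tau> g"])
          (use g stays tau_inv in \<open>auto simp: \<rho>_def T_def\<close>)
    qed (simp add: \<rho>_def)
  next
    fix g h assume g: "g \<in> carrier Aut" and h: "h \<in> carrier Aut"
    show "\<rho> (g \<otimes>\<^bsub>Aut\<^esub> h) = \<rho> g \<circ> \<rho> h"
    proof
      fix j
      show "\<rho> (g \<otimes>\<^bsub>Aut\<^esub> h) j = (\<rho> g \<circ> \<rho> h) j"
      proof (cases "j \<in> T")
        case True
        then have "j \<in> I" by (simp add: T_def)
        then show ?thesis
          using g h True stays[of "inv\<^bsub>Aut\<^esub> h" j]
          by (simp add: \<rho>_def Aut.inv_mult_group tau_mult)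
      qed (simp add: \<rho>_def)
    qed
  qed
  then have "\<rho> f i = i" by simp
  then have "\<tau> (inv\<^bsub>Aut\<^esub> f) i = i" using i by (simp add: \<rho>_def T_def)
  moreover have "f \<in> carrier Aut"
    using f Aut.exp_of_derived_in_carrier[of "carrier Aut" 3] by blast
  ultimately show ?thesis using tau_inv(1)[of f i] moves_tau(1)[of f i] i by simp
qed

definition fixes_y :: "((nat \<Rightarrow> 'a) \<Rightarrow> nat \<Rightarrow> 'a) set"
  where "fixes_y = {f \<in> carrier Aut. \<forall>x\<in>V. \<forall>i\<in>I. f x i = x i}"

lemma subgroup_fixes_y: "subgroup fixes_y Aut"
proof (rule Aut.subgroupI)
  have "\<one>\<^bsub>Aut\<^esub> \<in> fixes_y" by (auto simp: fixes_y_def Aut_one)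
  then show "fixes_y \<noteq> {}" by blast
next
  fix f assume "f \<in> fixes_y"
  then have f: "f \<in> carrier Aut" "\<And>x i. x \<in> V \<Longrightarrow> i \<in> I \<Longrightarrow> f x i = x i" by (auto simp: fixes_y_def)
  have "(inv\<^bsub>Aut\<^esub> f) x i = x i" if "x \<in> V" "i \<in> I" for x i
    using f(2)[OF Aut_maps[OF Aut.inv_closed[OF f(1)] that(1)] that(2)] Aut_inv(1)[OF f(1) that(1)] by simp
  then show "inv\<^bsub>Aut\<^esub> f \<in> fixes_y" using f(1) by (simp add: fixes_y_def)
qed (auto simp: fixes_y_def Aut_mult Aut_maps)

text \<open>
  Scalings of a coordinate commute.
\<close>

lemma commutator_fixes_y:
  assumes f: "f \<in> carrier Aut" "\<And>i. i \<in> I \<Longrightarrow> moves f i i"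
    and g: "g \<in> carrier Aut" "\<And>i. i \<in> I \<Longrightarrow> moves g i i"
  shows "f \<otimes>\<^bsub>Aut\<^esub> g \<otimes>\<^bsub>Aut\<^esub> inv\<^bsub>Aut\<^esub> f \<otimes>\<^bsub>Aut\<^esub> inv\<^bsub>Aut\<^esub> g \<in> fixes_y"
proof -
  obtain w where w: "w = f \<otimes>\<^bsub>Aut\<^esub> g \<otimes>\<^bsub>Aut\<^esub> inv\<^bsub>Aut\<^esub> f \<otimes>\<^bsub>Aut\<^esub> inv\<^bsub>Aut\<^esub> g" "w \<in> carrier Aut"
    "\<And>x. x \<in> V \<Longrightarrow> w (g (f x)) = f (g x)"
    using Aut_commutator[OF f(1) g(1)] by blast
  have "w u i = u i" if u: "u \<in> V" and i: "i \<in> I" for u i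
  proof -
    define x where "x = (inv\<^bsub>Aut\<^esub> f) ((inv\<^bsub>Aut\<^esub> g) u)"
    have x: "x \<in> V" "g (f x) = u"
      using u f(1) g(1) by (simp_all add: x_def Aut_maps Aut_inv)
    obtain c c' where "\<And>x. x \<in> V \<Longrightarrow> f x i = c * x i" "\<And>x. x \<in> V \<Longrightarrow> g x i = c' * x i"
      using f(2)[OF i] g(2)[OF i] by (auto simp: moves_def)
    then have "f (g x) i = g (f x) i"
      using x(1) f(1) g(1) by (simp add: Aut_maps)
    then show ?thesis using w(3)[OF x(1)] x(2) by simp
  qed
  then show ?thesis using w(1,2) by (simp add: fixes_y_def)
qed

lemma fixes_y_torus_point:
  assumes "f \<in> fixes_y" "in_torus y"
  shows "f (torus_point y t) = torus_point y (f (torus_point y t) (m + 1))"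
  using assms by (intro eq_torus_point) (auto simp: fixes_y_def Aut_maps torus_point_in_V)

text \<open>
  On the line over \<open>y\<close> both \<open>f\<close> and its inverse act on \<open>z\<close> by polynomials. These are inverse to each other under
  composition, and degrees multiply, so both have degree one.
\<close>

lemma fixes_y_affine:
  assumes f: "f \<in> fixes_y" and y: "in_torus y"
  obtains \<alpha> \<beta> where "\<alpha> \<noteq> 0" "\<And>t. f (torus_point y t) = torus_point y (\<alpha> * t + \<beta>)"
proof -
  have poly: "\<exists>q. \<forall>t. g (torus_point y t) = torus_point y (poly q t)" if g: "g \<in> fixes_y" for g
  proof -
    have "is_section (\<lambda>x. g x (m + 1))"
      using g by (intro is_section_regular_map Aut_regular) (auto simp: fixes_y_def)
    then obtain a where a: "a \<in> A" "\<And>x. x \<in> V \<Longrightarrow> g x (m + 1) = section_of a x"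
      by (auto simp: is_section_def)
    define q where "q = (\<Sum>e\<in>keys a. smult (\<Prod>i\<in>I. y i powi lookup e i) (lookup a e))"
    have "g (torus_point y t) (m + 1) = poly q t" for t
      unfolding a(2)[OF torus_point_in_V[OF y]] section_of_torus_point[OF a(1) y]
      by (simp add: q_def poly_sum ac_simps)
    then show ?thesis using fixes_y_torus_point[OF g y] by metis
  qed
  obtain q where q: "\<And>t. f (torus_point y t) = torus_point y (poly q t)" using poly[OF f] by blast
  have f': "inv\<^bsub>Aut\<^esub> f \<in> fixes_y" using subgroup.m_inv_closed[OF subgroup_fixes_y f] .
  obtain q' where q': "\<And>t. (inv\<^bsub>Aut\<^esub> f) (torus_point y t) = torus_point y (poly q' t)" using poly[OF f'] by blast
  have fA: "f \<in> carrier Aut" using f by (simp add: fixes_y_def)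
  have "poly (pcompose q' q) t = poly [:0, 1:] t" for t
  proof -
    have "torus_point y (poly q' (poly q t)) = torus_point y t"
      using Aut_inv(2)[OF fA torus_point_in_V[OF y], of t] by (simp add: q q')
    then have "torus_point y (poly q' (poly q t)) (Suc m) = torus_point y t (Suc m)" by simp
    then show ?thesis by (simp add: poly_pcompose)
  qed
  then have "pcompose q' q = [:0, 1:]" by (metis poly_eq_poly_eq_iff ext)
  then have "degree q' * degree q = degree [:0, 1 :: 'a:]" by (metis degree_pcompose)
  then have "degree q = 1" by simp
  then obtain \<beta> \<alpha> where "q = [:\<beta>, \<alpha>:]" "\<alpha> \<noteq> 0" by (rule degree1_coeffs)
  then show ?thesis using that[of \<alpha> \<beta>] q by (simp add: ac_simps)
qed

definition translates_z :: "((nat \<Rightarrow> 'a) \<Rightarrow> nat \<Rightarrow> 'a) set"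
  where "translates_z = {f \<in> carrier Aut. \<forall>y. in_torus y \<longrightarrow>
    (\<exists>\<beta>. \<forall>t. f (torus_point y t) = torus_point y (t + \<beta>))}"

lemma torus_point_inject: "torus_point y s = torus_point y t \<Longrightarrow> s = t"
  by (metis torus_point_simps(2))

lemma subgroup_translates_z: "subgroup translates_z Aut"
proof (rule Aut.subgroupI)
  have "\<one>\<^bsub>Aut\<^esub> \<in> translates_z"
    by (auto simp: translates_z_def Aut_one torus_point_in_V intro!: exI[of _ 0])
  then show "translates_z \<noteq> {}" by blast
next
  fix f assume f: "f \<in> translates_z"
  then have fA: "f \<in> carrier Aut" by (simp add: translates_z_def)
  have "\<exists>\<beta>. \<forall>t. (inv\<^bsub>Aut\<^esub> f) (torus_point y t) = torus_point y (t + \<beta>)" if y: "in_torus y" for y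
  proof -
    obtain \<beta> where \<beta>: "\<And>t. f (torus_point y t) = torus_point y (t + \<beta>)"
      using f y by (auto simp: translates_z_def)
    have "(inv\<^bsub>Aut\<^esub> f) (torus_point y t) = torus_point y (t + - \<beta>)" for t
      using Aut_inv(2)[OF fA torus_point_in_V[OF y], of "t + - \<beta>"] by (simp add: \<beta>)
    then show ?thesis by blast
  qed
  then show "inv\<^bsub>Aut\<^esub> f \<in> translates_z" using fA by (simp add: translates_z_def)
next
  fix f g assume f: "f \<in> translates_z" and g: "g \<in> translates_z"
  then have A: "f \<in> carrier Aut" "g \<in> carrier Aut" by (simp_all add: translates_z_def)
  have "\<exists>\<beta>. \<forall>t. (f \<otimes>\<^bsub>Aut\<^esub> g) (torus_point y t) = torus_point y (t + \<beta>)" if y: "in_torus y" for y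
  proof -
    obtain \<beta> where "\<And>t. f (torus_point y t) = torus_point y (t + \<beta>)"
      using f y by (auto simp: translates_z_def)
    moreover obtain \<gamma> where "\<And>t. g (torus_point y t) = torus_point y (t + \<gamma>)"
      using g y by (auto simp: translates_z_def)
    ultimately have "(f \<otimes>\<^bsub>Aut\<^esub> g) (torus_point y t) = torus_point y (t + (\<gamma> + \<beta>))" for t
      using A y by (simp add: Aut_mult torus_point_in_V ac_simps)
    then show ?thesis by blast
  qed
  then show "f \<otimes>\<^bsub>Aut\<^esub> g \<in> translates_z" using A by (simp add: translates_z_def)
qed (auto simp: translates_z_def)

text \<open>
  The linear coefficients of affine maps of the line multiply under composition, so that of a commutator is \<open>1\<close>.
\<close>

lemma commutator_translates_z:
  assumes f: "f \<in> fixes_y" and g: "g \<in> fixes_y"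
  shows "f \<otimes>\<^bsub>Aut\<^esub> g \<otimes>\<^bsub>Aut\<^esub> inv\<^bsub>Aut\<^esub> f \<otimes>\<^bsub>Aut\<^esub> inv\<^bsub>Aut\<^esub> g \<in> translates_z"
proof -
  have A: "f \<in> carrier Aut" "g \<in> carrier Aut" using f g by (simp_all add: fixes_y_def)
  obtain w where w: "w = f \<otimes>\<^bsub>Aut\<^esub> g \<otimes>\<^bsub>Aut\<^esub> inv\<^bsub>Aut\<^esub> f \<otimes>\<^bsub>Aut\<^esub> inv\<^bsub>Aut\<^esub> g" "w \<in> carrier Aut"
    "\<And>x. x \<in> V \<Longrightarrow> w (g (f x)) = f (g x)"
    using Aut_commutator[OF A] by blast
  have w_fixes: "w \<in> fixes_y"
    unfolding w(1) using f g subgroup_fixes_y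
    by (intro subgroup.m_closed[OF subgroup_fixes_y] subgroup.m_inv_closed[OF subgroup_fixes_y])
  have "\<exists>\<beta>. \<forall>t. w (torus_point y t) = torus_point y (t + \<beta>)" if y: "in_torus y" for y
  proof -
    obtain a b where ab: "a \<noteq> 0" "\<And>t. f (torus_point y t) = torus_point y (a * t + b)" using fixes_y_affine[OF f y] by blast
    obtain a' b' where ab': "a' \<noteq> 0" "\<And>t. g (torus_point y t) = torus_point y (a' * t + b')" using fixes_y_affine[OF g y] by blast
    obtain c d where cd: "c \<noteq> 0" "\<And>t. w (torus_point y t) = torus_point y (c * t + d)" using fixes_y_affine[OF w_fixes y] by blast
    have eq: "c * (a' * (a * t + b) + b') + d = a * (a' * t + b') + b" for t
      using w(3)[OF torus_point_in_V[OF y], of t] by (auto simp: ab ab' cd dest: torus_point_inject)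
    have "c * (a' * a) = (c * (a' * (a * 1 + b) + b') + d) - (c * (a' * (a * 0 + b) + b') + d)"
      by (simp add: algebra_simps)
    also have "\<dots> = 1 * (a' * a)" unfolding eq by (simp add: algebra_simps)
    finally have "c = 1" using ab(1) ab'(1) by (simp only: mult_right_cancel mult_eq_0_iff simp_thms)
    then show ?thesis using cd(2) by auto
  qed
  then show ?thesis using w(1,2) by (simp add: translates_z_def)
qed

lemma Aut_eq_one_if_trivial_on_torus:
  assumes f: "f \<in> carrier Aut" and triv: "\<And>y t. in_torus y \<Longrightarrow> f (torus_point y t) = torus_point y t"
  shows "f = \<one>\<^bsub>Aut\<^esub>"
proof (rule Aut_eqI[OF f Aut.one_closed])
  fix x assume x: "x \<in> V"
  have "f x j = x j" for j
  proof (cases "j \<in> {1..m + 1}")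
    case True
    obtain a where a: "a \<in> A" "\<And>x. x \<in> V \<Longrightarrow> f x j = section_of a x"
      using is_section_regular_map[OF Aut_regular[OF f] True] by (auto simp: is_section_def)
    obtain b where b: "b \<in> A" "\<And>x. x \<in> V \<Longrightarrow> x j = section_of b x"
      using is_section_coord[OF True] by (auto simp: is_section_def)
    have "a = b"
      using a(2) b(2) triv torus_point_in_V by (intro section_of_inject a(1) b(1)) metis
    then show ?thesis using a(2) b(2) x by metis
  next
    case False
    then show ?thesis
      using x Aut_maps[OF f x] unfolding V_iff affine_space_def by (metis PiE_arb)
  qed
  then show "f x = \<one>\<^bsub>Aut\<^esub> x" using x by (auto simp: Aut_one)
qed

lemma commutator_translations:
  assumes f: "f \<in> translates_z" and g: "g \<in> translates_z"
  shows "f \<otimes>\<^bsub>Aut\<^esub> g \<otimes>\<^bsub>Aut\<^esub> inv\<^bsub>Aut\<^esub> f \<otimes>\<^bsub>Aut\<^esub> inv\<^bsub>Aut\<^esub> g = \<one>\<^bsub>Aut\<^esub>"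
proof -
  have A: "f \<in> carrier Aut" "g \<in> carrier Aut" using f g by (simp_all add: translates_z_def)
  obtain w where w: "w = f \<otimes>\<^bsub>Aut\<^esub> g \<otimes>\<^bsub>Aut\<^esub> inv\<^bsub>Aut\<^esub> f \<otimes>\<^bsub>Aut\<^esub> inv\<^bsub>Aut\<^esub> g" "w \<in> carrier Aut"
    "\<And>x. x \<in> V \<Longrightarrow> w (g (f x)) = f (g x)"
    using Aut_commutator[OF A] by blast
  have "w (torus_point y t) = torus_point y t" if y: "in_torus y" for y t
  proof -
    obtain b where "\<And>t. f (torus_point y t) = torus_point y (t + b)"
      using f y by (auto simp: translates_z_def)
    moreover obtain b' where "\<And>t. g (torus_point y t) = torus_point y (t + b')"
      using g y by (auto simp: translates_z_def)
    ultimately show ?thesis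
      using w(3)[OF torus_point_in_V[OF y], of "t - b - b'"] by (simp add: algebra_simps)
  qed
  then show ?thesis using Aut_eq_one_if_trivial_on_torus[OF w(2)] w(1) by simp
qed

theorem solvable_if_small_classes:
  assumes "\<And>c. card {i \<in> I. k i = c} \<le> 4"
  shows "solvable Aut"
proof -
  let ?D = "derived Aut" and ?K = "(derived Aut ^^ 3) (carrier Aut)"
  have "?D ?K \<subseteq> fixes_y"
    using third_derived_moves_trivially[OF assms] Aut.exp_of_derived_in_carrier[of "carrier Aut" 3]
    by (intro Aut.derived_subset subgroup_fixes_y commutator_fixes_y) auto
  then have "?D (?D ?K) \<subseteq> ?D fixes_y" by (rule Aut.mono_derived)
  also have "\<dots> \<subseteq> translates_z"
    by (intro Aut.derived_subset subgroup_translates_z commutator_translates_z)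
  finally have "?D (?D (?D ?K)) \<subseteq> ?D translates_z" by (rule Aut.mono_derived)
  also have "\<dots> \<subseteq> {\<one>\<^bsub>Aut\<^esub>}"
    by (intro Aut.derived_subset Aut.triv_subgroup) (simp add: commutator_translations)
  finally have "(?D ^^ 6) (carrier Aut) \<subseteq> {\<one>\<^bsub>Aut\<^esub>}"
    by (simp add: numeral_eq_Suc)
  moreover have "\<one>\<^bsub>Aut\<^esub> \<in> (?D ^^ 6) (carrier Aut)"
    by (rule subgroup.one_closed[OF Aut.exp_of_derived_is_subgroup[OF Aut.subgroup_self]])
  ultimately show ?thesis
    unfolding Aut.solvable_iff_trivial_derived_seq by blast
qed

text \<open>
  Precomposition with the inverse permutation makes this a homomorphism.
\<close>

definition permute_coords :: "(nat \<Rightarrow> nat) \<Rightarrow> (nat \<Rightarrow> 'a) \<Rightarrow> nat \<Rightarrow> 'a"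
  where "permute_coords p = (\<lambda>x\<in>V. x \<circ> Hilbert_Choice.inv p)"

lemma permute_coords_in_V:
  assumes p: "p permutes I" "\<And>i. i \<in> I \<Longrightarrow> k (p i) = k i" and x: "x \<in> V"
  shows "x \<circ> p \<in> V"
proof -
  have out': "p j = j" if "j \<notin> {1..m + 1}" for j
    using that by (auto intro!: permutes_not_in[OF p(1)] simp: I_def)
  have out: "p 1 = 1" "p (m + 1) = m + 1"
    by (auto intro!: permutes_not_in[OF p(1)] simp: I_def)
  have "(\<Prod>i\<in>I. x (p i) ^ k i) = (\<Prod>i\<in>I. x (p i) ^ k (p i))" using p(2) by simp
  also have "\<dots> = (\<Prod>i\<in>I. x i ^ k i)" using prod.permute[OF p(1), of "\<lambda>i. x i ^ k i"] by (simp add: o_def)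
  finally show ?thesis
    using x out out' by (auto simp: V_iff affine_space_def PiE_def extensional_def)
qed

lemma permute_coords_Aut:
  assumes p: "p permutes I" "\<And>i. i \<in> I \<Longrightarrow> k (p i) = k i"
  shows "permute_coords p \<in> carrier Aut"
proof -
  let ?q = "Hilbert_Choice.inv p"
  have q: "?q permutes I" using p(1) by (rule permutes_inv)
  have kq: "k (?q i) = k i" if "i \<in> I" for i
    using p(2)[of "?q i"] permutes_in_image[OF q, of i] that permutes_inverses(1)[OF p(1), of i] by simp
  have inV: "x \<circ> ?q \<in> V" "x \<circ> p \<in> V" if "x \<in> V" for x
    using permute_coords_in_V[OF q kq that] permute_coords_in_V[OF p that] by auto
  have cancel: "x \<circ> ?q \<circ> p = x" "x \<circ> p \<circ> ?q = x" for x :: "nat \<Rightarrow> 'a"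
    by (simp_all add: fun_eq_iff permutes_inverses[OF p(1)])
  have bij: "bij_betw (permute_coords p) V V"
    by (rule bij_betwI[where g = "\<lambda>x. x \<circ> p"])
      (use inV cancel in \<open>auto simp: permute_coords_def\<close>)
  have Bij: "permute_coords p \<in> Bij V"
    using bij by (simp add: Bij_def permute_coords_def)
  have reg: "regular_map (m + 1) V g" if r: "r permutes I" "\<And>x. x \<in> V \<Longrightarrow> g x = x \<circ> r" for g r
  proof -
    have "regular_fun (m + 1) V (\<lambda>x. x (r j))" if "j \<in> {1..m + 1}" for j
    proof (rule regular_fun_coord)
      have "r permutes {1..m + 1}" by (rule permutes_subset[OF r(1)]) (auto simp: I_def)
      then show "r j \<in> {1..m + 1}" using that permutes_in_image by metis
    qed
    then have "regular_map (m + 1) V (\<lambda>x. x \<circ> r)" by (simp add: regular_map_iff)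
    then show ?thesis using regular_map_cong[of V g "\<lambda>x. x \<circ> r" "m + 1"] r(2) by blast
  qed
  have "inv_into V (permute_coords p) x = x \<circ> p" if "x \<in> V" for x
  proof (rule inv_into_eq_on[OF Bij, of "\<lambda>x. x \<circ> p", OF _ _ that])
    show "(\<lambda>x. x \<circ> p) \<in> V \<rightarrow> V" using inV(2) by blast
    show "permute_coords p (y \<circ> p) = y" if "y \<in> V" for y
      unfolding permute_coords_def using inV(2)[OF that] cancel(2)[of y] by simp
  qed
  then have "regular_map (m + 1) V (inv_into V (permute_coords p))" by (rule reg[OF p(1)])
  moreover have "regular_map (m + 1) V (permute_coords p)"
    by (rule reg[OF q]) (simp add: permute_coords_def)
  ultimately show ?thesis using Bij by (simp only: Aut_iff)
qed

text \<open>
  A point whose coordinates \<open>y_i\<close> are pairwise different detects the permutation.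
\<close>

lemma permute_coords_inject:
  assumes p: "p permutes I" and q: "q permutes I" and eq: "permute_coords p = permute_coords q"
  shows "p = q"
proof -
  let ?x = "torus_point of_nat 0"
  have x: "?x \<in> V" by (rule torus_point_in_V) (simp add: in_torus_def I_def)
  have "Hilbert_Choice.inv p j = Hilbert_Choice.inv q j" for j
  proof (cases "j \<in> I")
    case True
    then have "Hilbert_Choice.inv p j \<in> I" "Hilbert_Choice.inv q j \<in> I"
      using permutes_in_image[OF permutes_inv[OF p]] permutes_in_image[OF permutes_inv[OF q]] by auto
    moreover have "permute_coords p ?x j = permute_coords q ?x j" by (simp add: eq)
    ultimately show ?thesis using x by (simp add: permute_coords_def)
  next
    case False
    then show ?thesis using permutes_not_in[OF permutes_inv[OF p]] permutes_not_in[OF permutes_inv[OF q]] by simp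
  qed
  then have "Hilbert_Choice.inv p = Hilbert_Choice.inv q" by blast
  then show ?thesis using p q by (metis permutes_inv_inv)
qed

theorem not_solvable_if_five_equal:
  assumes T: "T \<subseteq> I" "card T = 5" and k: "\<And>i j. i \<in> T \<Longrightarrow> j \<in> T \<Longrightarrow> k i = k j"
  shows "\<not> solvable Aut"
proof
  assume sol: "solvable Aut"
  have "finite T" using T(2) card.infinite by fastforce
  then obtain b where b: "bij_betw b {1..5::nat} T"
    using finite_same_card_bij[of "{1..5::nat}" T] T(2) by auto
  define h where "h p = permute_coords (map_permutation {1..5} b p)" for p
  have perm: "map_permutation {1..5} b p permutes T" if "p permutes {1..5}" for p
    using map_permutation_permutes[OF b that] .
  have permI: "map_permutation {1..5} b p permutes I" if "p permutes {1..5}" for p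
    using permutes_subset[OF perm[OF that] T(1)] .
  have kk: "k (map_permutation {1..5} b p i) = k i" if "p permutes {1..5}" for p i
  proof (cases "i \<in> T")
    case True
    then show ?thesis using k permutes_in_image[OF perm[OF that]] by blast
  next
    case False
    then show ?thesis using permutes_not_in[OF perm[OF that] False] by simp
  qed
  have "group_hom (sym_group 5) Aut h"
    unfolding group_hom_def group_hom_axioms_def
  proof (intro conjI homI sym_group_is_group Aut.is_group)
    fix p q assume "p \<in> carrier (sym_group 5)" "q \<in> carrier (sym_group 5)"
    then have pq: "p permutes {1..5}" "q permutes {1..5}" by (simp_all add: sym_group_carrier)
    show hp: "h p \<in> carrier Aut" unfolding h_def by (rule permute_coords_Aut[OF permI[OF pq(1)] kk[OF pq(1)]])
    have hq: "h q \<in> carrier Aut" unfolding h_def by (rule permute_coords_Aut[OF permI[OF pq(2)] kk[OF pq(2)]])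
    have comp: "p \<circ> q permutes {1..5}" using pq by (simp add: permutes_compose)
    have hpq: "h (p \<circ> q) \<in> carrier Aut" unfolding h_def by (rule permute_coords_Aut[OF permI[OF comp] kk[OF comp]])
    have "h (p \<circ> q) = h p \<otimes>\<^bsub>Aut\<^esub> h q"
    proof (rule Aut_eqI[OF hpq])
      show "h p \<otimes>\<^bsub>Aut\<^esub> h q \<in> carrier Aut" using hp hq by simp
      fix x assume x: "x \<in> V"
      let ?p = "map_permutation {1..5} b p" and ?q = "map_permutation {1..5} b q"
      have "Hilbert_Choice.inv (?p \<circ> ?q) = Hilbert_Choice.inv ?q \<circ> Hilbert_Choice.inv ?p"
        using permutes_bij[OF perm[OF pq(1)]] permutes_bij[OF perm[OF pq(2)]] by (rule o_inv_distrib)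
      moreover have "map_permutation {1..5} b (p \<circ> q) = ?p \<circ> ?q"
        using map_permutation_compose'[OF bij_betw_imp_inj_on[OF b] pq(2)] .
      moreover have "x \<circ> Hilbert_Choice.inv ?q \<in> V"
        using Aut_maps[OF hq x] x by (simp add: h_def permute_coords_def)
      ultimately show "h (p \<circ> q) x = (h p \<otimes>\<^bsub>Aut\<^esub> h q) x"
        using x by (simp add: Aut_mult[OF hp hq x]) (simp add: h_def permute_coords_def o_assoc)
    qed
    then show "h (p \<otimes>\<^bsub>sym_group 5\<^esub> q) = h p \<otimes>\<^bsub>Aut\<^esub> h q" by (simp add: sym_group_mult)
  qed
  then interpret h: group_hom "sym_group 5" Aut h .
  have "inj_on h (carrier (sym_group 5))"
  proof (rule inj_onI)
    fix p q assume "p \<in> carrier (sym_group 5)" "q \<in> carrier (sym_group 5)" and eq: "h p = h q"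
    then have pq: "p permutes {1..5}" "q permutes {1..5}" by (simp_all add: sym_group_carrier)
    have "map_permutation {1..5} b p = map_permutation {1..5} b q"
      using permute_coords_inject[OF permI[OF pq(1)] permI[OF pq(2)]] eq by (simp add: h_def)
    moreover have "map_permutation T (inv_into {1..5} b) (map_permutation {1..5} b r) = r" if "r permutes {1..5}" for r
      using map_permutation_compose_inv[OF b that] bij_betw_inv_into_left[OF b] by blast
    ultimately show "p = q" using pq by metis
  qed
  then have "solvable (sym_group 5)" using h.inj_hom_imp_solvable sol by blast
  then show False using sym_group_is_unsolvable[of 5] by simp
qed

end

theorem corollary6p7:
  fixes P :: "'a::{alg_closed_field, field_char_0} poly"
    and m :: nat and k :: "nat \<Rightarrow> nat"
  assumes "m \<ge> 2"
    and "k 1 = 1"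
    and "\<And>i. i \<in> {2..m} \<Longrightarrow> k i \<ge> 2"
    and "Polynomial.degree P \<ge> 2"
  shows "\<not> solvable (variety_Aut (m + 1) (hypersurface m k P)) \<longleftrightarrow>
    (\<exists>i1 i2 i3 i4 i5. {i1, i2, i3, i4, i5} \<subseteq> {1..m} \<and> distinct [i1, i2, i3, i4, i5] \<and>
      k i1 = k i2 \<and> k i2 = k i3 \<and> k i3 = k i4 \<and> k i4 = k i5)"
    (is "_ \<longleftrightarrow> ?five")
proof -
  interpret hypersurface_variety m k P
    by unfold_locales (use assms in auto)
  show ?thesis
    unfolding Aut_def[symmetric]
  proof
    assume "\<not> solvable Aut"
    then obtain c where "\<not> card {i \<in> I. k i = c} \<le> 4" using solvable_if_small_classes by blast
    then have "5 \<le> card {i \<in> I. k i = c}" by simp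
    then obtain T where T: "T \<subseteq> {i \<in> I. k i = c}" "card T = 5" "finite T"
      by (rule obtain_subset_with_card_n)
    then obtain l where l: "set l = T" "distinct l" "length l = 5"
      using finite_distinct_list[of T] distinct_card by metis
    then obtain i1 i2 i3 i4 i5 where i: "l = [i1, i2, i3, i4, i5]"
      by (auto simp: numeral_eq_Suc length_Suc_conv)
    have mem: "i \<in> {1..m}" "k i = c" if "i \<in> set l" for i
      using subsetD[OF T(1), of i] that l(1) by (auto simp: I_def)
    have "{i1, i2, i3, i4, i5} \<subseteq> {1..m}" using mem(1) unfolding i by auto
    moreover have "k i1 = c" "k i2 = c" "k i3 = c" "k i4 = c" "k i5 = c"
      by (rule mem(2), simp add: i)+
    ultimately show ?five using l(2) unfolding i by metis
  next
    assume ?five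
    then obtain i1 i2 i3 i4 i5 where i: "{i1, i2, i3, i4, i5} \<subseteq> {1..m}" "distinct [i1, i2, i3, i4, i5]"
      "k i1 = k i2" "k i2 = k i3" "k i3 = k i4" "k i4 = k i5" by blast
    let ?T = "{i1, i2, i3, i4, i5}"
    have eq: "k i = k j" if "i \<in> ?T" "j \<in> ?T" for i j using that i(3-6) by auto
    have "1 \<notin> ?T"
    proof
      assume "1 \<in> ?T"
      then have "k i = 1" if "i \<in> ?T" for i using eq[OF that] assms(2) by metis
      then have "i = 1" if "i \<in> ?T" for i
        using assms(3)[of i] i(1) that by (cases "i \<ge> 2") fastforce+
      then have "i1 = 1" "i2 = 1" by blast+
      then show False using i(2) by simp
    qed
    then have "?T \<subseteq> I" using i(1) by (fastforce simp: I_def)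
    moreover have "card ?T = 5" using i(2) by simp
    ultimately show "\<not> solvable Aut" using eq by (rule not_solvable_if_five_equal)
  qed
qed

end
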